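(* Let $g:\mathcal P_0\to\mathbb R$ be the CARA betweenness preference functional defined implicitly by $\mathbb E[F(X-g(\mathbb P_X))]=0$, where $F$ and $\mathcal P_0$ satisfy assumptions (F), (P), (U) of the context. Assume that the market coefficients $\theta,\sigma$ are deterministic and that $$\mathcal G(\infty)>\int_0^T|\kappa(s)|^2ds.$$ Let $$\bar\pi_t=(\sigma(t)^\top)^{-1}\kappa(t)\,G\Big(\mathcal G^{-1}\Big(\int_t^T|\kappa(s)|^2ds\Big)\Big),\qquad t\in[0,T),$$ and assume $\bar\pi$ is admissible. Then, for the wealth dynamics $dX^\pi_t=\pi_t^\top\theta(t)\,dt+\pi_t^\top\sigma(t)\,dW^S_t$, $X^\pi_0=x_0$, the strategy $\bar\pi$ is a Type-I equilibrium (dollar-amount) strategy.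
   Context: Market. $T>0$; $\mathbb F=(\mathcal F_t)_{0\le t\le T}$ is the augmented natural filtration of a $(d+k)$-dimensional standard Brownian motion $W=(W^S,W^O)$ ($W^S$ $d$-dimensional, $W^O$ $k$-dimensional) on $(\Omega,\mathcal F_T,\mathbb P)$. Interest rate $0$. $\theta:[0,T]\to\mathbb R^d$ is bounded measurable, $\sigma:[0,T]\to\mathbb R^{d\times d}$ is measurable with $c_1|a|^2\le|\sigma(t)^\top a|^2\le c_2|a|^2$ for all $a\in\mathbb R^d$, a.e. $t$, for some constants $c_1,c_2>0$. $\kappa(t)=\sigma(t)^{-1}\theta(t)$. A trading strategy is an $\mathbb F$-predictable $\mathbb R^d$-valued process $\pi$ with $\int_0^T(|\pi_s^\top\theta(s)|+|\pi_s^\top\sigma(s)|^2)ds<\infty$ a.s.; here $\pi$ is the vector of dollar amounts invested in the stocks. Assumptions on the preference. (F) $F:\mathbb R\to\mathbb R$ is $C^2$, $F(0)=0$, $F'>0$, $F''<0$, and there are $C,\beta_0>0$ with $|F'(x)|+|F''(x)|\le C(1+e^{\beta_0|x|})$ for all $x\in\mathbb R$. (P) $\mathcal P_0$ is a nonempty convex set of probability measures on $\mathbb R$ such that $\mathbb P_X\in\mathcal P_0$ implies $\mathbb P_{\lambda+X}\in\mathcal P_0$ for all $\lambda\in\mathbb R$, and $\int_{\mathbb R}(|F(x)|+F'(x)-F''(x))\mu(dx)<\infty$ for all $\mu\in\mathcal P_0$. (U) With $\xi\sim N(0,1)$, for any $y_0,z_0\in(0,\infty)$ the family $\{F(y\xi+z):y\in[0,y_0],z\in[-z_0,z_0]\}$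 is uniformly integrable. Functions. With $\xi\sim N(0,1)$, $H:[0,\infty)\to\mathbb R$ is defined by $\mathbb E[F(\sqrt y\,\xi-H(y))]=0$; $$G(y)=\frac{\mathbb E[F'(\sqrt y\,\xi-H(y))]}{\mathbb E[-F''(\sqrt y\,\xi-H(y))]},\quad y\ge0;\qquad \mathcal G(x)=\int_0^x\frac1{G(y)^2}dy,\quad x\in[0,\infty].$$ $\mathcal G^{-1}$ is the inverse of $\mathcal G:[0,\infty)\to[0,\mathcal G(\infty))$. Equilibrium. $\mathbb P^t_\xi$ is the regular conditional law of $\xi$ given $\mathcal F_t$. A strategy $\pi$ is admissible ($\pi\in\mathcal A$) if $\mathbb P^t_{X^\pi_T}\in\mathcal P_0$ a.s. for each $t\in[0,T)$. For $\epsilon\in(0,T-t)$ and a bounded $\mathcal F_t$-measurable $\mathbb R^d$-valued $\varphi$, $\bar\pi^{t,\epsilon,\varphi}=\bar\pi+\varphi\mathbf 1_{[t,t+\epsilon)}$, $\bar X=X^{\bar\pi}$, $\bar X^{t,\epsilon,\varphi}=X^{\bar\pi^{t,\epsilon,\varphi}}$. $\bar\pi\in\mathcal A$ is a Type-I equilibrium if for any $t\in[0,T)$ and any such $\varphi$ with $\bar\pi^{t,\epsilon,\varphi}\in\mathcal A$ for all sufficiently small $\epsilon>0$, $\limsup_{\epsilon\to0}\frac1\epsilon\big(g(\mathbb P^t_{\bar X^{t,\epsilon,\varphi}_T})-g(\mathbb P^t_{\bar X_T})\big)\le0$ (a.s.). *)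

theory Defs
  imports "HOL-Probability.Probability"
begin

section \<open>The CARA betweenness preference\<close>

definition uniformly_integrable :: "'a measure \<Rightarrow> ('a \<Rightarrow> real) set \<Rightarrow> bool" where
  "uniformly_integrable M \<A> \<longleftrightarrow>
     (\<forall>f\<in>\<A>. integrable M f) \<and>
     ((\<lambda>c::real. SUP f\<in>\<A>. \<integral>\<^sup>+ \<omega>\<in>{\<omega>. \<bar>f \<omega>\<bar> > c}. ennreal \<bar>f \<omega>\<bar> \<partial>M) \<longlongrightarrow> 0) at_top"

definition assumption_F :: "(real \<Rightarrow> real) \<Rightarrow> bool" where
  "assumption_F F \<longleftrightarrow>
     (\<forall>x. F differentiable at x) \<and> (\<forall>x. deriv F differentiable at x) \<and>
     continuous_on UNIV (deriv (deriv F)) \<and>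
     F 0 = 0 \<and> (\<forall>x. deriv F x > 0) \<and> (\<forall>x. deriv (deriv F) x < 0) \<and>
     (\<exists>C>0. \<exists>\<beta>\<^sub>0>0. \<forall>x. \<bar>deriv F x\<bar> + \<bar>deriv (deriv F) x\<bar> \<le> C * (1 + exp (\<beta>\<^sub>0 * \<bar>x\<bar>)))"

text \<open>The second conjunct is convexity: a probability measure \<open>\<rho>\<close> equal to the mixture
  \<open>u \<mu> + (1 - u) \<nu>\<close> on every Borel set belongs to \<open>\<P>\<^sub>0\<close>.\<close>

definition assumption_P :: "(real \<Rightarrow> real) \<Rightarrow> real measure set \<Rightarrow> bool" where
  "assumption_P F \<P>\<^sub>0 \<longleftrightarrow>
     \<P>\<^sub>0 \<noteq> {} \<and> \<P>\<^sub>0 \<subseteq> space (prob_algebra borel) \<and>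
     (\<forall>\<mu>\<in>\<P>\<^sub>0. \<forall>\<nu>\<in>\<P>\<^sub>0. \<forall>u\<in>{0..1}. \<forall>\<rho>\<in>space (prob_algebra borel).
        (\<forall>B\<in>sets borel. measure \<rho> B = u * measure \<mu> B + (1 - u) * measure \<nu> B) \<longrightarrow> \<rho> \<in> \<P>\<^sub>0) \<and>
     (\<forall>\<mu>\<in>\<P>\<^sub>0. \<forall>c. distr \<mu> borel (\<lambda>x. c + x) \<in> \<P>\<^sub>0) \<and>
     (\<forall>\<mu>\<in>\<P>\<^sub>0. integrable \<mu> (\<lambda>x. \<bar>F x\<bar> + deriv F x - deriv (deriv F) x))"

definition assumption_U :: "(real \<Rightarrow> real) \<Rightarrow> bool" where
  "assumption_U F \<longleftrightarrow>
     (\<forall>y\<^sub>0>0. \<forall>z\<^sub>0>0. uniformly_integrable std_normal_distribution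
        {(\<lambda>x. F (y * x + z)) | y z. y \<in> {0..y\<^sub>0} \<and> z \<in> {-z\<^sub>0..z\<^sub>0}})"

text \<open>The Bochner integral of a non-integrable function is \<open>0\<close> by convention; the predicate
  \<open>has_bochner_integral\<close> excludes such spurious roots.\<close>

definition betweenness :: "(real \<Rightarrow> real) \<Rightarrow> real measure \<Rightarrow> real" where
  "betweenness F \<mu> = (THE c. has_bochner_integral \<mu> (\<lambda>x. F (x - c)) 0)"

definition H_fun :: "(real \<Rightarrow> real) \<Rightarrow> real \<Rightarrow> real" where
  "H_fun F y = (THE h. has_bochner_integral std_normal_distribution (\<lambda>x. F (sqrt y * x - h)) 0)"

definition G_fun :: "(real \<Rightarrow> real) \<Rightarrow> real \<Rightarrow> real" where
  "G_fun F y =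
     (LINT x|std_normal_distribution. deriv F (sqrt y * x - H_fun F y)) /
     (LINT x|std_normal_distribution. - deriv (deriv F) (sqrt y * x - H_fun F y))"

definition calG :: "(real \<Rightarrow> real) \<Rightarrow> ereal \<Rightarrow> ennreal" where
  "calG F x = (\<integral>\<^sup>+ y\<in>{y. 0 \<le> y \<and> ereal y \<le> x}. ennreal (1 / (G_fun F y)\<^sup>2) \<partial>lborel)"

definition calG_inv :: "(real \<Rightarrow> real) \<Rightarrow> ennreal \<Rightarrow> real" where
  "calG_inv F = the_inv_into {0..} (\<lambda>x. calG F (ereal x))"


section \<open>The market\<close>

text \<open>A standard Brownian motion on \<open>[0,T]\<close> with components indexed by \<open>I\<close>: the increments over
  the cells of a partition are independent and \<open>N(0, (t - s) Id)\<close>.\<close>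

definition (in prob_space) standard_brownian_motion ::
    "'i set \<Rightarrow> real \<Rightarrow> ('i \<Rightarrow> real \<Rightarrow> 'a \<Rightarrow> real) \<Rightarrow> bool" where
  "standard_brownian_motion I T B \<longleftrightarrow>
     (\<forall>i\<in>I. \<forall>t\<in>{0..T}. B i t \<in> borel_measurable M) \<and>
     (AE \<omega> in M. \<forall>i\<in>I. B i 0 \<omega> = 0) \<and>
     (AE \<omega> in M. \<forall>i\<in>I. continuous_on {0..T} (\<lambda>t. B i t \<omega>)) \<and>
     (\<forall>i\<in>I. \<forall>s t. 0 \<le> s \<longrightarrow> s < t \<longrightarrow> t \<le> T \<longrightarrow>
        distributed M lborel (\<lambda>\<omega>. B i t \<omega> - B i s \<omega>) (normal_density 0 (sqrt (t - s)))) \<and>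
     (\<forall>(n::nat) u. 0 \<le> u 0 \<longrightarrow> (\<forall>m<n. u m < u (Suc m)) \<longrightarrow> u n \<le> T \<longrightarrow>
        indep_vars (\<lambda>_. borel) (\<lambda>(i, m) \<omega>. B i (u (Suc m)) \<omega> - B i (u m) \<omega>) (I \<times> {..<n}))"

text \<open>The Brownian motion is indexed by \<open>'d + nat\<close>: the components \<open>Inl i\<close> form \<open>W\<^sup>S\<close>, the components
  \<open>Inr j\<close> with \<open>j < k\<close> form \<open>W\<^sup>O\<close>.\<close>

locale market = prob_space M + complete_measure M
  for M :: "'a measure" +
  fixes T :: real
    and k :: nat
    and W :: "'d::finite + nat \<Rightarrow> real \<Rightarrow> 'a \<Rightarrow> real"
    and \<theta> :: "real \<Rightarrow> real^'d"
    and \<sigma> :: "real \<Rightarrow> real^'d^'d"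
  assumes T_pos: "T > 0"
    and W_bm: "standard_brownian_motion (UNIV <+> {..<k}) T W"
    and sets_M: "sets M = sigma_sets (space M)
       ({W i s -` B \<inter> space M | i s B. i \<in> UNIV <+> {..<k} \<and> s \<in> {0..T} \<and> B \<in> sets borel} \<union> null_sets M)"
    and theta_meas: "\<theta> \<in> borel_measurable (restrict_space borel {0..T})"
    and theta_bounded: "bounded (\<theta> ` {0..T})"
    and sigma_meas: "\<sigma> \<in> borel_measurable (restrict_space borel {0..T})"
    and sigma_elliptic: "\<exists>c\<^sub>1>0. \<exists>c\<^sub>2>0. AE t in lborel. t \<in> {0..T} \<longrightarrow>
       (\<forall>a. c\<^sub>1 * (norm a)\<^sup>2 \<le> (norm (transpose (\<sigma> t) *v a))\<^sup>2 \<and>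
            (norm (transpose (\<sigma> t) *v a))\<^sup>2 \<le> c\<^sub>2 * (norm a)\<^sup>2)"
begin

definition WS :: "real \<Rightarrow> 'a \<Rightarrow> real^'d" where
  "WS t \<omega> = (\<chi> i. W (Inl i) t \<omega>)"

definition filt :: "real \<Rightarrow> 'a measure" where
  "filt t = sigma (space M)
     ({W i s -` B \<inter> space M | i s B. i \<in> UNIV <+> {..<k} \<and> s \<in> {0..t} \<and> B \<in> sets borel} \<union> null_sets M)"

definition kappa :: "real \<Rightarrow> real^'d" where
  "kappa t = matrix_inv (\<sigma> t) *v \<theta> t"

definition predictable_algebra :: "(real \<times> 'a) measure" where
  "predictable_algebra = sigma ({0..T} \<times> space M)
     ({{0} \<times> A | A. A \<in> sets (filt 0)} \<union>
      {{s<..t} \<times> A | s t A. 0 \<le> s \<and> s < t \<and> t \<le> T \<and> A \<in> sets (filt s)})"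

definition predictable :: "(real \<Rightarrow> 'a \<Rightarrow> real^'d) \<Rightarrow> bool" where
  "predictable h \<longleftrightarrow> (\<lambda>(t, \<omega>). h t \<omega>) \<in> borel_measurable predictable_algebra"

definition trading_strategy :: "(real \<Rightarrow> 'a \<Rightarrow> real^'d) \<Rightarrow> bool" where
  "trading_strategy \<pi> \<longleftrightarrow> predictable \<pi> \<and>
     (AE \<omega> in M. (\<integral>\<^sup>+ s\<in>{0..T}. ennreal (\<bar>\<pi> s \<omega> \<bullet> \<theta> s\<bar> + (norm (transpose (\<sigma> s) *v \<pi> s \<omega>))\<^sup>2) \<partial>lborel) < \<infinity>)"


subsection \<open>Stochastic integrals with respect to \<open>W\<^sup>S\<close>\<close>

definition simple_integrand :: "nat \<Rightarrow> (nat \<Rightarrow> real) \<Rightarrow> (nat \<Rightarrow> 'a \<Rightarrow> real^'d) \<Rightarrow> bool" where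
  "simple_integrand n u \<eta> \<longleftrightarrow>
     0 \<le> u 0 \<and> (\<forall>j<n. u j < u (Suc j)) \<and> u n \<le> T \<and>
     (\<forall>j<n. \<eta> j \<in> borel_measurable (filt (u j)) \<and> bounded (\<eta> j ` space M))"

definition simple_process :: "nat \<Rightarrow> (nat \<Rightarrow> real) \<Rightarrow> (nat \<Rightarrow> 'a \<Rightarrow> real^'d) \<Rightarrow> real \<Rightarrow> 'a \<Rightarrow> real^'d" where
  "simple_process n u \<eta> s \<omega> = (\<Sum>j<n. indicat_real {u j<..u (Suc j)} s *\<^sub>R \<eta> j \<omega>)"

definition simple_integral :: "nat \<Rightarrow> (nat \<Rightarrow> real) \<Rightarrow> (nat \<Rightarrow> 'a \<Rightarrow> real^'d) \<Rightarrow> real \<Rightarrow> 'a \<Rightarrow> real" where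
  "simple_integral n u \<eta> t \<omega> = (\<Sum>j<n. \<eta> j \<omega> \<bullet> (WS (min (u (Suc j)) t) \<omega> - WS (min (u j) t) \<omega>))"

text \<open>\<open>ito_integral h Z\<close>: the process \<open>Z\<close> is a version of \<open>\<integral>\<^sub>0\<^sup>\<cdot> h\<^sub>s\<^sup>T dW\<^sup>S\<^sub>s\<close> on \<open>[0,T]\<close>, for predictable \<open>h\<close>
  with almost surely square-integrable paths. Usually both limits below are limits in probability;
  passing to a subsequence makes them almost sure, and almost sure limits are limits in
  probability, so the resulting integral is the same (unique up to indistinguishability).\<close>

definition ito_integral :: "(real \<Rightarrow> 'a \<Rightarrow> real^'d) \<Rightarrow> (real \<Rightarrow> 'a \<Rightarrow> real) \<Rightarrow> bool" where
  "ito_integral h Z \<longleftrightarrow> (\<exists>n u \<eta>.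
     (\<forall>m. simple_integrand (n m) (u m) (\<eta> m)) \<and>
     (AE \<omega> in M. (\<lambda>m. \<integral>\<^sup>+ s\<in>{0..T}. ennreal ((norm (simple_process (n m) (u m) (\<eta> m) s \<omega> - h s \<omega>))\<^sup>2) \<partial>lborel)
        \<longlonglongrightarrow> 0) \<and>
     (AE \<omega> in M. uniform_limit {0..T} (\<lambda>m t. simple_integral (n m) (u m) (\<eta> m) t \<omega>) (\<lambda>t. Z t \<omega>)
        sequentially))"

text \<open>\<open>wealth x\<^sub>0 \<pi> X\<close>: \<open>X\<close> is a version of the wealth process \<open>X\<^sup>\<pi>\<close>; it is unique up to
  indistinguishability, and exists for every trading strategy \<open>\<pi>\<close>.\<close>

definition wealth :: "real \<Rightarrow> (real \<Rightarrow> 'a \<Rightarrow> real^'d) \<Rightarrow> (real \<Rightarrow> 'a \<Rightarrow> real) \<Rightarrow> bool" where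
  "wealth x\<^sub>0 \<pi> X \<longleftrightarrow> (\<exists>Z. ito_integral (\<lambda>s \<omega>. transpose (\<sigma> s) *v \<pi> s \<omega>) Z \<and>
     (AE \<omega> in M. \<forall>t\<in>{0..T}. X t \<omega> = x\<^sub>0 + (LINT s:{0..t}|lborel. \<pi> s \<omega> \<bullet> \<theta> s) + Z t \<omega>))"


subsection \<open>Equilibrium\<close>

text \<open>\<open>cond_law t Y L\<close>: \<open>L\<close> is a version of the regular conditional law of \<open>Y\<close> given \<open>\<F>\<^sub>t\<close>.\<close>

definition cond_law :: "real \<Rightarrow> ('a \<Rightarrow> real) \<Rightarrow> ('a \<Rightarrow> real measure) \<Rightarrow> bool" where
  "cond_law t Y L \<longleftrightarrow> Y \<in> borel_measurable M \<and> L \<in> filt t \<rightarrow>\<^sub>M prob_algebra borel \<and>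
     (\<forall>B\<in>sets borel. AE \<omega> in M. measure (L \<omega>) B = real_cond_exp M (filt t) (indicat_real (Y -` B \<inter> space M)) \<omega>)"

definition admissible :: "real \<Rightarrow> real measure set \<Rightarrow> (real \<Rightarrow> 'a \<Rightarrow> real^'d) \<Rightarrow> bool" where
  "admissible x\<^sub>0 \<P>\<^sub>0 \<pi> \<longleftrightarrow> trading_strategy \<pi> \<and>
     (\<exists>X. wealth x\<^sub>0 \<pi> X \<and> (\<forall>t\<in>{0..<T}. \<exists>L. cond_law t (X T) L \<and> (AE \<omega> in M. L \<omega> \<in> \<P>\<^sub>0)))"

definition perturbed :: "(real \<Rightarrow> 'a \<Rightarrow> real^'d) \<Rightarrow> real \<Rightarrow> real \<Rightarrow> ('a \<Rightarrow> real^'d) \<Rightarrow> real \<Rightarrow> 'a \<Rightarrow> real^'d" where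
  "perturbed \<pi> t \<epsilon> \<phi> s \<omega> = \<pi> s \<omega> + indicat_real {t..<t + \<epsilon>} s *\<^sub>R \<phi> \<omega>"

text \<open>For each \<open>\<epsilon>\<close> the conditional law is determined only up to a null set depending on \<open>\<epsilon>\<close>, and \<open>\<epsilon>\<close>
  ranges over a continuum, so a pathwise \<open>limsup\<close> as \<open>\<epsilon>\<close> tends to \<open>0\<close> depends on the versions: no
  nontrivial statement holds for all of them. The condition is therefore that the almost sure
  inequality holds for a suitable choice of the versions \<open>L\<^sub>\<epsilon>\<close>. This amounts to the essential
  \<open>limsup\<close> being at most \<open>0\<close>; in particular it implies that, along each fixed sequence tending to \<open>0\<close>,
  the \<open>limsup\<close> is almost surely at most \<open>0\<close> for every choice of versions.\<close>

definition type_I_equilibrium ::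
    "real \<Rightarrow> real measure set \<Rightarrow> (real measure \<Rightarrow> real) \<Rightarrow> (real \<Rightarrow> 'a \<Rightarrow> real^'d) \<Rightarrow> bool" where
  "type_I_equilibrium x\<^sub>0 \<P>\<^sub>0 g \<pi> \<longleftrightarrow> admissible x\<^sub>0 \<P>\<^sub>0 \<pi> \<and>
     (\<forall>t\<in>{0..<T}. \<forall>\<phi>\<in>borel_measurable (filt t). bounded (\<phi> ` space M) \<longrightarrow>
        (\<forall>\<delta>\<in>{0<..T - t}. (\<forall>\<epsilon>\<in>{0<..<\<delta>}. admissible x\<^sub>0 \<P>\<^sub>0 (perturbed \<pi> t \<epsilon> \<phi>)) \<longrightarrow>
          (\<forall>X X\<^sub>\<epsilon> L. wealth x\<^sub>0 \<pi> X \<longrightarrow> cond_law t (X T) L \<longrightarrow>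
             (\<forall>\<epsilon>\<in>{0<..<\<delta>}. wealth x\<^sub>0 (perturbed \<pi> t \<epsilon> \<phi>) (X\<^sub>\<epsilon> \<epsilon>)) \<longrightarrow>
             (\<exists>L\<^sub>\<epsilon>. (\<forall>\<epsilon>\<in>{0<..<\<delta>}. cond_law t (X\<^sub>\<epsilon> \<epsilon> T) (L\<^sub>\<epsilon> \<epsilon>)) \<and>
                (AE \<omega> in M. Limsup (at_right 0) (\<lambda>\<epsilon>. ereal ((g (L\<^sub>\<epsilon> \<epsilon> \<omega>) - g (L \<omega>)) / \<epsilon>)) \<le> 0)))))"

end

end

theory Submission
  imports Defs "HOL-Real_Asymp.Real_Asymp"
begin

text \<open>For deterministic coefficients, conditionally on \<open>\<F>\<^sub>t\<close> the terminal wealth of \<open>\<pi>\<close> and of each of its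
  perturbations is normal, and \<open>g (N (m, v)) = m + H v\<close>. The function \<open>V t = \<G>\<^sup>-\<^sup>1 (\<integral>\<^sub>t\<^sup>T |\<kappa>|\<^sup>2)\<close> satisfies
  \<open>V t = \<integral>\<^sub>t\<^sup>T G (V s)\<^sup>2 |\<kappa>(s)|\<^sup>2 ds\<close>, so it is the conditional variance under \<open>\<pi>\<close>. As \<open>F\<close> is concave, Stein's
  identity gives the upper bound for \<open>H v' - H v\<close> that \<open>H' = - 1 / (2 G)\<close> suggests, and with it the
  first-order change of mean and of variance caused by a perturbation cancel up to a nonpositive term.

  Conditional normality is obtained from exponential martingales of simple integrands, truncated so
  that they stay bounded along the approximating sequence, and from Levy's uniqueness theorem.\<close>

section \<open>Gaussian integrals of functions of exponential growth\<close>

text \<open>The strategy comes from a pointwise optimisation. A perturbation a at time t adds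
  theta.a per unit time to the mean and 2 w theta.a + |sigma^T a|^2 to the variance, where w kappa
  is the volatility of the candidate; a unit of variance costs 1 / (2 G(V t)). The linear terms
  cancel for w = G(V), and then V' = - G(V)^2 |kappa|^2 with V(T) = 0. Separation of variables turns
  this into \<open>calG\<close> of V t being the tail energy of kappa, and the condition on
  \<open>calG\<close> at infinity says that the solution reaches back to time 0. As kappa is merely
  measurable, the equation is proved in integrated form, by comparing measures.

  Two degeneracies shape the rest. At V t = 0 the quadratic expansion in the variance breaks down;
  there kappa, hence theta, vanishes almost everywhere on the remaining interval, so a perturbation
  gains no drift. And conditional laws are fixed only up to null sets depending on epsilon: explicit
  normal laws are chosen as versions for all epsilon at once, after which the limsup is an estimate
  on real functions at each omega.\<close>

abbreviation (input) std_normal :: "real measure" where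
  "std_normal \<equiv> std_normal_distribution"

definition exp_growth :: "(real \<Rightarrow> real) \<Rightarrow> bool" where
  "exp_growth f \<longleftrightarrow> (\<exists>C b. \<forall>x. \<bar>f x\<bar> \<le> C * exp (b * \<bar>x\<bar>))"

lemma prob_space_std_normal: "prob_space std_normal"
  using real_dist_normal_dist by (simp add: real_distribution_def)

lemma integrable_std_normal_iff:
  fixes f :: "real \<Rightarrow> real"
  assumes [measurable]: "f \<in> borel_measurable borel"
  shows "integrable std_normal f \<longleftrightarrow> integrable lborel (\<lambda>x. std_normal_density x * f x)"
  by (subst integrable_density) auto

text \<open>Completing the square turns \<open>exp (a * x)\<close> times the standard normal density
  into \<open>exp (a\<^sup>2/2)\<close> times the normal density of mean a. The absolute value costs
  only exp(a|x|) <= exp(ax) + exp(-ax).\<close>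

lemma integrable_std_normal_exp: "integrable std_normal (\<lambda>x. exp (a * \<bar>x\<bar>))"
proof -
  have *: "integrable std_normal (\<lambda>x. exp (a * x))" for a :: real
  proof -
    have "integrable lborel (\<lambda>x. exp (a\<^sup>2/2) * normal_density a 1 x)"
      by (intro integrable_mult_right integrable_normal_density) simp
    also have "(\<lambda>x. exp (a\<^sup>2/2) * normal_density a 1 x) = (\<lambda>x. std_normal_density x * exp (a * x))"
      by (rule ext) (simp add: normal_density_def mult.left_commute exp_add[symmetric] power2_eq_square field_simps)
    finally show ?thesis by (subst integrable_std_normal_iff) auto
  qed
  show ?thesis
  proof (rule Bochner_Integration.integrable_bound)
    show "integrable std_normal (\<lambda>x. exp (a * x) + exp ((-a) * x))"
      by (intro Bochner_Integration.integrable_add *)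
    show "AE x in std_normal. norm (exp (a * \<bar>x\<bar>)) \<le> norm (exp (a * x) + exp (- a * x))"
    proof (rule AE_I2)
      fix x :: real
      have "exp (a * x) + exp (- a * x) > 0" by (intro add_pos_pos) auto
      then show "norm (exp (a * \<bar>x\<bar>)) \<le> norm (exp (a * x) + exp (- a * x))" by (auto simp: abs_if)
    qed
  qed auto
qed

text \<open>A single D serves as factor and as rate for all parameters in a compact range. This is
  the dominating function for limits in s and c.\<close>

lemma exp_growth_affine_bound:
  assumes "exp_growth f"
  obtains D where "D \<ge> 0" "\<And>s c x. \<bar>s\<bar> \<le> S \<Longrightarrow> \<bar>c\<bar> \<le> S \<Longrightarrow> \<bar>f (s * x + c)\<bar> \<le> D * exp (D * \<bar>x\<bar>)"
proof -
  from assms obtain C b where Cb: "\<And>x. \<bar>f x\<bar> \<le> C * exp (b * \<bar>x\<bar>)" unfolding exp_growth_def by blast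
  define D where "D = max (\<bar>C\<bar> * exp (\<bar>b\<bar> * \<bar>S\<bar>)) (\<bar>b\<bar> * \<bar>S\<bar>)"
  have "\<bar>f (s * x + c)\<bar> \<le> D * exp (D * \<bar>x\<bar>)" if "\<bar>s\<bar> \<le> S" "\<bar>c\<bar> \<le> S" for s c x
  proof -
    have "\<bar>s * x + c\<bar> \<le> \<bar>s\<bar> * \<bar>x\<bar> + \<bar>c\<bar>" by (metis abs_mult abs_triangle_ineq)
    also have "\<dots> \<le> \<bar>S\<bar> * \<bar>x\<bar> + \<bar>S\<bar>" using that by (intro add_mono mult_right_mono) auto
    finally have 1: "\<bar>s * x + c\<bar> \<le> \<bar>S\<bar> * \<bar>x\<bar> + \<bar>S\<bar>" .
    have "b * \<bar>s * x + c\<bar> \<le> \<bar>b\<bar> * \<bar>s * x + c\<bar>" by (intro mult_right_mono) auto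
    also have "\<dots> \<le> \<bar>b\<bar> * (\<bar>S\<bar> * \<bar>x\<bar> + \<bar>S\<bar>)" using 1 by (intro mult_left_mono) auto
    finally have 2: "exp (b * \<bar>s * x + c\<bar>) \<le> exp (\<bar>b\<bar> * \<bar>S\<bar>) * exp (\<bar>b\<bar> * \<bar>S\<bar> * \<bar>x\<bar>)"
      by (simp add: exp_add[symmetric] algebra_simps)
    have "\<bar>f (s * x + c)\<bar> \<le> \<bar>C\<bar> * exp (b * \<bar>s * x + c\<bar>)"
      by (rule order_trans[OF Cb]) (intro mult_right_mono, auto)
    also have "\<dots> \<le> \<bar>C\<bar> * (exp (\<bar>b\<bar> * \<bar>S\<bar>) * exp (\<bar>b\<bar> * \<bar>S\<bar> * \<bar>x\<bar>))"
      using 2 by (intro mult_left_mono) auto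
    also have "\<dots> = (\<bar>C\<bar> * exp (\<bar>b\<bar> * \<bar>S\<bar>)) * exp (\<bar>b\<bar> * \<bar>S\<bar> * \<bar>x\<bar>)" by simp
    also have "\<dots> \<le> D * exp (D * \<bar>x\<bar>)"
      unfolding D_def by (intro mult_mono) (auto intro!: mult_right_mono simp: le_max_iff_disj)
    finally show ?thesis .
  qed
  moreover have "D \<ge> 0" unfolding D_def by (simp add: le_max_iff_disj)
  ultimately show ?thesis using that by blast
qed

lemma integrable_std_normal_affine:
  assumes "exp_growth f" and [measurable]: "f \<in> borel_measurable borel"
  shows "integrable std_normal (\<lambda>x. f (s * x + c))"
proof -
  obtain D where D: "\<And>x. \<bar>f (s * x + c)\<bar> \<le> D * exp (D * \<bar>x\<bar>)"
    using exp_growth_affine_bound[OF assms(1), of "max \<bar>s\<bar> \<bar>c\<bar>"] by (metis max.cobounded1 max.cobounded2)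
  have "integrable std_normal (\<lambda>x. D * exp (D * \<bar>x\<bar>))"
    by (intro integrable_mult_right integrable_std_normal_exp)
  then show ?thesis
    by (rule Bochner_Integration.integrable_bound) (auto intro!: AE_I2 order_trans[OF D])
qed

lemma tendsto_std_normal_affine:
  assumes "exp_growth f" and f: "continuous_on UNIV f"
    and s: "s \<longlonglongrightarrow> s0" and c: "c \<longlonglongrightarrow> c0"
  shows "(\<lambda>n. LINT x|std_normal. f (s n * x + c n)) \<longlonglongrightarrow>
         (LINT x|std_normal. f (s0 * x + c0))"
proof -
  have [measurable]: "f \<in> borel_measurable borel" using f by (rule borel_measurable_continuous_onI)
  obtain S1 where S1: "\<And>n. \<bar>s n\<bar> \<le> S1" using convergent_imp_Bseq[OF convergentI[OF s]] by (auto simp: Bseq_def)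
  obtain S2 where S2: "\<And>n. \<bar>c n\<bar> \<le> S2" using convergent_imp_Bseq[OF convergentI[OF c]] by (auto simp: Bseq_def)
  obtain D where D: "\<And>n x. \<bar>f (s n * x + c n)\<bar> \<le> D * exp (D * \<bar>x\<bar>)"
    using exp_growth_affine_bound[OF assms(1), of "max S1 S2"] S1 S2 by (metis max.coboundedI1 max.coboundedI2)
  show ?thesis
  proof (rule integral_dominated_convergence)
    show "integrable std_normal (\<lambda>x. D * exp (D * \<bar>x\<bar>))"
      by (intro integrable_mult_right integrable_std_normal_exp)
    show "AE x in std_normal. (\<lambda>n. f (s n * x + c n)) \<longlonglongrightarrow> f (s0 * x + c0)"
      by (intro AE_I2 continuous_on_tendsto_compose[OF f] tendsto_intros s c) auto
  qed (use D in auto)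
qed

text \<open>Integration by parts: the density has derivative -x times itself, and the boundary terms
  vanish because Gaussian decay beats every exponential.\<close>

lemma stein_identity:
  assumes "exp_growth f" "exp_growth f'" and f': "continuous_on UNIV f'"
    and der: "\<And>x. (f has_real_derivative f' x) (at x)"
  shows "integrable std_normal (\<lambda>x. x * f (s * x + c))"
    and "(LINT x|std_normal. x * f (s * x + c)) =
         s * (LINT x|std_normal. f' (s * x + c))"
proof -
  let ?p = std_normal_density
  have cf: "continuous_on UNIV f" by (meson der DERIV_continuous_on has_field_derivative_at_within)
  have [measurable]: "f \<in> borel_measurable borel" "f' \<in> borel_measurable borel"
    using cf f' by (auto intro: borel_measurable_continuous_onI)
  obtain D where D0: "D \<ge> 0" and D: "\<And>x. \<bar>f (s * x + c)\<bar> \<le> D * exp (D * \<bar>x\<bar>)"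
    using exp_growth_affine_bound[OF assms(1), of "max \<bar>s\<bar> \<bar>c\<bar>"] by (metis max.cobounded1 max.cobounded2)
  \<comment> \<open>The extra 1 in the rate absorbs the factor |x| <= exp |x|.\<close>
  have "integrable std_normal (\<lambda>x. D * exp ((D + 1) * \<bar>x\<bar>))"
    by (intro integrable_mult_right integrable_std_normal_exp)
  then show i1: "integrable std_normal (\<lambda>x. x * f (s * x + c))"
  proof (rule Bochner_Integration.integrable_bound)
    have "\<bar>x * f (s * x + c)\<bar> \<le> D * exp ((D + 1) * \<bar>x\<bar>)" for x
    proof -
      have "\<bar>x * f (s * x + c)\<bar> \<le> exp \<bar>x\<bar> * (D * exp (D * \<bar>x\<bar>))"
        unfolding abs_mult using D[of x] exp_ge_add_one_self[of "\<bar>x\<bar>"] by (intro mult_mono) (linarith | simp)+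
      then show ?thesis by (simp add: exp_add[symmetric] algebra_simps)
    qed
    then show "AE x in std_normal. norm (x * f (s * x + c)) \<le> norm (D * exp ((D + 1) * \<bar>x\<bar>))"
      using D0 by auto
  qed auto
  have i2: "integrable std_normal (\<lambda>x. f' (s * x + c))"
    by (intro integrable_std_normal_affine assms) auto
  have j1: "integrable lborel (\<lambda>x. ?p x * (x * f (s * x + c)))"
    and j2: "integrable lborel (\<lambda>x. ?p x * (s * f' (s * x + c)))"
    by (rule integrable_std_normal_iff[THEN iffD1, rotated, OF i1], measurable)
      (rule integrable_std_normal_iff[THEN iffD1, rotated, OF integrable_mult_right[OF i2, of s]], measurable)
  define u where "u x = ?p x * (s * f' (s * x + c)) - ?p x * (x * f (s * x + c))" for x
  have iu: "integrable lborel u"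
    unfolding u_def by (intro Bochner_Integration.integrable_diff j1 j2)
  have p': "(?p has_real_derivative - x * ?p x) (at x)" for x
    unfolding normal_density_def
    by (auto intro!: derivative_eq_intros simp: field_simps power2_eq_square)
  have dv: "((\<lambda>x. ?p x * f (s * x + c)) has_vector_derivative u x) (at x)" for x
    unfolding has_real_derivative_iff_has_vector_derivative[symmetric] u_def
    by (rule DERIV_cong[OF DERIV_mult[OF p' DERIV_chain2[OF der]]])
      (auto intro!: derivative_eq_intros simp: algebra_simps)
  have lim: "((\<lambda>x. ?p x * f (s * x + c)) \<longlongrightarrow> 0) F" if "filterlim (\<lambda>x. \<bar>x\<bar>) at_top F" for F
  proof (rule Lim_null_comparison)
    have "\<bar>?p x * f (s * x + c)\<bar> \<le> D * exp (\<bar>x\<bar> * (D - \<bar>x\<bar> / 2))" for x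
    proof -
      have "?p x \<le> exp (- x\<^sup>2 / 2)"
      proof -
        have "1 \<le> sqrt (2 * pi)" using pi_ge_two by (intro real_le_rsqrt) auto
        then have "1 / sqrt (2 * pi) \<le> 1" by simp
        then show ?thesis unfolding std_normal_density_def
          by (metis exp_ge_zero mult_left_le_one_le real_sqrt_ge_zero zero_le_divide_1_iff mult_2 pi_ge_zero add_nonneg_nonneg)
      qed
      then have "\<bar>?p x * f (s * x + c)\<bar> \<le> exp (- x\<^sup>2 / 2) * (D * exp (D * \<bar>x\<bar>))"
        unfolding abs_mult using D[of x] by (intro mult_mono) auto
      also have "\<dots> = D * exp (\<bar>x\<bar> * (D - \<bar>x\<bar> / 2))"
        by (simp add: exp_add[symmetric] right_diff_distrib power2_eq_square exp_diff exp_minus field_simps)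
      finally show ?thesis .
    qed
    then show "\<forall>\<^sub>F x in F. norm (?p x * f (s * x + c)) \<le> D * exp (\<bar>x\<bar> * (D - \<bar>x\<bar> / 2))" by simp
    have "((\<lambda>y::real. D * exp (y * (D - y / 2))) \<longlongrightarrow> 0) at_top" by real_asymp
    from filterlim_compose[OF this that] show "((\<lambda>x. D * exp (\<bar>x\<bar> * (D - \<bar>x\<bar> / 2))) \<longlongrightarrow> 0) F" .
  qed
  have "(LBINT x=(-\<infinity>)..\<infinity>. u x) = 0 - 0"
  proof (rule interval_integral_FTC_integrable)
    show "isCont u x" for x
      unfolding u_def normal_density_def
      by (intro continuous_intros continuous_on_interior[OF cf] continuous_on_interior[OF f']
          isCont_o2[where g=f] isCont_o2[where g=f']) auto
    show "set_integrable lborel (einterval (-\<infinity>) \<infinity>) u"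
      using iu by (simp add: set_integrable_def)
    show "(((\<lambda>x. ?p x * f (s * x + c)) \<circ> real_of_ereal) \<longlongrightarrow> 0) (at_right (-\<infinity>))"
      unfolding ereal_tendsto_simps1 by (rule lim) real_asymp
    show "(((\<lambda>x. ?p x * f (s * x + c)) \<circ> real_of_ereal) \<longlongrightarrow> 0) (at_left \<infinity>)"
      unfolding ereal_tendsto_simps1 by (rule lim) real_asymp
  qed (use dv in auto)
  then have "(LINT x|lborel. u x) = 0"
    by (simp add: interval_integral_to_infinity_eq interval_lebesgue_integral_def set_lebesgue_integral_def)
  then have "(LINT x|lborel. ?p x * (x * f (s * x + c))) = s * (LINT x|lborel. ?p x * f' (s * x + c))"
    unfolding u_def Bochner_Integration.integral_diff[OF j2 j1] by (simp add: mult.left_commute[of _ s])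
  then show "(LINT x|std_normal. x * f (s * x + c)) =
         s * (LINT x|std_normal. f' (s * x + c))"
    by (subst (1 2) integral_density) auto
qed

section \<open>The functions H and G\<close>

lemma finite_measure_std_normal: "finite_measure std_normal"
  using prob_space_std_normal by (simp add: prob_space_def)

locale cara =
  fixes F :: "real \<Rightarrow> real"
  assumes F: "assumption_F F"
begin

section \<open>Smoothness, concavity and growth of F\<close>

lemma deriv_F: "(F has_real_derivative deriv F x) (at x)"
  and deriv2_F: "(deriv F has_real_derivative deriv (deriv F) x) (at x)"
  using F by (auto simp: assumption_F_def DERIV_deriv_iff_real_differentiable)

lemma deriv_F_pos: "deriv F x > 0"
  and deriv2_F_neg: "deriv (deriv F) x < 0"
  and F_zero: "F 0 = 0"
  and continuous_deriv2_F: "continuous_on UNIV (deriv (deriv F))"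
  using F by (auto simp: assumption_F_def)

lemma continuous_F: "continuous_on UNIV F"
  and continuous_deriv_F: "continuous_on UNIV (deriv F)"
  by (meson deriv_F deriv2_F DERIV_isCont continuous_at_imp_continuous_on)+

lemma measurable_F[measurable]: "F \<in> borel_measurable borel"
  and measurable_deriv_F[measurable]: "deriv F \<in> borel_measurable borel"
  and measurable_deriv2_F[measurable]: "deriv (deriv F) \<in> borel_measurable borel"
  by (auto intro!: borel_measurable_continuous_onI continuous_F continuous_deriv_F continuous_deriv2_F)

lemma F_strict_mono: "x < y \<Longrightarrow> F x < F y"
  by (rule DERIV_pos_imp_increasing) (use deriv_F deriv_F_pos in blast)+

lemma deriv_F_strict_antimono: "x < y \<Longrightarrow> deriv F y < deriv F x"
  by (rule DERIV_neg_imp_decreasing) (use deriv2_F deriv2_F_neg in blast)+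

text \<open>Concavity in the form that survives integration: an upper bound on both sides of a, with
  no second-order remainder to control.\<close>

lemma F_tangent: "F b \<le> F a + deriv F a * (b - a)"
proof (cases a b rule: linorder_cases)
  case less
  obtain z where z: "a < z" "F b - F a = (b - a) * deriv F z"
    using MVT2[OF less, of F "deriv F"] deriv_F by blast
  have "(b - a) * deriv F z \<le> (b - a) * deriv F a"
    using less deriv_F_strict_antimono[OF z(1)] by (intro mult_left_mono) auto
  then show ?thesis using z by (simp add: mult.commute)
next
  case greater
  obtain z where z: "z < a" "F a - F b = (a - b) * deriv F z"
    using MVT2[OF greater, of F "deriv F"] deriv_F by blast
  have "(a - b) * deriv F a \<le> (a - b) * deriv F z"
    using greater deriv_F_strict_antimono[OF z(1)] by (intro mult_left_mono) auto
  then show ?thesis using z by (simp add: algebra_simps)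
qed simp

text \<open>For F itself the mean value theorem from F 0 = 0 bounds |F x| by |x| times a value of F'
  between 0 and x; raising the rate by 1 absorbs the factor |x|.\<close>

lemma exp_growth_deriv_F: "exp_growth (deriv F)"
  and exp_growth_deriv2_F: "exp_growth (deriv (deriv F))"
  and exp_growth_F: "exp_growth F"
proof -
  obtain C b where Cb: "C > 0" "b > 0"
    "\<And>x. \<bar>deriv F x\<bar> + \<bar>deriv (deriv F) x\<bar> \<le> C * (1 + exp (b * \<bar>x\<bar>))"
    using F unfolding assumption_F_def by blast
  have 1: "\<bar>deriv F x\<bar> + \<bar>deriv (deriv F) x\<bar> \<le> 2 * C * exp (b * \<bar>x\<bar>)" for x
  proof -
    have "1 + exp (b * \<bar>x\<bar>) \<le> 2 * exp (b * \<bar>x\<bar>)" using Cb by simp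
    then have "C * (1 + exp (b * \<bar>x\<bar>)) \<le> C * (2 * exp (b * \<bar>x\<bar>))"
      using Cb(1) by (intro mult_left_mono) auto
    then show ?thesis using Cb(3)[of x] by linarith
  qed
  have 2: "\<bar>deriv F x\<bar> \<le> 2 * C * exp (b * \<bar>x\<bar>)" for x using 1[of x] by linarith
  then show "exp_growth (deriv F)" unfolding exp_growth_def by blast
  have "\<bar>deriv (deriv F) x\<bar> \<le> 2 * C * exp (b * \<bar>x\<bar>)" for x using 1[of x] by linarith
  then show "exp_growth (deriv (deriv F))" unfolding exp_growth_def by blast
  have "\<bar>F x\<bar> \<le> 2 * C * exp ((b + 1) * \<bar>x\<bar>)" for x
  proof -
    have "\<exists>z. \<bar>z\<bar> \<le> \<bar>x\<bar> \<and> F x = x * deriv F z"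
    proof (cases x "0::real" rule: linorder_cases)
      case less
      obtain z where z: "x < z" "z < 0" "F 0 - F x = (0 - x) * deriv F z"
        using MVT2[OF less, of F "deriv F"] deriv_F by blast
      then show ?thesis by (intro exI[of _ z]) (auto simp: F_zero)
    next
      case greater
      obtain z where z: "z < x" "z > 0" "F x - F 0 = (x - 0) * deriv F z"
        using MVT2[OF greater, of F "deriv F"] deriv_F by blast
      then show ?thesis by (intro exI[of _ z]) (auto simp: F_zero)
    qed (auto simp: F_zero)
    then obtain z where z: "\<bar>z\<bar> \<le> \<bar>x\<bar>" "F x = x * deriv F z" by blast
    have "\<bar>deriv F z\<bar> \<le> 2 * C * exp (b * \<bar>z\<bar>)" by (rule 2)
    also have "\<dots> \<le> 2 * C * exp (b * \<bar>x\<bar>)" using Cb z by (intro mult_left_mono) auto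
    finally have "\<bar>F x\<bar> \<le> exp \<bar>x\<bar> * (2 * C * exp (b * \<bar>x\<bar>))"
      unfolding z(2) abs_mult using exp_ge_add_one_self[of "\<bar>x\<bar>"] by (intro mult_mono) (linarith | simp)+
    then show ?thesis by (simp add: exp_add[symmetric] algebra_simps)
  qed
  then show "exp_growth F" unfolding exp_growth_def by blast
qed

section \<open>The root H of the defining equation\<close>

lemma integrable_F_affine: "integrable std_normal (\<lambda>x. F (s * x - h))"
  and integrable_deriv_F_affine: "integrable std_normal (\<lambda>x. deriv F (s * x - h))"
  and integrable_deriv2_F_affine: "integrable std_normal (\<lambda>x. deriv (deriv F) (s * x - h))"
  using integrable_std_normal_affine[OF exp_growth_F, of s "-h"]
    integrable_std_normal_affine[OF exp_growth_deriv_F, of s "-h"]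
    integrable_std_normal_affine[OF exp_growth_deriv2_F, of s "-h"] by auto

text \<open>The first argument is a standard deviation, so that H at y is the root of
  \<open>Psi (sqrt y)\<close> and joint continuity includes s = 0. As \<open>sqrt\<close> is
  extended to negative arguments as an odd continuous function, the results on H and G below hold
  for every real y.\<close>

definition Psi :: "real \<Rightarrow> real \<Rightarrow> real" where
  "Psi s h = (LINT x|std_normal. F (s * x - h))"

lemma Psi_strict_antimono: "h < h' \<Longrightarrow> Psi s h' < Psi s h"
  unfolding Psi_def
  by (rule finite_measure.integral_less_AE_space[OF finite_measure_std_normal integrable_F_affine integrable_F_affine])
     (auto simp: F_strict_mono prob_space.emeasure_space_1[OF prob_space_std_normal, simplified])

lemma continuous_Psi: "continuous_on UNIV (\<lambda>(s, h). Psi s h)"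
  unfolding continuous_on_sequentially
proof (intro allI impI ballI)
  fix x :: "nat \<Rightarrow> real \<times> real" and ab :: "real \<times> real"
  assume "(\<forall>n. x n \<in> UNIV) \<and> x \<longlonglongrightarrow> ab"
  moreover define a b where "a = fst ab" "b = snd ab"
  ultimately have "x \<longlonglongrightarrow> (a, b)" by simp
  then have "(\<lambda>n. fst (x n)) \<longlonglongrightarrow> a" "(\<lambda>n. - snd (x n)) \<longlonglongrightarrow> - b"
    by (auto dest: tendsto_fst tendsto_snd intro!: tendsto_intros)
  from tendsto_std_normal_affine[OF exp_growth_F continuous_F this]
  show "((\<lambda>(s, h). Psi s h) \<circ> x) \<longlonglongrightarrow> (case ab of (s, h) \<Rightarrow> Psi s h)"
    by (simp add: Psi_def o_def case_prod_beta a_b_def)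
qed

text \<open>The tangent of F at 0 has mean 0 under a centred normal law, so the integral is
  nonpositive at h = 0. Shifting the argument far to the right makes it positive, and the
  intermediate value theorem applies.\<close>

lemma Psi_root_ex: "\<exists>h. Psi s h = 0"
proof -
  have "Psi s 0 \<le> (LINT x|std_normal. deriv F 0 * s * x)"
    unfolding Psi_def
  proof (rule integral_mono)
    show "integrable std_normal (\<lambda>x. deriv F 0 * s * x)"
      using integrable_std_normal_distribution_moment[of 1] by simp
    show "F (s * x - 0) \<le> deriv F 0 * s * x" for x using F_tangent[of "s * x" 0] by (simp add: F_zero)
  qed (rule integrable_F_affine)
  also have "\<dots> = 0" using integral_std_normal_distribution_moment_odd[of 1] by simp
  finally have le: "Psi s 0 \<le> 0" .
  \<comment> \<open>F may be unbounded above. Cutting it off at the positive value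
    \<open>F 1\<close> makes dominated convergence available and still bounds the integral from
    below.\<close>
  have "(\<lambda>n::nat. LINT x|std_normal. min (F (s * x + real n)) (F 1)) \<longlonglongrightarrow>
        (LINT x|std_normal. F 1)"
  proof (rule integral_dominated_convergence)
    show "integrable std_normal (\<lambda>x. \<bar>F (s * x - 0)\<bar> + F 1)"
      using integrable_F_affine[of s 0] prob_space_std_normal
      by (intro Bochner_Integration.integrable_add integrable_abs finite_measure.integrable_const)
        (auto simp: prob_space_def)
    show "AE x in std_normal. (\<lambda>n. min (F (s * x + real n)) (F 1)) \<longlonglongrightarrow> F 1"
    proof (rule AE_I2)
      fix x :: real
      have "\<forall>\<^sub>F n in sequentially. s * x + real n \<ge> 1" by real_asymp
      then have "\<forall>\<^sub>F n in sequentially. min (F (s * x + real n)) (F 1) = F 1"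
        by eventually_elim (metis F_strict_mono less_eq_real_def min_absorb2)
      then show "(\<lambda>n. min (F (s * x + real n)) (F 1)) \<longlonglongrightarrow> F 1" by (rule tendsto_eventually)
    qed
    show "AE x in std_normal. norm (min (F (s * x + real n)) (F 1)) \<le> \<bar>F (s * x - 0)\<bar> + F 1" for n
    proof (rule AE_I2)
      fix x :: real
      have "F (s * x) \<le> F (s * x + real n)" by (cases n) (auto intro!: less_imp_le F_strict_mono)
      moreover have "F 1 > 0" using F_strict_mono[of 0 1] by (simp add: F_zero)
      ultimately show "norm (min (F (s * x + real n)) (F 1)) \<le> \<bar>F (s * x - 0)\<bar> + F 1" by (auto simp: min_def)
    qed
  qed auto
  moreover have "(LINT x|std_normal. F 1) > 0"
    using F_strict_mono[of 0 1] prob_space.prob_space[OF prob_space_std_normal] by (simp add: F_zero)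
  ultimately have "\<forall>\<^sub>F n in sequentially. (LINT x|std_normal. min (F (s * x + real n)) (F 1)) > 0"
    by (rule order_tendstoD)
  then obtain n :: nat where n: "(LINT x|std_normal. min (F (s * x + real n)) (F 1)) > 0"
    by (auto dest: eventually_happens)
  also have "(LINT x|std_normal. min (F (s * x + real n)) (F 1)) \<le> Psi s (- real n)"
    unfolding Psi_def
  proof (rule integral_mono)
    show "integrable std_normal (\<lambda>x. min (F (s * x + real n)) (F 1))"
      using integrable_F_affine[of s "- real n"] prob_space_std_normal
      by (intro integrable_min finite_measure.integrable_const) (auto simp: prob_space_def)
  qed (use integrable_F_affine[of s "- real n"] in auto)
  finally have ge: "0 \<le> Psi s (- real n)" by simp
  have "continuous_on {- real n..0} (\<lambda>h. (s, h))" by (intro continuous_intros)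
  from continuous_on_compose2[OF continuous_Psi this] have "continuous_on {- real n..0} (Psi s)" by simp
  from IVT2'[OF le ge _ this] show ?thesis by auto
qed

lemma root_iff:
  "has_bochner_integral std_normal (\<lambda>x. F (sqrt y * x - h)) 0 \<longleftrightarrow> h = H_fun F y"
  and Psi_H: "Psi (sqrt y) (H_fun F y) = 0"
proof -
  have iff: "has_bochner_integral std_normal (\<lambda>x. F (sqrt y * x - h)) 0 \<longleftrightarrow> Psi (sqrt y) h = 0" for h
    by (simp add: has_bochner_integral_iff integrable_F_affine Psi_def)
  have un: "h = h'" if "Psi (sqrt y) h = 0" "Psi (sqrt y) h' = 0" for h h'
    using Psi_strict_antimono[of h h' "sqrt y"] Psi_strict_antimono[of h' h "sqrt y"] that
    by (cases h h' rule: linorder_cases) auto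
  obtain h0 where h0: "Psi (sqrt y) h0 = 0" using Psi_root_ex by blast
  have "H_fun F y = h0" unfolding H_fun_def iff by (rule the_equality) (use h0 un in auto)
  then show "Psi (sqrt y) (H_fun F y) = 0" using h0 by simp
  then show "has_bochner_integral std_normal (\<lambda>x. F (sqrt y * x - h)) 0 \<longleftrightarrow> h = H_fun F y"
    unfolding iff using un by auto
qed

text \<open>Strict monotonicity in h replaces an implicit function theorem: the integral has
  opposite strict signs at H + e and H - e, these signs persist for nearby y', and so they enclose
  the root there.\<close>

lemma isCont_H: "isCont (H_fun F) y"
  unfolding isCont_def
proof (rule tendstoI)
  fix e :: real assume e: "e > 0"
  have lim: "((\<lambda>y'. Psi (sqrt y') c) \<longlongrightarrow> Psi (sqrt y) c) (at y)" for c
  proof -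
    have "isCont (\<lambda>y'. Psi (sqrt y') c) y"
    proof -
      have "continuous_on UNIV (\<lambda>y'. (sqrt y', c))" by (intro continuous_intros)
      from continuous_on_compose2[OF continuous_Psi this] show ?thesis
        by (simp add: continuous_on_eq_continuous_at)
    qed
    then show ?thesis by (simp add: isCont_def)
  qed
  have "Psi (sqrt y) (H_fun F y + e) < 0" "Psi (sqrt y) (H_fun F y - e) > 0"
    using Psi_strict_antimono[of "H_fun F y" "H_fun F y + e" "sqrt y"]
      Psi_strict_antimono[of "H_fun F y - e" "H_fun F y" "sqrt y"] e by (auto simp: Psi_H)
  then have "\<forall>\<^sub>F y' in at y. Psi (sqrt y') (H_fun F y + e) < 0" "\<forall>\<^sub>F y' in at y. Psi (sqrt y') (H_fun F y - e) > 0"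
    by (auto intro: order_tendstoD[OF lim])
  then show "\<forall>\<^sub>F y' in at y. dist (H_fun F y') (H_fun F y) < e"
  proof eventually_elim
    case (elim y')
    have "H_fun F y' < H_fun F y + e" "H_fun F y - e < H_fun F y'"
      using elim Psi_strict_antimono[of "H_fun F y + e" "H_fun F y'" "sqrt y'"]
        Psi_strict_antimono[of "H_fun F y'" "H_fun F y - e" "sqrt y'"] Psi_H[of y']
      by (cases "H_fun F y + e" "H_fun F y'" rule: linorder_cases;
          cases "H_fun F y'" "H_fun F y - e" rule: linorder_cases; force)+
    then show ?case by (auto simp: dist_real_def)
  qed
qed

section \<open>The quotient G and the increments of H\<close>

definition G_num :: "real \<Rightarrow> real" where
  "G_num y = (LINT x|std_normal. deriv F (sqrt y * x - H_fun F y))"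

definition G_den :: "real \<Rightarrow> real" where
  "G_den y = (LINT x|std_normal. - deriv (deriv F) (sqrt y * x - H_fun F y))"

lemma G_eq: "G_fun F y = G_num y / G_den y"
  by (simp add: G_fun_def G_num_def G_den_def)

lemma integral_std_normal_pos:
  assumes "integrable std_normal f" "\<And>x. f x > (0::real)"
  shows "(LINT x|std_normal. f x) > 0"
proof -
  have "(LINT x|std_normal. 0) < (LINT x|std_normal. f x)"
    by (rule finite_measure.integral_less_AE_space[OF finite_measure_std_normal _ assms(1)])
     (auto simp: assms prob_space.emeasure_space_1[OF prob_space_std_normal, simplified])
  then show ?thesis by simp
qed

lemma G_num_pos: "G_num y > 0" and G_den_pos: "G_den y > 0"
  unfolding G_num_def G_den_def
  by (rule integral_std_normal_pos; simp add: integrable_deriv_F_affine integrable_deriv2_F_affine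
      deriv_F_pos deriv2_F_neg del: Bochner_Integration.integral_minus)+

lemma G_pos: "G_fun F y > 0"
  by (simp add: G_eq G_num_pos G_den_pos)

lemma continuous_G: "continuous_on UNIV (G_fun F)"
proof -
  have *: "continuous_on UNIV (\<lambda>y. LINT x|std_normal. f (sqrt y * x - H_fun F y))"
    if "exp_growth f" "continuous_on UNIV f" for f
    unfolding continuous_on_sequentially
  proof safe
    fix x and a :: real assume x: "x \<longlonglongrightarrow> a"
    have "(\<lambda>n. sqrt (x n)) \<longlonglongrightarrow> sqrt a" "(\<lambda>n. - H_fun F (x n)) \<longlonglongrightarrow> - H_fun F a"
      using x isCont_tendsto_compose[OF isCont_H] by (auto intro!: tendsto_intros)
    from tendsto_std_normal_affine[OF that this]
    show "((\<lambda>y. LINT x|std_normal. f (sqrt y * x - H_fun F y)) \<circ> x) \<longlonglongrightarrow>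
       (LINT x|std_normal. f (sqrt a * x - H_fun F a))"
      by (simp add: o_def)
  qed
  have "continuous_on UNIV G_num" unfolding G_num_def
    by (rule *[OF exp_growth_deriv_F continuous_deriv_F])
  moreover have "continuous_on UNIV G_den" unfolding G_den_def
    using continuous_on_minus[OF *[OF exp_growth_deriv2_F continuous_deriv2_F]] by simp
  ultimately have "continuous_on UNIV (\<lambda>y. G_num y / G_den y)"
    using G_den_pos by (intro continuous_intros) (auto simp: less_imp_neq[symmetric])
  then show ?thesis by (simp add: G_eq[abs_def])
qed

text \<open>Concavity of \<open>F\<close> gives the first-order upper bound for \<open>H\<close> that a formula for \<open>H'\<close> would
  give, also at \<open>v = 0\<close> and without differentiating \<open>H\<close>.\<close>

lemma H_increment_le:
  "H_fun F v' - H_fun F v \<le> - (sqrt v' - sqrt v) * sqrt v / G_fun F v"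
proof -
  let ?N = std_normal and ?h = "H_fun F v" and ?h' = "H_fun F v'"
  let ?s = "sqrt v" and ?s' = "sqrt v'"
  note st = stein_identity[OF exp_growth_deriv_F exp_growth_deriv2_F continuous_deriv2_F deriv2_F, of ?s "- ?h"]
  have i1: "integrable ?N (\<lambda>x. x * deriv F (?s * x - ?h))" using st(1) by simp
  \<comment> \<open>The derivative of F(s x - h) in s carries a factor x; Stein's identity trades it
    for a second derivative, which is how \<open>G_den\<close> appears.\<close>
  have s1: "(LINT x|?N. x * deriv F (?s * x - ?h)) = - ?s * G_den v" using st(2) by (simp add: G_den_def)
  \<comment> \<open>The tangent inequality at \<open>?s * x - ?h\<close>, integrated. The left side
    is 0, since \<open>?h'\<close> and \<open>?h\<close> are the roots for \<open>?s'\<close> and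
    \<open>?s\<close>.\<close>
  have "Psi ?s' ?h' - Psi ?s ?h \<le>
     (LINT x|?N. (?s' - ?s) * (x * deriv F (?s * x - ?h)) - (?h' - ?h) * deriv F (?s * x - ?h))"
    unfolding Psi_def
  proof (subst Bochner_Integration.integral_diff[symmetric, OF integrable_F_affine integrable_F_affine],
      rule integral_mono)
    show "F (?s' * x - ?h') - F (?s * x - ?h) \<le>
      (?s' - ?s) * (x * deriv F (?s * x - ?h)) - (?h' - ?h) * deriv F (?s * x - ?h)" for x
      using F_tangent[of "?s' * x - ?h'" "?s * x - ?h"] by (simp add: algebra_simps)
  qed (intro Bochner_Integration.integrable_diff integrable_mult_right integrable_F_affine
      integrable_deriv_F_affine i1)+
  also have "\<dots> = (?s' - ?s) * (- ?s * G_den v) - (?h' - ?h) * G_num v"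
    using i1 integrable_deriv_F_affine[of ?s ?h]
    by (subst Bochner_Integration.integral_diff) (auto simp: s1 G_num_def)
  finally have "(?h' - ?h) * G_num v \<le> - (?s' - ?s) * ?s * G_den v" by (simp add: Psi_H algebra_simps del: real_sqrt_mult_self)
  then have "?h' - ?h \<le> - (?s' - ?s) * ?s * G_den v / G_num v"
    using G_num_pos[of v] by (simp only: pos_le_divide_eq)
  then show ?thesis by (simp add: G_eq)
qed

text \<open>Centring by c is the defining equation of H with h = c - m, and that equation has
  exactly one root, so the definite description is determined.\<close>

lemma betweenness_normal:
  "betweenness F (distr std_normal borel (\<lambda>x. m + sqrt v * x)) = m + H_fun F v"
proof -
  have "has_bochner_integral (distr std_normal borel (\<lambda>x. m + sqrt v * x)) (\<lambda>x. F (x - c)) 0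
      \<longleftrightarrow> c - m = H_fun F v" for c
  proof -
    have "has_bochner_integral (distr std_normal borel (\<lambda>x. m + sqrt v * x)) (\<lambda>x. F (x - c)) 0
      \<longleftrightarrow> has_bochner_integral std_normal (\<lambda>x. F (sqrt v * x - (c - m))) 0"
      by (simp add: has_bochner_integral_iff integrable_distr_eq integral_distr algebra_simps)
    then show ?thesis by (simp add: root_iff)
  qed
  then have "\<And>c. has_bochner_integral (distr std_normal borel (\<lambda>x. m + sqrt v * x)) (\<lambda>x. F (x - c)) 0
      \<longleftrightarrow> c = m + H_fun F v" by (metis add_diff_cancel_left' add.commute diff_add_cancel)
  then show ?thesis by (simp add: betweenness_def)
qed

end

section \<open>The variance equation\<close>

context cara
begin

text \<open>Reading \<open>calG\<close> as the mass of [0, x] makes its value at infinity, finite or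
  not, the supremum of its values at integers by continuity from below.\<close>

definition calG_measure :: "real measure" where
  "calG_measure = density lborel (\<lambda>y. ennreal (1 / (G_fun F y)\<^sup>2))"

lemma measurable_G[measurable]: "G_fun F \<in> borel_measurable borel"
  by (rule borel_measurable_continuous_onI[OF continuous_G])

lemma sets_calG_measure[measurable_cong]: "sets calG_measure = sets borel"
  by (simp add: calG_measure_def)

lemma calG_eq: "calG F (ereal x) = emeasure calG_measure {0..x}"
  and calG_infinity: "calG F \<infinity> = emeasure calG_measure {0..}"
  unfolding calG_def calG_measure_def
  by (subst emeasure_density; auto intro!: nn_integral_cong simp: indicator_def)+

text \<open>On bounded intervals the density 1 / G^2 is continuous, so \<open>calG\<close> is finite
  there. This real-valued copy gives access to derivatives and to the intermediate value
  theorem.\<close>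

definition calG_real :: "real \<Rightarrow> real" where
  "calG_real x = integral {0..x} (\<lambda>y. 1 / (G_fun F y)\<^sup>2)"

lemma continuous_density: "continuous_on A (\<lambda>y. 1 / (G_fun F y)\<^sup>2)"
  using G_pos by (intro continuous_intros continuous_on_subset[OF continuous_G]) (auto simp: less_imp_neq[symmetric])

lemma calG_eq_calG_real: assumes "x \<ge> 0" shows "calG F (ereal x) = ennreal (calG_real x)"
proof -
  have "((\<lambda>y. 1 / (G_fun F y)\<^sup>2) has_integral calG_real x) {0..x}"
    unfolding calG_real_def by (intro integrable_integral integrable_continuous_interval continuous_density)
  then have "(\<integral>\<^sup>+ y. ennreal (1 / (G_fun F y)\<^sup>2) * indicator {0..x} y \<partial>lborel) = ennreal (calG_real x)"
    by (intro nn_integral_has_integral_lebesgue') auto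
  then show ?thesis by (simp add: calG_eq calG_measure_def emeasure_density)
qed

lemma calG_real_zero: "calG_real 0 = 0" by (simp add: calG_real_def)

lemma calG_real_deriv: "x \<in> {0..b} \<Longrightarrow> (calG_real has_real_derivative 1 / (G_fun F x)\<^sup>2) (at x within {0..b})"
  unfolding calG_real_def[abs_def] by (intro integral_has_real_derivative continuous_density)

lemma continuous_calG_real: "continuous_on {0..b} calG_real"
  by (rule DERIV_continuous_on) (rule calG_real_deriv)

lemma calG_real_strict_mono: assumes "0 \<le> x" "x < y" shows "calG_real x < calG_real y"
proof (rule DERIV_pos_imp_increasing_open[OF assms(2)])
  fix z assume z: "x < z" "z < y"
  have "(calG_real has_real_derivative 1 / (G_fun F z)\<^sup>2) (at z within {0..y})"
    using z assms by (intro calG_real_deriv) auto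
  then have "(calG_real has_real_derivative 1 / (G_fun F z)\<^sup>2) (at z)"
    using z assms at_within_interior[of z "{0..y}"] by (simp add: interior_atLeastAtMost_real)
  then show "\<exists>d. (calG_real has_real_derivative d) (at z) \<and> d > 0" using G_pos[of z] by (auto intro!: exI)
next
  show "continuous_on {x..y} calG_real" by (rule continuous_on_subset[OF continuous_calG_real[of y]]) (use assms in auto)
qed

lemma calG_real_mono: "0 \<le> x \<Longrightarrow> x \<le> y \<Longrightarrow> calG_real x \<le> calG_real y"
  using calG_real_strict_mono[of x y] by (cases "x = y") auto

lemma calG_real_nonneg: "0 \<le> x \<Longrightarrow> 0 \<le> calG_real x"
  using calG_real_mono[of 0 x] by (simp add: calG_real_zero)

lemma calG_le_iff: "0 \<le> x \<Longrightarrow> 0 \<le> y \<Longrightarrow> calG F (ereal x) \<le> calG F (ereal y) \<longleftrightarrow> x \<le> y"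
  using calG_real_strict_mono[of y x] calG_real_mono[of x y] calG_real_nonneg[of y] by (auto simp: calG_eq_calG_real not_le[symmetric])

lemma calG_inj: "inj_on (\<lambda>x. calG F (ereal x)) {0..}"
  by (rule inj_onI) (metis calG_le_iff atLeast_iff order_antisym order_refl)

lemma calG_surj:
  assumes "c < calG F \<infinity>"
  shows "c \<in> (\<lambda>x. calG F (ereal x)) ` {0..}"
proof -
  have "(SUP n::nat. emeasure calG_measure {0..real n}) = emeasure calG_measure (\<Union>n. {0..real n})"
    by (intro SUP_emeasure_incseq) (auto simp: incseq_def sets_calG_measure)
  also have "(\<Union>n. {0..real n}) = {0::real..}" by (auto intro: real_arch_simple)
  finally have "c < (SUP n::nat. calG F (ereal (real n)))" using assms by (simp add: calG_infinity calG_eq)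
  then obtain n :: nat where n: "c < calG F (ereal (real n))" by (auto simp: less_SUP_iff)
  then have n': "c < ennreal (calG_real (real n))" by (simp add: calG_eq_calG_real)
  then obtain r where r: "c = ennreal r" "r \<ge> 0" by (cases c) (auto simp: top.not_eq_extremum[symmetric])
  then have "r \<le> calG_real (real n)" using n' by (simp add: ennreal_less_iff)
  then obtain x where "0 \<le> x" "x \<le> real n" "calG_real x = r"
    using IVT'[of calG_real 0 r "real n"] continuous_calG_real r calG_real_zero by auto
  then show ?thesis using r by (auto simp: calG_eq_calG_real image_iff intro!: bexI[of _ x])
qed

lemma calG_calG_inv: "c < calG F \<infinity> \<Longrightarrow> calG F (ereal (calG_inv F c)) = c"
  and calG_inv_nonneg: "c < calG F \<infinity> \<Longrightarrow> calG_inv F c \<ge> 0"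
  unfolding calG_inv_def
  using f_the_inv_into_f[OF calG_inj calG_surj] the_inv_into_into[OF calG_inj calG_surj order_refl] by auto

lemma calG_inv_calG: "x \<ge> 0 \<Longrightarrow> calG_inv F (calG F (ereal x)) = x"
  unfolding calG_inv_def by (rule the_inv_into_f_f[OF calG_inj]) simp

lemma calG_inv_le_iff:
  "c < calG F \<infinity> \<Longrightarrow> x \<ge> 0 \<Longrightarrow> calG_inv F c \<le> x \<longleftrightarrow> c \<le> calG F (ereal x)"
  using calG_le_iff[of "calG_inv F c" x] calG_inv_nonneg[of c] by (simp add: calG_calG_inv)

text \<open>The inverse of a continuous injection on the compact interval [0, X] is continuous on
  its image.\<close>

lemma continuous_calG_inv:
  assumes "X \<ge> 0"
  shows "continuous_on {0..calG_real X} (\<lambda>r. calG_inv F (ennreal r))"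
proof -
  have "continuous_on (calG_real ` {0..X}) (\<lambda>r. calG_inv F (ennreal r))"
    by (rule continuous_on_inv[OF continuous_calG_real compact_Icc]) (auto simp: calG_eq_calG_real[symmetric] calG_inv_calG)
  moreover have "{0..calG_real X} \<subseteq> calG_real ` {0..X}"
  proof
    fix r assume "r \<in> {0..calG_real X}"
    then obtain x where "0 \<le> x" "x \<le> X" "calG_real x = r"
      using IVT'[of calG_real 0 r X] continuous_calG_real assms calG_real_zero by auto
    then show "r \<in> calG_real ` {0..X}" by auto
  qed
  ultimately show ?thesis by (rule continuous_on_subset)
qed

section \<open>The tail variance as solution of the integral equation\<close>

context
  fixes c :: "real \<Rightarrow> real" and T :: real
  assumes c[measurable]: "c \<in> borel_measurable borel" and c_nonneg: "\<And>s. c s \<ge> 0" and T: "T > 0"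
    and small: "(\<integral>\<^sup>+ s\<in>{0..T}. ennreal (c s) \<partial>lborel) < calG F \<infinity>"
begin

definition tail_energy :: "real \<Rightarrow> ennreal" where "tail_energy t = (\<integral>\<^sup>+ s\<in>{t..T}. ennreal (c s) \<partial>lborel)"
definition tail_variance :: "real \<Rightarrow> real" where "tail_variance t = calG_inv F (tail_energy t)"

lemma tail_energy_antimono: "s \<le> t \<Longrightarrow> tail_energy t \<le> tail_energy s"
  unfolding tail_energy_def by (intro nn_integral_mono) (auto split: split_indicator)

lemma tail_energy_less: "t \<in> {0..T} \<Longrightarrow> tail_energy t < calG F \<infinity>"
  using small tail_energy_antimono[of 0 t] unfolding tail_energy_def by auto

lemma tail_variance_nonneg: "t \<in> {0..T} \<Longrightarrow> tail_variance t \<ge> 0"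
  unfolding tail_variance_def by (intro calG_inv_nonneg tail_energy_less)

lemma calG_tail_variance: "t \<in> {0..T} \<Longrightarrow> calG F (ereal (tail_variance t)) = tail_energy t"
  unfolding tail_variance_def by (intro calG_calG_inv tail_energy_less)

lemma tail_variance_le_iff: "t \<in> {0..T} \<Longrightarrow> x \<ge> 0 \<Longrightarrow> tail_variance t \<le> x \<longleftrightarrow> tail_energy t \<le> calG F (ereal x)"
  unfolding tail_variance_def by (intro calG_inv_le_iff tail_energy_less)

lemma tail_variance_antimono: "s \<in> {0..T} \<Longrightarrow> t \<in> {0..T} \<Longrightarrow> s \<le> t \<Longrightarrow> tail_variance t \<le> tail_variance s"
  using tail_variance_le_iff[of t "tail_variance s"] tail_variance_nonneg[of s] tail_energy_antimono[of s t] by (simp add: calG_tail_variance)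

lemma tail_variance_eq_0D: "t \<in> {0..T} \<Longrightarrow> tail_variance t = 0 \<Longrightarrow> tail_energy t = 0"
  using calG_tail_variance[of t] by (simp add: calG_eq_calG_real calG_real_zero)

lemma tail_variance_T: "tail_variance T = 0"
proof -
  have "tail_energy T = 0" unfolding tail_energy_def
    by (rule nn_integral_zero', rule AE_mp[OF AE_lborel_singleton[of T]]) (auto split: split_indicator)
  then show ?thesis using tail_variance_le_iff[of T 0] tail_variance_nonneg[of T] T by auto
qed

text \<open>By smallness the total energy is the value of \<open>calG\<close> at a real point, hence
  finite. The tail energy is then a continuous real function with values in an interval on which the
  inverse of \<open>calG\<close> is continuous.\<close>

lemma continuous_tail_variance: "continuous_on {0..T} tail_variance"
proof -
  have fin: "tail_energy 0 = ennreal (calG_real (tail_variance 0))" using calG_tail_variance[of 0] tail_variance_nonneg[of 0] T by (simp add: calG_eq_calG_real)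
  have si: "set_integrable lborel {0..T} c"
    unfolding set_integrable_def
  proof (rule integrableI_bounded)
    have "(\<integral>\<^sup>+ x. ennreal (norm (indicator {0..T} x *\<^sub>R c x)) \<partial>lborel) = tail_energy 0"
      unfolding tail_energy_def by (intro nn_integral_cong) (auto simp: c_nonneg split: split_indicator)
    then show "(\<integral>\<^sup>+ x. ennreal (norm (indicator {0..T} x *\<^sub>R c x)) \<partial>lborel) < \<infinity>" using fin by simp
  qed simp
  then have int: "c integrable_on {0..T}" by (rule set_borel_integral_eq_integral)
  define kk where "kk t = integral {t..T} c" for t
  have tail_energy: "tail_energy t = ennreal (kk t)" "0 \<le> kk t" "kk t \<le> calG_real (tail_variance 0)" if "t \<in> {0..T}" for t
  proof -
    have "(c has_integral kk t) {t..T}"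
      unfolding kk_def by (intro integrable_integral integrable_on_subinterval[OF int]) (use that in auto)
    then have "(\<integral>\<^sup>+ s. ennreal (c s) * indicator {t..T} s \<partial>lborel) = ennreal (kk t)"
      by (intro nn_integral_has_integral_lebesgue') (auto simp: c_nonneg)
    then show tail_energy: "tail_energy t = ennreal (kk t)" by (simp add: tail_energy_def)
    show 0: "0 \<le> kk t" unfolding kk_def
      by (intro integral_nonneg integrable_on_subinterval[OF int]) (use that c_nonneg in auto)
    have "ennreal (kk t) \<le> ennreal (calG_real (tail_variance 0))" using tail_energy_antimono[of 0 t] that by (simp add: fin[symmetric] tail_energy)
    then show "kk t \<le> calG_real (tail_variance 0)" using calG_real_nonneg[OF tail_variance_nonneg[of 0]] T by simp
  qed
  have "continuous_on {0..T} kk"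
    unfolding kk_def by (rule indefinite_integral_continuous_1'[OF int])
  then have "continuous_on {0..T} (\<lambda>t. calG_inv F (ennreal (kk t)))"
    by (rule continuous_on_compose2[OF continuous_calG_inv[of "tail_variance 0"], rotated]) (use tail_energy T tail_variance_nonneg[of 0] in auto)
  then show ?thesis by (rule continuous_on_eq) (simp add: tail_variance_def tail_energy)
qed

text \<open>Both sides are the integral of \<open>G\<^sup>2\<close> against the same measure: \<open>tail_variance\<close> maps \<open>c(s) ds\<close> on \<open>[t,T]\<close> to
  \<open>dy / G(y)\<^sup>2\<close> on \<open>[0, tail_variance t]\<close>.\<close>

lemma tail_variance_equation:
  assumes t: "t \<in> {0..T}"
  shows "(\<integral>\<^sup>+ s\<in>{t..T}. ennreal ((G_fun F (tail_variance s))\<^sup>2 * c s) \<partial>lborel) = ennreal (tail_variance t)"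
proof -
  \<comment> \<open>Extended by 0, the tail variance is Borel on the whole line and can serve as a
    map between measures.\<close>
  define w where "w s = (if s \<in> {0..T} then tail_variance s else 0)" for s
  have w[measurable]: "w \<in> borel_measurable borel"
    unfolding w_def by (rule borel_measurable_continuous_on_if[OF _ continuous_tail_variance]) auto
  define N0 where "N0 = density lborel (\<lambda>s. ennreal (c s) * indicator {t..T} s)"
  define N1 where "N1 = distr N0 borel w"
  define N2 where "N2 = density lborel (\<lambda>y. ennreal (1 / (G_fun F y)\<^sup>2) * indicator {0..tail_variance t} y)"
  have [measurable_cong]: "sets N0 = sets borel" "sets N1 = sets borel" "sets N2 = sets borel"
    by (simp_all add: N0_def N1_def N2_def)
  have N1_le: "emeasure N1 {..x} = (\<integral>\<^sup>+ s\<in>{s\<in>{t..T}. tail_variance s \<le> x}. ennreal (c s) \<partial>lborel)" for x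
  proof -
    have "emeasure N1 {..x} = emeasure N0 (w -` {..x})"
      unfolding N1_def by (subst emeasure_distr) (auto simp: N0_def)
    also have "\<dots> = (\<integral>\<^sup>+ s. ennreal (c s) * indicator {t..T} s * indicator (w -` {..x}) s \<partial>lborel)"
      unfolding N0_def by (rule emeasure_density) (auto intro: measurable_sets_borel[OF w])
    also have "\<dots> = (\<integral>\<^sup>+ s\<in>{s\<in>{t..T}. tail_variance s \<le> x}. ennreal (c s) \<partial>lborel)"
      using t by (intro nn_integral_cong) (auto simp: w_def split: split_indicator)
    finally show ?thesis .
  qed
  have N2_le: "emeasure N2 {..x} = (if x < 0 then 0 else calG F (ereal (min x (tail_variance t))))" for x
  proof -
    have "emeasure N2 {..x} = (\<integral>\<^sup>+ y. ennreal (1 / (G_fun F y)\<^sup>2) * indicator {0..tail_variance t} y * indicator {..x} y \<partial>lborel)"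
      unfolding N2_def by (rule emeasure_density) auto
    also have "\<dots> = (\<integral>\<^sup>+ y. ennreal (1 / (G_fun F y)\<^sup>2) * indicator {0..min x (tail_variance t)} y \<partial>lborel)"
      by (intro nn_integral_cong) (auto split: split_indicator)
    finally show ?thesis
      using tail_variance_nonneg[OF t] by (auto simp: calG_eq calG_measure_def emeasure_density simp del: ereal_min)
  qed
  \<comment> \<open>Half-lines suffice: both measures are finite, so they are identified by their
    distribution functions.\<close>
  have eq: "emeasure N1 {..x} = emeasure N2 {..x}" for x
  proof (cases "x < 0")
    case True
    then have "{s \<in> {t..T}. tail_variance s \<le> x} = {}" using order_trans[OF tail_variance_nonneg, of _ x] t by fastforce
    then show ?thesis using True by (simp add: N1_le N2_le)
  next
    case False
    then have x: "x \<ge> 0" by simp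
    show ?thesis
    proof (cases "tail_variance t \<le> x")
      case True
      have "tail_variance s \<le> x" if "s \<in> {t..T}" for s using tail_variance_antimono[OF t, of s] t that True by auto
      then have "{s \<in> {t..T}. tail_variance s \<le> x} = {t..T}" by auto
      then show ?thesis using True x t by (simp add: N1_le N2_le calG_tail_variance tail_energy_def)
    next
      case False
      \<comment> \<open>The tail variance is constant where c vanishes, so the level x may be
        attained on a whole interval. The least point s1 of the sublevel set bounds its mass from
        above; any point s0 at level x bounds it from below.\<close>
      let ?S = "{s \<in> {t..T}. tail_variance s \<le> x}"
      have cont: "continuous_on {t..T} tail_variance" by (rule continuous_on_subset[OF continuous_tail_variance]) (use t in auto)
      obtain s0 where s0: "t \<le> s0" "s0 \<le> T" "tail_variance s0 = x"
        using IVT2'[of tail_variance T x t] False x tail_variance_T t cont by auto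
      have "?S = {t..T} \<inter> tail_variance -` {..x}" by auto
      then have "closed ?S"
        using continuous_closed_preimage[OF cont closed_atLeastAtMost closed_atMost[of x]] by metis
      then have "Inf ?S \<in> ?S" using s0 by (intro closed_contains_Inf) (auto intro!: bdd_belowI[of _ t])
      moreover have "?S \<subseteq> {Inf ?S..T}" by (auto intro!: cInf_lower bdd_belowI[of _ t])
      ultimately obtain s1 where s1: "s1 \<in> ?S" "?S \<subseteq> {s1..T}" by blast
      have "emeasure N1 {..x} \<le> tail_energy s1"
        unfolding N1_le tail_energy_def using s1(2) by (intro nn_integral_mono) (auto split: split_indicator)
      also have "\<dots> \<le> calG F (ereal x)" using s1(1) x t tail_variance_le_iff[of s1 x] by auto
      finally have "emeasure N1 {..x} \<le> calG F (ereal x)" .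
      moreover have "calG F (ereal x) \<le> emeasure N1 {..x}"
      proof -
        have "{s0..T} \<subseteq> ?S" using tail_variance_antimono[of s0] s0 t by auto
        then have "tail_energy s0 \<le> emeasure N1 {..x}"
          unfolding N1_le tail_energy_def by (intro nn_integral_mono) (auto split: split_indicator)
        then show ?thesis using calG_tail_variance[of s0] s0 t by simp
      qed
      ultimately show ?thesis using x False by (simp add: N2_le min_def)
    qed
  qed
  have "N1 = N2"
  proof (rule cdf_unique')
    have "emeasure N0 UNIV = tail_energy t" unfolding N0_def tail_energy_def by (subst emeasure_density) auto
    also have "\<dots> < \<infinity>" using calG_tail_variance[OF t] calG_eq_calG_real[OF tail_variance_nonneg[OF t]] by (metis ennreal_less_top infinity_ennreal_def)
    finally have N0: "emeasure N0 UNIV < \<infinity>" .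
    then have "finite_measure N0" by (intro finite_measureI) (auto simp: N0_def)
    then have "finite_measure N1" unfolding N1_def by (rule finite_measure.finite_measure_distr) measurable
    then show "finite_borel_measure N1"
      by (intro finite_borel_measure.intro finite_borel_measure_axioms.intro) (simp_all add: N1_def)
    have "emeasure N2 UNIV = calG F (ereal (tail_variance t))"
      unfolding N2_def by (subst emeasure_density) (auto simp: calG_eq calG_measure_def emeasure_density)
    also have "\<dots> < \<infinity>" by (simp add: calG_eq_calG_real tail_variance_nonneg[OF t])
    finally have "emeasure N2 UNIV < \<infinity>" .
    then have "finite_measure N2" by (intro finite_measureI) (auto simp: N2_def)
    then show "finite_borel_measure N2"
      by (intro finite_borel_measure.intro finite_borel_measure_axioms.intro) (simp_all add: N2_def)
    show "cdf N1 = cdf N2" by (rule ext) (simp add: cdf_def measure_def eq)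
  qed
  have "(\<integral>\<^sup>+ s\<in>{t..T}. ennreal ((G_fun F (tail_variance s))\<^sup>2 * c s) \<partial>lborel) = (\<integral>\<^sup>+ s. ennreal ((G_fun F (w s))\<^sup>2) \<partial>N0)"
    unfolding N0_def
  proof (subst nn_integral_density, measurable, rule nn_integral_cong)
    fix s
    show "ennreal ((G_fun F (tail_variance s))\<^sup>2 * c s) * indicator {t..T} s =
      ennreal (c s) * indicator {t..T} s * ennreal ((G_fun F (w s))\<^sup>2)"
      using t by (auto simp: w_def ennreal_mult c_nonneg mult_ac split: split_indicator)
  qed
  also have "\<dots> = (\<integral>\<^sup>+ y. ennreal ((G_fun F y)\<^sup>2) \<partial>N1)"
    unfolding N1_def by (subst nn_integral_distr) auto
  also have "\<dots> = (\<integral>\<^sup>+ y. indicator {0..tail_variance t} y \<partial>lborel)"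
    unfolding \<open>N1 = N2\<close> N2_def
  proof (subst nn_integral_density, simp, simp, rule nn_integral_cong)
    fix y :: real
    have "ennreal (1 / (G_fun F y)\<^sup>2) * ennreal ((G_fun F y)\<^sup>2) = 1"
      using G_pos[of y] by (subst ennreal_mult[symmetric]) auto
    then show "ennreal (1 / (G_fun F y)\<^sup>2) * indicator {0..tail_variance t} y * ennreal ((G_fun F y)\<^sup>2) = indicator {0..tail_variance t} y"
      by (auto split: split_indicator)
  qed
  also have "\<dots> = ennreal (tail_variance t)" using tail_variance_nonneg[OF t] by simp
  finally show ?thesis .
qed

end

end

section \<open>Independence of Brownian increments\<close>

lemma finite_set_grid:
  fixes S :: "real set"
  assumes "finite S" "S \<noteq> {}"
  obtains N w where "\<And>l. l < N \<Longrightarrow> w l < w (Suc l)" "w ` {..N} = S"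
proof
  let ?ws = "sorted_list_of_set S"
  have len: "length ?ws > 0" using assms by (simp add: card_gt_0_iff)
  show "?ws ! l < ?ws ! Suc l" if "l < length ?ws - 1" for l
    using that assms by (intro sorted_wrt_nth_less[of "(<)"]) (auto simp: strict_sorted_iff)
  have "{..length ?ws - 1} = {..<length ?ws}" using len by auto
  then have "(!) ?ws ` {..length ?ws - 1} = set ?ws" by (auto simp: set_conv_nth)
  then show "(!) ?ws ` {..length ?ws - 1} = S" using assms by simp
qed

lemma grid_mono:
  fixes w :: "nat \<Rightarrow> real"
  assumes "\<And>l. l < N \<Longrightarrow> w l < w (Suc l)" "i \<le> j" "j \<le> N"
  shows "w i \<le> w j"
  using assms(2,3)
proof (induction j)
  case (Suc j)
  then show ?case using assms(1)[of j] by (cases "i = Suc j") auto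
qed simp

lemma borel_measurable_vecI:
  fixes f :: "'a \<Rightarrow> real ^ 'n::finite"
  assumes "\<And>i. (\<lambda>x. f x $ i) \<in> borel_measurable N"
  shows "f \<in> borel_measurable N"
  unfolding borel_measurable_euclidean_space[of f]
  using assms by (auto simp: Basis_vec_def inner_axis)

lemma (in prob_space) indep_vars_subset':
  assumes "indep_vars M' X I" "J \<subseteq> I"
  shows "indep_vars M' X J"
  using assms unfolding indep_vars_def by (auto intro: indep_sets_mono_index)

lemma (in prob_space) indep_set_mono:
  assumes "indep_set A B" "A' \<subseteq> A" "B' \<subseteq> B"
  shows "indep_set A' B'"
  using assms unfolding indep_sets2_eq by (meson subset_eq)

section \<open>The filtration and its cylinder events\<close>

context market
begin

abbreviation idx :: "('d + nat) set" where "idx \<equiv> UNIV <+> {..<k}"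

lemma W_measurable: "i \<in> idx \<Longrightarrow> t \<in> {0..T} \<Longrightarrow> W i t \<in> borel_measurable M"
  and W_zero: "AE \<omega> in M. \<forall>i\<in>idx. W i 0 \<omega> = 0"
  and W_distributed: "i \<in> idx \<Longrightarrow> 0 \<le> s \<Longrightarrow> s < t \<Longrightarrow> t \<le> T \<Longrightarrow>
    distributed M lborel (\<lambda>\<omega>. W i t \<omega> - W i s \<omega>) (normal_density 0 (sqrt (t - s)))"
  and W_indep: "0 \<le> u 0 \<Longrightarrow> (\<And>m. m < n \<Longrightarrow> u m < u (Suc m)) \<Longrightarrow> u n \<le> T \<Longrightarrow>
    indep_vars (\<lambda>_. borel) (\<lambda>(i, m) \<omega>. W i (u (Suc m)) \<omega> - W i (u m) \<omega>) (idx \<times> {..<n})"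
  using W_bm unfolding standard_brownian_motion_def by auto

lemma space_filt[simp]: "space (filt t) = space M"
  unfolding filt_def by (rule space_measure_of) (auto dest: null_setsD2 sets.sets_into_space)

lemma sets_filt: "sets (filt t) = sigma_sets (space M)
    ({W i s -` B \<inter> space M | i s B. i \<in> idx \<and> s \<in> {0..t} \<and> B \<in> sets borel} \<union> null_sets M)"
  unfolding filt_def by (rule sets_measure_of) (auto dest: null_setsD2 sets.sets_into_space)

lemma sets_filt_mono: assumes "s \<le> t" shows "sets (filt s) \<subseteq> sets (filt t)"
proof -
  have "{0..s} \<subseteq> {0..t}" using assms by auto
  then show ?thesis unfolding sets_filt by (intro sigma_sets_mono' Un_mono) blast+
qed

lemma sets_filt_subset: assumes "t \<le> T" shows "sets (filt t) \<subseteq> sets M"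
  unfolding sets_filt
  by (rule sets.sigma_sets_subset) (use assms in \<open>auto intro!: measurable_sets[OF W_measurable]\<close>)

lemma subalgebra_filt: "t \<le> T \<Longrightarrow> subalgebra M (filt t)"
  unfolding subalgebra_def using sets_filt_subset by auto

lemma filt_measurable_mono: "s \<le> t \<Longrightarrow> f \<in> measurable (filt s) N \<Longrightarrow> f \<in> measurable (filt t) N"
  using sets_filt_mono[of s t] by (auto simp: measurable_def)

lemma filt_measurable_M: "t \<le> T \<Longrightarrow> f \<in> measurable (filt t) N \<Longrightarrow> f \<in> measurable M N"
  using sets_filt_subset[of t] by (auto simp: measurable_def)

lemma W_filt_measurable: "i \<in> idx \<Longrightarrow> s \<in> {0..t} \<Longrightarrow> W i s \<in> borel_measurable (filt t)"
  by (rule measurableI) (auto simp: sets_filt)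

lemma WS_filt_measurable: "s \<in> {0..t} \<Longrightarrow> WS s \<in> borel_measurable (filt t)"
  by (rule borel_measurable_vecI) (auto simp: WS_def intro!: W_filt_measurable)


lemma WS_measurable: "s \<in> {0..T} \<Longrightarrow> WS s \<in> borel_measurable M"
  by (rule filt_measurable_M[OF order_refl WS_filt_measurable])

definition cylinder :: "(('d + nat) \<times> real) set \<Rightarrow> (('d + nat) \<times> real \<Rightarrow> real set) \<Rightarrow> 'a set" where
  "cylinder J E = {\<omega>\<in>space M. \<forall>p\<in>J. W (fst p) (snd p) \<omega> \<in> E p}"

definition cylinders :: "real \<Rightarrow> 'a set set" where
  "cylinders a = {cylinder J E | J E. finite J \<and> J \<subseteq> idx \<times> {0..a} \<and> (\<forall>p\<in>J. E p \<in> sets borel)}"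

lemma cylinder_sets:
  assumes "finite J" "J \<subseteq> idx \<times> {0..a}" "\<And>p. p \<in> J \<Longrightarrow> E p \<in> sets borel"
  shows "cylinder J E \<in> sets (filt a)"
proof -
  have "{\<omega>\<in>space (filt a). \<forall>p\<in>J. W (fst p) (snd p) \<omega> \<in> E p} \<in> sets (filt a)"
  proof (rule sets.sets_Collect_finite_All[OF _ assms(1)])
    fix p assume p: "p \<in> J"
    then have "W (fst p) (snd p) \<in> borel_measurable (filt a)"
      using assms(2) by (intro W_filt_measurable) (metis mem_Times_iff subsetD)+
    from measurable_sets[OF this assms(3)[OF p]]
    show "{\<omega> \<in> space (filt a). W (fst p) (snd p) \<omega> \<in> E p} \<in> sets (filt a)"
      by (simp add: vimage_def Int_def conj_commute)
  qed
  then show ?thesis by (simp add: cylinder_def)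
qed

lemma cylinders_subset: "cylinders a \<subseteq> sets (filt a)"
  using cylinder_sets by (auto simp: cylinders_def)

text \<open>Adding the null sets preserves stability under intersections because the measure is
  complete: every subset of a null set is again a null set. The generator of the augmented
  filtration thus becomes a pi-system.\<close>

lemma Int_stable_cylinders: "Int_stable (cylinders a \<union> null_sets M)"
  unfolding Int_stable_def
proof (intro ballI)
  fix A B assume "A \<in> cylinders a \<union> null_sets M" "B \<in> cylinders a \<union> null_sets M"
  then consider "A \<in> cylinders a" "B \<in> cylinders a" | "A \<in> null_sets M" | "B \<in> null_sets M" by auto
  then show "A \<inter> B \<in> cylinders a \<union> null_sets M"
  proof cases
    case 1
    then obtain J E J' E' where *: "A = cylinder J E" "finite J" "J \<subseteq> idx \<times> {0..a}" "\<forall>p\<in>J. E p \<in> sets borel"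
       "B = cylinder J' E'" "finite J'" "J' \<subseteq> idx \<times> {0..a}" "\<forall>p\<in>J'. E' p \<in> sets borel"
      unfolding cylinders_def by blast
    let ?E = "\<lambda>p. (if p \<in> J then E p else UNIV) \<inter> (if p \<in> J' then E' p else UNIV)"
    have "A \<inter> B = cylinder (J \<union> J') ?E" using * by (auto simp: cylinder_def)
    moreover have "cylinder (J \<union> J') ?E \<in> cylinders a"
      unfolding cylinders_def using * by (intro CollectI exI[of _ "J \<union> J'"] exI[of _ ?E]) auto
    ultimately show ?thesis by auto
  next
    case 2
    then have "A \<inter> B \<in> null_sets M" by (rule complete2[rotated]) simp
    then show ?thesis by simp
  next
    case 3
    then have "A \<inter> B \<in> null_sets M" by (rule complete2[rotated]) simp
    then show ?thesis by simp
  qed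
qed

lemma sets_filt_cylinders: "sets (filt a) \<subseteq> sigma_sets (space M) (cylinders a \<union> null_sets M)"
  unfolding sets_filt
proof (rule sigma_sets_mono', rule Un_mono)
  show "{W i s -` B \<inter> space M |i s B. i \<in> idx \<and> s \<in> {0..a} \<and> B \<in> sets borel} \<subseteq> cylinders a"
  proof (rule subsetI)
    fix A assume "A \<in> {W i s -` B \<inter> space M |i s B. i \<in> idx \<and> s \<in> {0..a} \<and> B \<in> sets borel}"
    then obtain i s B where "A = W i s -` B \<inter> space M" "i \<in> idx" "s \<in> {0..a}" "B \<in> sets borel" by blast
    then show "A \<in> cylinders a"
      unfolding cylinders_def
      by (intro CollectI exI[of _ "{(i, s)}"] exI[of _ "\<lambda>_. B"]) (auto simp: cylinder_def)
  qed
qed simp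

text \<open>Brownian motion is specified through increments over the cells of a partition. A
  cylinder event up to time a is, almost surely, an event about the increments over cells below a,
  which are independent of those over the last cell.\<close>

lemma cylinder_increment_indep:
  assumes ab: "0 \<le> a" "a < b" "b \<le> T"
    and J: "finite J" "J \<subseteq> idx \<times> {0..a}" and E: "\<forall>p\<in>J. E p \<in> sets borel" and B: "B \<in> sets borel"
  shows "prob (cylinder J E \<inter> ((\<lambda>\<omega>. WS b \<omega> - WS a \<omega>) -` B \<inter> space M)) =
         prob (cylinder J E) * prob ((\<lambda>\<omega>. WS b \<omega> - WS a \<omega>) -` B \<inter> space M)"
proof -
  \<comment> \<open>0 and a join the observed times: sums of increments then start at time 0, and
    the last cell is exactly (a, b].\<close>
  define S where "S = insert 0 (insert a (snd ` J))"
  have S: "finite S" "S \<subseteq> {0..a}" "0 \<in> S" "a \<in> S" using J ab by (auto simp: S_def)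
  obtain n v where v: "\<And>l. l < n \<Longrightarrow> v l < v (Suc l)" "v ` {..n} = S"
    using finite_set_grid[OF S(1)] S(3) by auto
  note mono = grid_mono[of n v, OF v(1)]
  define u where "u m = (if m \<le> n then v m else b)" for m
  have ind: "\<exists>m\<le>n. u m = s" if "s \<in> S" for s
    using that unfolding v(2)[symmetric] by (auto simp: u_def)
  have uS: "u m \<in> S" if "m \<le> n" for m using that v(2) by (auto simp: u_def)
  have u0: "u 0 = 0"
  proof -
    obtain m where "m \<le> n" "v m = 0" using ind[OF S(3)] by (auto simp: u_def)
    then show ?thesis using mono[of 0 m] uS[of 0] S(2) by (auto simp: u_def)
  qed
  have un: "u n = a"
  proof -
    obtain m where "m \<le> n" "v m = a" using ind[OF S(4)] by (auto simp: u_def)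
    then show ?thesis using mono[of m n] uS[of n] S(2) by (auto simp: u_def)
  qed
  have uSn: "u (Suc n) = b" by (simp add: u_def)
  have inc: "u m < u (Suc m)" if "m < Suc n" for m
  proof (cases "m = n")
    case True then show ?thesis using un uSn ab by simp
  next
    case False then show ?thesis using that v(1)[of m] by (simp add: u_def)
  qed
  from ind obtain mm where mm: "\<And>s. s \<in> S \<Longrightarrow> mm s \<le> n \<and> u (mm s) = s" by metis
  let ?X = "\<lambda>p \<omega>. W (fst p) (u (Suc (snd p))) \<omega> - W (fst p) (u (snd p)) \<omega>"
  have "indep_vars (\<lambda>_. borel) (\<lambda>(i, m) \<omega>. W i (u (Suc m)) \<omega> - W i (u m) \<omega>) (idx \<times> {..<Suc n})"
    by (rule W_indep) (use u0 inc uSn ab in auto)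
  then have iv: "indep_vars (\<lambda>_. borel) ?X (idx \<times> {..<Suc n})" by (simp add: case_prod_beta')
  let ?A = "idx \<times> {..<n}" and ?B = "idx \<times> {n}"
  have iv2: "indep_var (Pi\<^sub>M ?A (\<lambda>_. borel)) (\<lambda>\<omega>. \<lambda>p\<in>?A. ?X p \<omega>) (Pi\<^sub>M ?B (\<lambda>_. borel)) (\<lambda>\<omega>. \<lambda>p\<in>?B. ?X p \<omega>)"
    by (rule indep_var_restrict[OF iv]) auto
  define XA where "XA = {x \<in> space (Pi\<^sub>M ?A (\<lambda>_. borel :: real measure)).
      \<forall>p\<in>J. (\<Sum>l<mm (snd p). x (fst p, l)) \<in> E p}"
  define XB where "XB = {x \<in> space (Pi\<^sub>M ?B (\<lambda>_. borel :: real measure)). (\<chi> i. x (Inl i, n)) \<in> B}"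
  have XA: "XA \<in> sets (Pi\<^sub>M ?A (\<lambda>_. borel))"
    unfolding XA_def
  proof (rule sets.sets_Collect_finite_All[OF _ J(1)])
    fix p assume p: "p \<in> J"
    have "mm (snd p) \<le> n" using mm[of "snd p"] p by (auto simp: S_def)
    moreover have "fst p \<in> idx" using p J by (metis mem_Times_iff subsetD)
    ultimately have m: "(\<lambda>x. \<Sum>l<mm (snd p). x (fst p, l) :: real) \<in> borel_measurable (Pi\<^sub>M ?A (\<lambda>_. borel))"
      by (intro borel_measurable_sum measurable_component_singleton) auto
    from measurable_sets[OF this, of "E p"] E p
    show "{x \<in> space (Pi\<^sub>M ?A (\<lambda>_. borel)). (\<Sum>l<mm (snd p). x (fst p, l)) \<in> E p} \<in> sets (Pi\<^sub>M ?A (\<lambda>_. borel))"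
      by (simp add: vimage_def Int_def conj_commute)
  qed
  have XB: "XB \<in> sets (Pi\<^sub>M ?B (\<lambda>_. borel))"
  proof -
    have "(\<lambda>x. \<chi> i. x (Inl i, n)) \<in> borel_measurable (Pi\<^sub>M ?B (\<lambda>_. borel :: real measure))"
      by (rule borel_measurable_vecI) (auto intro!: measurable_component_singleton)
    from measurable_sets[OF this B] show ?thesis
      unfolding XB_def by (simp add: vimage_def Int_def conj_commute)
  qed
  let ?PA = "(\<lambda>\<omega>. \<lambda>p\<in>?A. ?X p \<omega>) -` XA \<inter> space M" and ?PB = "(\<lambda>\<omega>. \<lambda>p\<in>?B. ?X p \<omega>) -` XB \<inter> space M"
  have rvA: "?PA \<in> events" and rvB: "?PB \<in> events"
    using measurable_sets[OF indep_var_rv1[OF iv2] XA] measurable_sets[OF indep_var_rv2[OF iv2] XB] by auto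
  have PB: "?PB = (\<lambda>\<omega>. WS b \<omega> - WS a \<omega>) -` B \<inter> space M"
  proof -
    have "(\<chi> i. (\<lambda>p\<in>?B. ?X p \<omega>) (Inl i, n)) = WS b \<omega> - WS a \<omega>" for \<omega>
      by (simp add: vec_eq_iff WS_def un uSn InlI)
    then show ?thesis by (auto simp: XB_def space_PiM)
  qed
  \<comment> \<open>W starts at 0 only almost surely, so telescoping recovers W from its increments,
    and with it the cylinder event, only up to a null set.\<close>
  have AE_A: "AE \<omega> in M. \<omega> \<in> ?PA \<longleftrightarrow> \<omega> \<in> cylinder J E"
    using W_zero
  proof (rule AE_mp, intro AE_I2 impI)
    fix \<omega> assume w: "\<omega> \<in> space M" and W0: "\<forall>i\<in>idx. W i 0 \<omega> = 0"
    have "(\<Sum>l<mm (snd p). (\<lambda>p\<in>?A. ?X p \<omega>) (fst p, l)) = W (fst p) (snd p) \<omega>" if p: "p \<in> J" for p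
    proof -
      have m: "mm (snd p) \<le> n" "u (mm (snd p)) = snd p" using mm[of "snd p"] p by (auto simp: S_def)
      have i: "fst p \<in> idx" using p J by (metis mem_Times_iff subsetD)
      have "(\<Sum>l<mm (snd p). (\<lambda>p\<in>?A. ?X p \<omega>) (fst p, l)) =
        (\<Sum>l<mm (snd p). W (fst p) (u (Suc l)) \<omega> - W (fst p) (u l) \<omega>)"
        using m i by (intro sum.cong) auto
      also have "\<dots> = W (fst p) (u (mm (snd p))) \<omega> - W (fst p) (u 0) \<omega>"
        by (rule sum_lessThan_telescope)
      finally show ?thesis using m u0 W0 i by simp
    qed
    then show "\<omega> \<in> ?PA \<longleftrightarrow> \<omega> \<in> cylinder J E"
      using w by (simp add: XA_def cylinder_def space_PiM)
  qed
  have cyl: "cylinder J E \<in> events"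
    using cylinder_sets[of J a E] J E sets_filt_subset[of a] ab by auto
  have "prob (cylinder J E \<inter> ?PB) = prob (?PA \<inter> ?PB)"
    by (rule finite_measure_eq_AE) (use AE_A cyl rvA rvB in auto)
  also have "?PA \<inter> ?PB = (\<lambda>\<omega>. (\<lambda>p\<in>?A. ?X p \<omega>, \<lambda>p\<in>?B. ?X p \<omega>)) -` (XA \<times> XB) \<inter> space M" by auto
  also have "prob \<dots> = prob ?PA * prob ?PB" by (rule indep_varD[OF iv2 XA XB])
  also have "prob ?PA = prob (cylinder J E)"
    by (rule finite_measure_eq_AE[OF AE_A rvA cyl])
  finally show ?thesis unfolding PB .
qed

text \<open>The product formula passes from the pi-system of cylinders and null sets to the
  sigma-algebra it generates. On the null sets the formula is trivial, which is how the augmentation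
  of the filtration is covered.\<close>

lemma increment_indep:
  assumes ab: "0 \<le> a" "a < b" "b \<le> T" and X: "X \<in> measurable (filt a) S"
    and f: "f \<in> measurable borel S'"
  shows "indep_var S X S' (\<lambda>\<omega>. f (WS b \<omega> - WS a \<omega>))"
proof -
  let ?D = "\<lambda>\<omega>. WS b \<omega> - WS a \<omega>"
  let ?H = "{?D -` B \<inter> space M | B. B \<in> sets borel}"
  have D: "?D \<in> borel_measurable M" using ab by (intro borel_measurable_diff WS_measurable) auto
  have "indep_set (cylinders a \<union> null_sets M) ?H"
  proof (rule indep_setI)
    show "cylinders a \<union> null_sets M \<subseteq> events"
      using cylinders_subset sets_filt_subset[of a] ab by auto
    show "?H \<subseteq> events" using measurable_sets[OF D] by auto
    fix A C assume A: "A \<in> cylinders a \<union> null_sets M" and "C \<in> ?H"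
    then obtain B where B: "C = ?D -` B \<inter> space M" "B \<in> sets borel" by auto
    have C: "C \<in> events" using B measurable_sets[OF D] by auto
    show "prob (A \<inter> C) = prob A * prob C"
    proof (cases "A \<in> null_sets M")
      case True
      then have "A \<inter> C \<in> null_sets M" using C by (rule null_set_Int2)
      then show ?thesis using True by (simp add: measure_eq_0_null_sets)
    next
      case False
      then obtain J E where "A = cylinder J E" "finite J" "J \<subseteq> idx \<times> {0..a}" "\<forall>p\<in>J. E p \<in> sets borel"
        using A unfolding cylinders_def by auto
      then show ?thesis using cylinder_increment_indep[OF ab] B by simp
    qed
  qed
  moreover have "Int_stable ?H"
  proof (rule Int_stableI)
    fix a b assume "a \<in> ?H" "b \<in> ?H"
    then obtain A B where "a = ?D -` A \<inter> space M" "b = ?D -` B \<inter> space M" "A \<in> sets borel" "B \<in> sets borel"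
      by auto
    then have "a \<inter> b = ?D -` (A \<inter> B) \<inter> space M" "A \<inter> B \<in> sets borel" by auto
    then show "a \<inter> b \<in> ?H" by blast
  qed
  ultimately have ind: "indep_set (sigma_sets (space M) (cylinders a \<union> null_sets M)) (sigma_sets (space M) ?H)"
    by (intro indep_set_sigma_sets Int_stable_cylinders)
  have sub: "sigma_sets (space M) {X -` A \<inter> space M |A. A \<in> sets S}
     \<subseteq> sigma_sets (space M) (cylinders a \<union> null_sets M)"
  proof -
    have "{X -` A \<inter> space M |A. A \<in> sets S} \<subseteq> sets (filt a)" using measurable_sets[OF X] by auto
    then show ?thesis using sets_filt_cylinders by (intro sigma_sets_mono) blast
  qed
  show ?thesis
    unfolding indep_var_eq
  proof (intro conjI)
    show "random_variable S X" using ab by (intro filt_measurable_M[OF _ X]) auto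
    show "random_variable S' (\<lambda>\<omega>. f (?D \<omega>))" by (rule measurable_compose[OF D f])
    have "{(\<lambda>\<omega>. f (?D \<omega>)) -` A \<inter> space M |A. A \<in> sets S'} \<subseteq> ?H"
    proof safe
      fix A assume "A \<in> sets S'"
      then have "f -` A \<in> sets borel" using measurable_sets[OF f, of A] by simp
      then show "\<exists>B. (\<lambda>\<omega>. f (?D \<omega>)) -` A \<inter> space M = ?D -` B \<inter> space M \<and> B \<in> sets borel"
        by (intro exI[of _ "f -` A"]) auto
    qed
    then have "sigma_sets (space M) {(\<lambda>\<omega>. f (?D \<omega>)) -` A \<inter> space M |A. A \<in> sets S'} \<subseteq> sigma_sets (space M) ?H"
      by (rule sigma_sets_mono')
    from indep_set_mono[OF ind sub this] show "indep_set (sigma_sets (space M) {X -` A \<inter> space M |A. A \<in> sets S})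
       (sigma_sets (space M) {(\<lambda>\<omega>. f (?D \<omega>)) -` A \<inter> space M |A. A \<in> sets S'})"
      .
  qed
qed

text \<open>The components over one cell are independent centred normal variables, so the
  characteristic function factorises and the squared coordinates of y add up to its squared
  norm.\<close>

lemma increment_char:
  assumes ab: "0 \<le> a" "a < b" "b \<le> T"
  shows "(LINT \<omega>|M. iexp (y \<bullet> (WS b \<omega> - WS a \<omega>))) = of_real (exp (- (norm y)\<^sup>2 * (b - a) / 2))"
proof -
  let ?X = "\<lambda>i \<omega>. W (Inl i) b \<omega> - W (Inl i) a \<omega>"
  have one: "(LINT \<omega>|M. iexp (x * ?X i \<omega>)) = of_real (exp (- x\<^sup>2 * (b - a) / 2))" for x i
  proof -
    have "distributed M lborel (?X i) (normal_density 0 (sqrt (b - a)))"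
      using ab by (intro W_distributed) auto
    then have st: "distributed M lborel (\<lambda>\<omega>. ?X i \<omega> / sqrt (b - a)) std_normal_density"
      using normal_standard_normal_convert[of "sqrt (b - a)" "?X i" 0] ab by simp
    then have [measurable]: "(\<lambda>\<omega>. ?X i \<omega> / sqrt (b - a)) \<in> borel_measurable M"
      by (auto dest: distributed_measurable)
    have "(LINT \<omega>|M. iexp (x * ?X i \<omega>)) = (LINT \<omega>|M. iexp (x * sqrt (b - a) * (?X i \<omega> / sqrt (b - a))))"
      using ab by simp
    also have "\<dots> = (LINT z|distr M lborel (\<lambda>\<omega>. ?X i \<omega> / sqrt (b - a)). iexp (x * sqrt (b - a) * z))"
      by (subst integral_distr) auto
    also have "\<dots> = char std_normal (x * sqrt (b - a))"
      using st by (simp add: distributed_def char_def)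
    also have "\<dots> = of_real (exp (- x\<^sup>2 * (b - a) / 2))"
      using ab by (simp add: char_std_normal_distribution power_mult_distrib)
    finally show ?thesis .
  qed
  \<comment> \<open>A partition with the single cell (a, b], so that only independence across the
    components remains.\<close>
  define u where "u m = (if m = 0 then a else b)" for m :: nat
  let ?Z = "\<lambda>p \<omega>. W (fst p) (u (Suc (snd p))) \<omega> - W (fst p) (u (snd p)) \<omega>"
  let ?I = "(\<lambda>i. (Inl i, 0)) ` UNIV :: (('d + nat) \<times> nat) set"
  have "indep_vars (\<lambda>_. borel) (\<lambda>(i, m) \<omega>. W i (u (Suc m)) \<omega> - W i (u m) \<omega>) (idx \<times> {..<1})"
    by (rule W_indep) (use ab in \<open>auto simp: u_def\<close>)
  then have "indep_vars (\<lambda>_. borel) ?Z (idx \<times> {..<1})" by (simp add: case_prod_beta')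
  then have "indep_vars (\<lambda>_. borel) ?Z ?I"
    by (rule indep_vars_subset') auto
  then have "indep_vars (\<lambda>_. borel) (\<lambda>p \<omega>. iexp (y $ projl (fst p) * ?Z p \<omega>)) ?I"
    by (rule indep_vars_compose2[where Y = "\<lambda>p x. iexp (y $ projl (fst p) * x)"]) simp
  then have "(LINT \<omega>|M. (\<Prod>p\<in>?I. iexp (y $ projl (fst p) * ?Z p \<omega>))) =
     (\<Prod>p\<in>?I. LINT \<omega>|M. iexp (y $ projl (fst p) * ?Z p \<omega>))"
  proof (rule indep_vars_lebesgue_integral[rotated])
    fix p :: "('d + nat) \<times> nat" assume p: "p \<in> ?I"
    then have [measurable]: "?Z p \<in> borel_measurable M"
      using ab by (auto simp: u_def intro!: borel_measurable_diff W_measurable)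
    have "(\<lambda>\<omega>. iexp (y $ projl (fst p) * ?Z p \<omega>)) \<in> borel_measurable M"
      by (rule measurable_compose[OF \<open>?Z p \<in> borel_measurable M\<close>, of "\<lambda>x. iexp (y $ projl (fst p) * x)"]) simp
    then show "integrable M (\<lambda>\<omega>. iexp (y $ projl (fst p) * ?Z p \<omega>))"
      by (intro integrable_const_bound[where B = 1]) auto
  qed auto
  then have "(LINT \<omega>|M. (\<Prod>i\<in>UNIV. iexp (y $ i * ?X i \<omega>))) = (\<Prod>i\<in>UNIV. LINT \<omega>|M. iexp (y $ i * ?X i \<omega>))"
    by (simp add: prod.reindex inj_on_def u_def)
  also have "(\<lambda>\<omega>. \<Prod>i\<in>UNIV. iexp (y $ i * ?X i \<omega>)) = (\<lambda>\<omega>. iexp (y \<bullet> (WS b \<omega> - WS a \<omega>)))"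
    by (simp add: exp_sum[symmetric] inner_vec_def WS_def sum_distrib_left)
  also have "(\<Prod>i\<in>UNIV. LINT \<omega>|M. iexp (y $ i * ?X i \<omega>)) = of_real (\<Prod>i\<in>UNIV. exp (- (y $ i)\<^sup>2 * (b - a) / 2))"
    unfolding one by simp
  also have "(\<Prod>i\<in>UNIV. exp (- (y $ i)\<^sup>2 * (b - a) / 2)) = exp (- (norm y)\<^sup>2 * (b - a) / 2)"
    by (subst exp_sum[symmetric])
      (simp_all add: norm_vec_def L2_set_def sum_nonneg sum_negf sum_distrib_right sum_divide_distrib)
  finally show ?thesis .
qed

text \<open>One step of the exponential martingale. Given the information at a, the vector \<eta> is
  frozen, and the compensating exponential is the reciprocal of the characteristic function of the
  increment at \<eta>. Independence reduces this to Fubini's theorem for the product of the two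
  laws.\<close>

lemma increment_exponential:
  fixes Y :: "'a \<Rightarrow> complex" and \<eta> :: "'a \<Rightarrow> real^'d"
  assumes ab: "0 \<le> a" "a \<le> b" "b \<le> T"
    and Y: "Y \<in> borel_measurable (filt a)" "\<And>\<omega>. \<omega> \<in> space M \<Longrightarrow> norm (Y \<omega>) \<le> C"
    and \<eta>: "\<eta> \<in> borel_measurable (filt a)" "bounded (\<eta> ` space M)"
  shows "(LINT \<omega>|M. Y \<omega> * of_real (exp ((norm (\<eta> \<omega>))\<^sup>2 * (b - a) / 2)) * iexp (\<eta> \<omega> \<bullet> (WS b \<omega> - WS a \<omega>)))
    = (LINT \<omega>|M. Y \<omega>)"
proof (cases "a = b")
  case False
  with ab have ab': "a < b" by simp
  let ?D = "\<lambda>\<omega>. WS b \<omega> - WS a \<omega>"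
  (* indep_var is only available for two variables of the same type, hence the dummy components *)
  define X where "X \<omega> = ((Y \<omega> * of_real (exp ((norm (\<eta> \<omega>))\<^sup>2 * (b - a) / 2)), \<eta> \<omega>), 0 :: real^'d)" for \<omega>
  define D where "D \<omega> = ((0 :: complex, 0 :: real^'d), ?D \<omega>)" for \<omega>
  let ?B = "(borel \<Otimes>\<^sub>M borel) \<Otimes>\<^sub>M borel :: ((complex \<times> (real^'d)) \<times> (real^'d)) measure"
  obtain R where R: "\<And>\<omega>. \<omega> \<in> space M \<Longrightarrow> norm (\<eta> \<omega>) \<le> R" using \<eta>(2) by (auto simp: bounded_iff)
  obtain \<omega>0 where "\<omega>0 \<in> space M" using not_empty by blast
  then have "C \<ge> 0" using order_trans[OF norm_ge_zero Y(2)] by blast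
  note [measurable] = Y(1) \<eta>(1)
  have X: "X \<in> filt a \<rightarrow>\<^sub>M ?B" unfolding X_def by measurable
  have X': "X \<in> M \<rightarrow>\<^sub>M ?B" using ab by (intro filt_measurable_M[OF _ X]) auto
  have dWS[measurable]: "?D \<in> borel_measurable M" using ab by (intro borel_measurable_diff WS_measurable) auto
  have D: "D \<in> M \<rightarrow>\<^sub>M ?B" unfolding D_def by measurable
  have ind: "indep_var ?B X ?B D" unfolding D_def using ab ab' by (intro increment_indep X) auto
  let ?P = "distr M ?B X" and ?Q = "distr M ?B D"
  have PQ: "?P \<Otimes>\<^sub>M ?Q = distr M (?B \<Otimes>\<^sub>M ?B) (\<lambda>\<omega>. (X \<omega>, D \<omega>))"
    using ind by (simp add: indep_var_distribution_eq)
  interpret P: prob_space ?P by (rule prob_space_distr[OF X'])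
  interpret Q: prob_space ?Q by (rule prob_space_distr[OF D])
  interpret PQ: pair_sigma_finite ?P ?Q ..
  let ?f = "\<lambda>(x, d). fst (fst x) * iexp (snd (fst x) \<bullet> snd d) :: complex"
  have f[measurable]: "?f \<in> borel_measurable (?B \<Otimes>\<^sub>M ?B)" by measurable
  have XD: "(\<lambda>\<omega>. (X \<omega>, D \<omega>)) \<in> M \<rightarrow>\<^sub>M ?B \<Otimes>\<^sub>M ?B"
    using X' D by (rule measurable_Pair)
  have bd: "norm (Y \<omega> * of_real (exp ((norm (\<eta> \<omega>))\<^sup>2 * (b - a) / 2))) \<le> C * exp (R\<^sup>2 * (b - a) / 2)"
    if "\<omega> \<in> space M" for \<omega>
  proof -
    have "(norm (\<eta> \<omega>))\<^sup>2 * (b - a) / 2 \<le> R\<^sup>2 * (b - a) / 2"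
      using R[OF that] ab by (intro divide_right_mono mult_right_mono power_mono) auto
    then show ?thesis unfolding norm_mult using Y(2)[OF that] \<open>C \<ge> 0\<close> by (intro mult_mono) auto
  qed
  have intf: "integrable (?P \<Otimes>\<^sub>M ?Q) ?f"
    unfolding PQ
  proof (subst integrable_distr_eq[OF XD f], rule integrable_const_bound[where B = "C * exp (R\<^sup>2 * (b - a) / 2)"])
    show "AE \<omega> in M. norm (?f (X \<omega>, D \<omega>)) \<le> C * exp (R\<^sup>2 * (b - a) / 2)"
      using bd by (intro AE_I2) (simp add: X_def norm_mult)
  qed (rule measurable_compose[OF XD f])
  have "(LINT \<omega>|M. Y \<omega> * of_real (exp ((norm (\<eta> \<omega>))\<^sup>2 * (b - a) / 2)) * iexp (\<eta> \<omega> \<bullet> ?D \<omega>))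
    = (LINT \<omega>|M. ?f (X \<omega>, D \<omega>))" by (simp add: X_def D_def)
  also have "\<dots> = integral\<^sup>L (?P \<Otimes>\<^sub>M ?Q) ?f"
    unfolding PQ by (rule integral_distr[OF XD f, symmetric])
  also have "\<dots> = (LINT x|?P. LINT d|?Q. ?f (x, d))" by (rule PQ.integral_fst'[OF intf, symmetric])
  also have "\<dots> = (LINT x|?P. fst (fst x) * of_real (exp (- (norm (snd (fst x)))\<^sup>2 * (b - a) / 2)))"
  proof (rule Bochner_Integration.integral_cong[OF refl])
    fix x :: "(complex \<times> (real^'d)) \<times> (real^'d)"
    have "(LINT d|?Q. iexp (snd (fst x) \<bullet> snd d)) = (LINT \<omega>|M. iexp (snd (fst x) \<bullet> snd (D \<omega>)))"
      by (rule integral_distr[OF D]) measurable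
    also have "\<dots> = of_real (exp (- (norm (snd (fst x)))\<^sup>2 * (b - a) / 2))"
      using increment_char[of a b "snd (fst x)"] ab ab' by (simp add: D_def)
    finally show "(LINT d|?Q. ?f (x, d)) = fst (fst x) * of_real (exp (- (norm (snd (fst x)))\<^sup>2 * (b - a) / 2))"
      by (simp add: case_prod_beta)
  qed
  also have "\<dots> = (LINT \<omega>|M. fst (fst (X \<omega>)) * of_real (exp (- (norm (snd (fst (X \<omega>))))\<^sup>2 * (b - a) / 2)))"
    by (rule integral_distr[OF X']) measurable
  also have "\<dots> = (LINT \<omega>|M. Y \<omega>)"
    by (intro Bochner_Integration.integral_cong) (simp_all add: X_def exp_minus)
  finally show ?thesis .
qed simp

end

section \<open>Exponential martingales of stochastic integrals\<close>

text \<open>The two functions differ inside a null set, all of whose subsets are measurable.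
  Stochastic integrals and wealth processes are given only up to null sets, so their measurability
  rests on this.\<close>

lemma (in complete_measure) measurable_AE_eq:
  assumes f: "f \<in> measurable M N" and ae: "AE \<omega> in M. f \<omega> = g \<omega>"
    and g: "g \<in> space M \<rightarrow> space N"
  shows "g \<in> measurable M N"
proof (rule measurableI)
  show "\<And>x. x \<in> space M \<Longrightarrow> g x \<in> space N" using g by auto
  fix A assume A: "A \<in> sets N"
  obtain E where E: "{\<omega>\<in>space M. f \<omega> \<noteq> g \<omega>} \<subseteq> E" "E \<in> null_sets M"
    using ae by (auto elim!: AE_E simp: null_sets_def)
  have eq: "g -` A \<inter> space M = (f -` A \<inter> space M - E) \<union> (g -` A \<inter> space M \<inter> E)" using E by auto
  have "g -` A \<inter> space M \<inter> E \<in> sets M" by (rule complete[OF _ E(2)]) auto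
  moreover have "f -` A \<inter> space M - E \<in> sets M" using measurable_sets[OF f A] E by auto
  ultimately show "g -` A \<inter> space M \<in> sets M" by (subst eq) (rule sets.Un)
qed

lemma (in complete_measure) borel_measurable_AE_limit:
  fixes f :: "nat \<Rightarrow> 'a \<Rightarrow> 'b::{banach, second_countable_topology}"
  assumes f: "\<And>n. f n \<in> borel_measurable M" and ae: "AE \<omega> in M. (\<lambda>n. f n \<omega>) \<longlonglongrightarrow> g \<omega>"
  shows "g \<in> borel_measurable M"
proof (rule measurable_AE_eq)
  show "(\<lambda>\<omega>. lim (\<lambda>n. f n \<omega>)) \<in> borel_measurable M" by (rule borel_measurable_lim_metric[OF f])
  show "AE \<omega> in M. lim (\<lambda>n. f n \<omega>) = g \<omega>" using ae by eventually_elim (rule limI)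
qed simp

text \<open>The weighted form, whose factor in front of the first term can be brought arbitrarily
  close to 1; the constant 2 would be too coarse for limits of energies.\<close>

lemma norm_add_square_le:
  fixes a b :: "'b::real_normed_vector"
  assumes "e > 0"
  shows "(norm (a + b))\<^sup>2 \<le> (1 + e) * (norm a)\<^sup>2 + (1 + 1 / e) * (norm b)\<^sup>2"
proof -
  have "(norm (a + b))\<^sup>2 \<le> (norm a + norm b)\<^sup>2" by (intro power_mono norm_triangle_ineq) auto
  also have "\<dots> = (1 + e) * (norm a)\<^sup>2 + (1 + 1 / e) * (norm b)\<^sup>2 - (e * norm a - norm b)\<^sup>2 / e"
    using assms by (simp add: power2_eq_square field_simps)
  also have "\<dots> \<le> (1 + e) * (norm a)\<^sup>2 + (1 + 1 / e) * (norm b)\<^sup>2" using assms by simp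
  finally show ?thesis .
qed

abbreviation (input) energy :: "real set \<Rightarrow> (real \<Rightarrow> 'b::real_normed_vector) \<Rightarrow> ennreal" where
  "energy A f \<equiv> (\<integral>\<^sup>+ s\<in>A. ennreal ((norm (f s))\<^sup>2) \<partial>lborel)"

lemma nn_integral_square_add_le:
  fixes a b :: "real \<Rightarrow> 'b::euclidean_space"
  assumes [measurable]: "a \<in> borel_measurable borel" "b \<in> borel_measurable borel" "A \<in> sets borel" and e: "e > 0"
  shows "energy A (\<lambda>s. a s + b s) \<le>
    ennreal (1 + e) * energy A a +
    ennreal (1 + 1 / e) * energy A b"
proof -
  have "energy A (\<lambda>s. a s + b s) \<le>
     (\<integral>\<^sup>+ s. ennreal (1 + e) * (ennreal ((norm (a s))\<^sup>2) * indicator A s) +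
       ennreal (1 + 1 / e) * (ennreal ((norm (b s))\<^sup>2) * indicator A s) \<partial>lborel)"
  proof (rule nn_integral_mono)
    fix s
    have "ennreal ((norm (a s + b s))\<^sup>2) \<le> ennreal ((1 + e) * (norm (a s))\<^sup>2 + (1 + 1 / e) * (norm (b s))\<^sup>2)"
      by (rule ennreal_leI[OF norm_add_square_le[OF e]])
    also have "\<dots> = ennreal (1 + e) * ennreal ((norm (a s))\<^sup>2) + ennreal (1 + 1 / e) * ennreal ((norm (b s))\<^sup>2)"
      using e by (simp add: ennreal_mult)
    finally show "ennreal ((norm (a s + b s))\<^sup>2) * indicator A s \<le>
       ennreal (1 + e) * (ennreal ((norm (a s))\<^sup>2) * indicator A s) +
       ennreal (1 + 1 / e) * (ennreal ((norm (b s))\<^sup>2) * indicator A s)"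
      by (auto split: split_indicator)
  qed
  also have "\<dots> = ennreal (1 + e) * energy A a +
    ennreal (1 + 1 / e) * energy A b"
    by (subst nn_integral_add) (auto simp: nn_integral_cmult)
  finally show ?thesis .
qed

text \<open>Convergence in mean square implies convergence of the energies. The weighted inequality
  is applied in both directions, with a weight that tends to 0 more slowly than the squared
  distance.\<close>

lemma energy_tendsto:
  fixes f :: "nat \<Rightarrow> real \<Rightarrow> 'b::euclidean_space" and h :: "real \<Rightarrow> 'b"
  assumes [measurable]: "\<And>m. f m \<in> borel_measurable borel" "h \<in> borel_measurable borel" "A \<in> sets borel"
    and lim: "(\<lambda>m. \<integral>\<^sup>+ s\<in>A. ennreal ((norm (f m s - h s))\<^sup>2) \<partial>lborel) \<longlonglongrightarrow> 0"
    and V: "energy A h = ennreal V" "V \<ge> 0"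
    and Q: "\<And>m. energy A (\<lambda>s. f m s) = ennreal (Q m)" "\<And>m. Q m \<ge> 0"
  shows "Q \<longlonglongrightarrow> V"
proof -
  define D where "D m = energy A (\<lambda>s. f m s - h s)" for m
  define d where "d m = enn2real (D m)" for m
  \<comment> \<open>The square root makes \<open>d m / e m\<close> at most
    \<open>sqrt (d m)\<close>; the summand 1 / (m + 1) keeps \<open>e m\<close> positive where
    \<open>d m\<close> is 0.\<close>
  define e where "e m = sqrt (d m) + 1 / (real m + 1)" for m
  have "(\<lambda>m. enn2real (D m)) \<longlonglongrightarrow> enn2real 0"
    using lim by (intro tendsto_enn2real) (auto simp: D_def)
  then have d: "d \<longlonglongrightarrow> 0" by (simp add: d_def[abs_def])
  have d0: "d m \<ge> 0" for m by (simp add: d_def)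
  have e0: "e m > 0" for m using d0[of m] by (simp add: e_def add_nonneg_pos)
  have "(\<lambda>m. 1 / (real m + 1)) \<longlonglongrightarrow> 0" by real_asymp
  from tendsto_add[OF tendsto_real_sqrt[OF d] this] have e: "e \<longlonglongrightarrow> 0" by (simp add: e_def[abs_def])
  have "\<forall>\<^sub>F m in sequentially. D m < 1" using lim unfolding D_def by (rule order_tendstoD) simp
  \<comment> \<open>\<open>enn2real\<close> sends infinity to 0, so the real distance is the true
    one only once finiteness is known.\<close>
  then have evD: "\<forall>\<^sub>F m in sequentially. D m = ennreal (d m)"
    by eventually_elim (auto simp: d_def intro!: ennreal_enn2real[symmetric] order_less_trans[OF _ ennreal_one_less_top])
  have de: "(1 + 1 / e m) * d m \<le> d m + sqrt (d m)" for m
  proof -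
    have "d m = sqrt (d m) * sqrt (d m)" using d0[of m] by simp
    also have "\<dots> \<le> sqrt (d m) * e m" by (intro mult_left_mono) (auto simp: e_def d0)
    finally have "d m / e m \<le> sqrt (d m)" using e0[of m] by (simp add: pos_divide_le_eq)
    then show ?thesis by (simp add: algebra_simps)
  qed
  have ev: "\<forall>\<^sub>F m in sequentially. Q m \<le> (1 + e m) * V + (d m + sqrt (d m)) \<and>
      (V - (d m + sqrt (d m))) / (1 + e m) \<le> Q m"
    using evD
  proof eventually_elim
    case (elim m)
    note D = elim[unfolded D_def]
    have D2: "energy A (\<lambda>s. h s - f m s) = ennreal (d m)"
      unfolding D[symmetric] by (subst norm_minus_commute) (rule refl)
    have "ennreal (Q m) \<le> ennreal (1 + e m) * ennreal V + ennreal (1 + 1 / e m) * ennreal (d m)"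
      using nn_integral_square_add_le[of h "\<lambda>s. f m s - h s" A "e m"] e0[of m] by (simp add: V Q D)
    also have "\<dots> = ennreal ((1 + e m) * V + (1 + 1 / e m) * d m)"
      using e0[of m] d0[of m] V by (simp add: ennreal_mult)
    finally have 1: "Q m \<le> (1 + e m) * V + (1 + 1 / e m) * d m"
      using e0[of m] d0[of m] V by (subst (asm) ennreal_le_iff) auto
    have "ennreal V \<le> ennreal (1 + e m) * ennreal (Q m) + ennreal (1 + 1 / e m) * ennreal (d m)"
      using nn_integral_square_add_le[of "f m" "\<lambda>s. - (f m s - h s)" A "e m"] e0[of m]
      by (simp add: V Q D2)
    also have "\<dots> = ennreal ((1 + e m) * Q m + (1 + 1 / e m) * d m)"
      using e0[of m] d0[of m] Q(2)[of m] by (simp add: ennreal_mult)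
    finally have 2: "V \<le> (1 + e m) * Q m + (1 + 1 / e m) * d m"
      using e0[of m] d0[of m] Q(2)[of m] by (subst (asm) ennreal_le_iff) auto
    have "V - (d m + sqrt (d m)) \<le> Q m * (1 + e m)" using 2 de[of m] by (simp add: algebra_simps)
    then show ?case using 1 de[of m] e0[of m] by (simp add: pos_divide_le_eq)
  qed
  show ?thesis
  proof (rule tendsto_sandwich)
    show "(\<lambda>m. (V - (d m + sqrt (d m))) / (1 + e m)) \<longlonglongrightarrow> V"
      by (rule tendsto_eq_intros d e refl | simp)+
    show "(\<lambda>m. (1 + e m) * V + (d m + sqrt (d m))) \<longlonglongrightarrow> V"
      by (rule tendsto_eq_intros d e refl | simp)+
  qed (use ev in \<open>auto elim: eventually_mono\<close>)
qed

text \<open>For r <= t this is the projection of x onto [r, t]. Clipping the grid points restricts a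
  simple integrand to [r, t] while keeping the number of cells; cells outside become
  degenerate.\<close>

definition clip :: "real \<Rightarrow> real \<Rightarrow> real \<Rightarrow> real" where "clip r t x = max r (min x t)"

lemma clip_mono: "x \<le> y \<Longrightarrow> clip r t x \<le> clip r t y"
  by (auto simp: clip_def)

lemma clip_bounds: "r \<le> t \<Longrightarrow> r \<le> clip r t x \<and> clip r t x \<le> t"
  by (auto simp: clip_def)

lemma emeasure_cell:
  assumes "r \<le> t" "l \<le> h"
  shows "emeasure lborel ({r..t} \<inter> {l<..h}) = ennreal (clip r t h - clip r t l)"
proof (cases "l < r")
  case True
  then have "{r..t} \<inter> {l<..h} = {r..min h t}" by auto
  then show ?thesis using assms True by (auto simp: clip_def emeasure_lborel_Icc_eq min_def max_def)
next
  case False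
  then have "{r..t} \<inter> {l<..h} = {l<..min h t}" by auto
  then show ?thesis using assms False by (auto simp: clip_def min_def max_def)
qed

section \<open>Simple integrands, their energies and their exponential martingales\<close>

context market
begin

lemma simple_integrandD:
  assumes "simple_integrand n u \<eta>"
  shows "0 \<le> u 0" "\<And>j. j < n \<Longrightarrow> u j < u (Suc j)" "u n \<le> T"
    "\<And>j. j < n \<Longrightarrow> \<eta> j \<in> borel_measurable (filt (u j))" "\<And>j. j < n \<Longrightarrow> bounded (\<eta> j ` space M)"
  using assms by (auto simp: simple_integrand_def)

lemma simple_integrand_strict:
  assumes "simple_integrand n u \<eta>" "i < j" "j \<le> n"
  shows "u i < u j"
  using assms(2,3)
proof (induction j)
  case (Suc j)
  have "u j < u (Suc j)" using simple_integrandD(2)[OF assms(1)] Suc by simp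
  then show ?case using Suc by (cases "i = j") auto
qed simp

lemma simple_integrand_mono:
  "simple_integrand n u \<eta> \<Longrightarrow> i \<le> j \<Longrightarrow> j \<le> n \<Longrightarrow> u i \<le> u j"
  using simple_integrand_strict[of n u \<eta> i j] by (cases "i = j") auto

lemma simple_integrand_range:
  assumes "simple_integrand n u \<eta>" "i \<le> n" shows "u i \<in> {0..T}"
  using simple_integrand_mono[OF assms(1), of 0 i] simple_integrand_mono[OF assms(1), of i n]
    simple_integrandD(1,3)[OF assms(1)] assms(2) by auto

lemma sum_cells:
  fixes f :: "nat \<Rightarrow> 'z::real_vector"
  assumes si: "simple_integrand n u \<eta>" and j: "j < n" "s \<in> {u j<..u (Suc j)}"
  shows "(\<Sum>i<n. indicat_real {u i<..u (Suc i)} s *\<^sub>R f i) = f j"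
proof -
  have "s \<notin> {u i<..u (Suc i)}" if i: "i < n" "i \<noteq> j" for i
  proof (cases "i < j")
    case True
    then have "u (Suc i) \<le> u j" using j by (intro simple_integrand_mono[OF si]) auto
    then show ?thesis using j by auto
  next
    case False
    then have "u (Suc j) \<le> u i" using i by (intro simple_integrand_mono[OF si]) auto
    then show ?thesis using j by auto
  qed
  then have "(\<Sum>i<n. indicat_real {u i<..u (Suc i)} s *\<^sub>R f i) = (\<Sum>i<n. if i = j then f j else 0)"
    using j by (intro sum.cong) (auto simp: indicator_def)
  then show ?thesis using j(1) by simp
qed

lemma measurable_simple_process[measurable]: "(\<lambda>s. simple_process n u \<eta> s \<omega>) \<in> borel_measurable borel"
  unfolding simple_process_def by (intro borel_measurable_sum borel_measurable_scaleR) auto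

lemma simple_process_energy:
  assumes si: "simple_integrand n u \<eta>" and rt: "r \<le> t"
  shows "energy {r..t} (\<lambda>s. simple_process n u \<eta> s \<omega>) =
     ennreal (\<Sum>j<n. (norm (\<eta> j \<omega>))\<^sup>2 * (clip r t (u (Suc j)) - clip r t (u j)))"
proof -
  have eq: "(norm (simple_process n u \<eta> s \<omega>))\<^sup>2 = (\<Sum>j<n. (norm (\<eta> j \<omega>))\<^sup>2 * indicat_real {u j<..u (Suc j)} s)" for s
  proof (cases "\<exists>j<n. s \<in> {u j<..u (Suc j)}")
    case True
    then obtain j where "j < n" "s \<in> {u j<..u (Suc j)}" by blast
    note sum_cells[OF si this]
    from this[of "\<lambda>j. \<eta> j \<omega>"] this[of "\<lambda>j. (norm (\<eta> j \<omega>))\<^sup>2"] show ?thesis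
      by (simp add: simple_process_def mult.commute)
  next
    case False
    then have "indicat_real {u j<..u (Suc j)} s = 0" if "j < n" for j using that by (auto simp: indicator_def)
    then show ?thesis by (simp add: simple_process_def)
  qed
  have uu: "u j \<le> u (Suc j)" if "j < n" for j using simple_integrandD(2)[OF si that] by simp
  have "energy {r..t} (\<lambda>s. simple_process n u \<eta> s \<omega>) =
    (\<integral>\<^sup>+ s. (\<Sum>j<n. ennreal ((norm (\<eta> j \<omega>))\<^sup>2) * indicator ({r..t} \<inter> {u j<..u (Suc j)}) s) \<partial>lborel)"
    unfolding eq
  proof (rule nn_integral_cong)
    fix s
    have "ennreal (\<Sum>j<n. (norm (\<eta> j \<omega>))\<^sup>2 * indicat_real {u j<..u (Suc j)} s) =
      (\<Sum>j<n. ennreal ((norm (\<eta> j \<omega>))\<^sup>2 * indicat_real {u j<..u (Suc j)} s))"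
      by (rule sum_ennreal[symmetric]) auto
    then show "ennreal (\<Sum>j<n. (norm (\<eta> j \<omega>))\<^sup>2 * indicat_real {u j<..u (Suc j)} s) * indicator {r..t} s =
      (\<Sum>j<n. ennreal ((norm (\<eta> j \<omega>))\<^sup>2) * indicator ({r..t} \<inter> {u j<..u (Suc j)}) s)"
      by (auto simp: sum_distrib_right intro!: sum.cong split: split_indicator)
  qed
  also have "\<dots> = (\<Sum>j<n. ennreal ((norm (\<eta> j \<omega>))\<^sup>2) * emeasure lborel ({r..t} \<inter> {u j<..u (Suc j)}))"
    by (subst nn_integral_sum) (auto simp: nn_integral_cmult_indicator)
  also have "\<dots> = (\<Sum>j<n. ennreal ((norm (\<eta> j \<omega>))\<^sup>2 * (clip r t (u (Suc j)) - clip r t (u j))))"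
    by (rule sum.cong[OF refl]) (simp add: emeasure_cell[OF rt uu] ennreal_mult clip_mono[OF uu])
  also have "\<dots> = ennreal (\<Sum>j<n. (norm (\<eta> j \<omega>))\<^sup>2 * (clip r t (u (Suc j)) - clip r t (u j)))"
    by (rule sum_ennreal) (simp add: clip_mono[OF uu])
  finally show ?thesis .
qed

text \<open>For every order of x, r and t, stopping at t minus stopping at r gives the increment of
  W from r to the clipped point. Differences over a cell then no longer see r separately.\<close>

lemma simple_integral_diff:
  assumes rt: "r \<le> t"
  shows "simple_integral n u \<eta> t \<omega> - simple_integral n u \<eta> r \<omega> =
     (\<Sum>j<n. \<eta> j \<omega> \<bullet> (WS (clip r t (u (Suc j))) \<omega> - WS (clip r t (u j)) \<omega>))"
proof -
  have *: "WS (min x t) \<omega> - WS (min x r) \<omega> = WS (clip r t x) \<omega> - WS r \<omega>" for x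
    using rt by (cases "x \<le> r"; cases "x \<le> t") (auto simp: clip_def min_def max_def)
  have "WS (min y t) \<omega> - WS (min x t) \<omega> - (WS (min y r) \<omega> - WS (min x r) \<omega>) =
     WS (clip r t y) \<omega> - WS (clip r t x) \<omega>" for x y
  proof -
    have "WS (min y t) \<omega> - WS (min x t) \<omega> - (WS (min y r) \<omega> - WS (min x r) \<omega>) =
      (WS (min y t) \<omega> - WS (min y r) \<omega>) - (WS (min x t) \<omega> - WS (min x r) \<omega>)" by simp
    then show ?thesis by (simp only: *) simp
  qed
  then show ?thesis
    unfolding simple_integral_def sum_subtractf[symmetric] inner_diff_right[symmetric] by simp
qed

text \<open>Integrand and integral are paired and the grid is hidden, since the approximants in a
  sequence and those of two integrals live on different grids.\<close>

definition elementary :: "(real \<Rightarrow> 'a \<Rightarrow> real^'d) \<Rightarrow> (real \<Rightarrow> 'a \<Rightarrow> real) \<Rightarrow> bool" where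
  "elementary P J \<longleftrightarrow> (\<exists>n u \<eta>. simple_integrand n u \<eta> \<and> P = simple_process n u \<eta> \<and> J = simple_integral n u \<eta>)"

lemma ito_integral_altdef:
  "ito_integral h Z \<longleftrightarrow> (\<exists>P J. (\<forall>m. elementary (P m) (J m)) \<and>
     (AE \<omega> in M. (\<lambda>m. energy {0..T} (\<lambda>s. P m s \<omega> - h s \<omega>)) \<longlonglongrightarrow> 0) \<and>
     (AE \<omega> in M. uniform_limit {0..T} (\<lambda>m t. J m t \<omega>) (\<lambda>t. Z t \<omega>) sequentially))"
  (is "_ \<longleftrightarrow> ?R")
proof
  assume "ito_integral h Z"
  then obtain n u \<eta> where *: "\<forall>m. simple_integrand (n m) (u m) (\<eta> m)"
    "AE \<omega> in M. (\<lambda>m. energy {0..T} (\<lambda>s. simple_process (n m) (u m) (\<eta> m) s \<omega> - h s \<omega>)) \<longlonglongrightarrow> 0"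
    "AE \<omega> in M. uniform_limit {0..T} (\<lambda>m t. simple_integral (n m) (u m) (\<eta> m) t \<omega>) (\<lambda>t. Z t \<omega>) sequentially"
    unfolding ito_integral_def by blast
  then have "\<forall>m. elementary (simple_process (n m) (u m) (\<eta> m)) (simple_integral (n m) (u m) (\<eta> m))"
    unfolding elementary_def by blast
  with *(2,3) show ?R
    by (intro exI[of _ "\<lambda>m. simple_process (n m) (u m) (\<eta> m)"] exI[of _ "\<lambda>m. simple_integral (n m) (u m) (\<eta> m)"]) simp
next
  assume ?R
  then obtain P J where *: "\<forall>m. elementary (P m) (J m)"
    "AE \<omega> in M. (\<lambda>m. energy {0..T} (\<lambda>s. P m s \<omega> - h s \<omega>)) \<longlonglongrightarrow> 0"
    "AE \<omega> in M. uniform_limit {0..T} (\<lambda>m t. J m t \<omega>) (\<lambda>t. Z t \<omega>) sequentially" by blast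
  from *(1) obtain n u \<eta> where **: "\<And>m. simple_integrand (n m) (u m) (\<eta> m)"
    "\<And>m. P m = simple_process (n m) (u m) (\<eta> m)" "\<And>m. J m = simple_integral (n m) (u m) (\<eta> m)"
    unfolding elementary_def by metis
  show "ito_integral h Z"
    unfolding ito_integral_def using **(1) *(2,3)[unfolded **(2,3)] by blast
qed

lemma elementary_measurable: "elementary P J \<Longrightarrow> (\<lambda>s. P s \<omega>) \<in> borel_measurable borel"
  by (auto simp: elementary_def)

lemma elementary_energy:
  assumes "elementary P J" "r \<le> t"
  shows "energy {r..t} (\<lambda>s. P s \<omega>) = ennreal (enn2real (energy {r..t} (\<lambda>s. P s \<omega>)))"
  using assms simple_process_energy by (auto simp: elementary_def)

text \<open>Truncating the integrand once its energy on \<open>[r,t]\<close> exceeds \<open>N\<close> keeps the exponential martingale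
  bounded uniformly over all integrands, which is what the passage to the limit needs.\<close>

lemma simple_exponential:
  fixes Y :: "'a \<Rightarrow> complex"
  assumes el: "elementary P J" and rt: "0 \<le> r" "r \<le> t" "t \<le> T"
    and Y: "Y \<in> borel_measurable (filt r)" "\<And>\<omega>. \<omega> \<in> space M \<Longrightarrow> norm (Y \<omega>) \<le> C" and N: "N \<ge> 0"
  defines "Q \<equiv> \<lambda>\<omega>. enn2real (energy {r..t} (\<lambda>s. P s \<omega>))"
  shows "\<exists>Z\<in>borel_measurable M. (\<forall>\<omega>\<in>space M. norm (Z \<omega>) \<le> C * exp (x\<^sup>2 * N / 2)) \<and>
     (LINT \<omega>|M. Z \<omega>) = (LINT \<omega>|M. Y \<omega>) \<and>
     (\<forall>\<omega>\<in>space M. Q \<omega> \<le> N \<longrightarrow>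
        Z \<omega> = Y \<omega> * of_real (exp (x\<^sup>2 * Q \<omega> / 2)) * iexp (x * (J t \<omega> - J r \<omega>)))"
proof -
  obtain n u \<eta> where si: "simple_integrand n u \<eta>" and P: "P = simple_process n u \<eta>" and J: "J = simple_integral n u \<eta>"
    using el unfolding elementary_def by blast
  define a where "a j = clip r t (u j)" for j
  define D where "D j = a (Suc j) - a j" for j
  define q where "q j \<omega> = (norm (\<eta> j \<omega>))\<^sup>2 * D j" for j \<omega>
  \<comment> \<open>The sum includes cell j itself, whose energy is already known at its left end
    point because the integrand is. So the cut-off is adapted and the retained energy never exceeds
    N.\<close>
  define c where "c j \<omega> = (if (\<Sum>i<Suc j. q i \<omega>) \<le> N then 1 else 0 :: real)" for j \<omega>
  define dW where "dW j \<omega> = WS (a (Suc j)) \<omega> - WS (a j) \<omega>" for j \<omega>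
  define Qt where "Qt m \<omega> = (\<Sum>j<m. c j \<omega> * q j \<omega>)" for m \<omega>
  define It where "It m \<omega> = (\<Sum>j<m. c j \<omega> * (\<eta> j \<omega> \<bullet> dW j \<omega>))" for m \<omega>
  define Z where "Z m \<omega> = Y \<omega> * of_real (exp (x\<^sup>2 * Qt m \<omega> / 2)) * iexp (x * It m \<omega>)" for m \<omega>
  have ar: "r \<le> a j" "a j \<le> t" for j using clip_bounds[OF rt(2)] by (auto simp: a_def)
  have D0: "D j \<ge> 0" if "j < n" for j
    using clip_mono[of "u j" "u (Suc j)" r t] simple_integrandD(2)[OF si that] by (simp add: D_def a_def)
  have q0: "q j \<omega> \<ge> 0" if "j < n" for j \<omega> using D0[OF that] by (simp add: q_def)
  have amono: "a i \<le> a j" if "i \<le> j" "j \<le> n" for i j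
    unfolding a_def by (intro clip_mono simple_integrand_mono[OF si that])
  \<comment> \<open>A cell starting at or after t is clipped to the single point t, where its
    integrand need not be known yet. Such a cell has \<open>D j = 0\<close> and contributes
    nothing.\<close>
  have \<eta>m: "\<eta> j \<in> borel_measurable (filt (a j))" if j: "j < n" "D j \<noteq> 0" for j
  proof -
    have "u j < t"
    proof (rule ccontr)
      assume "\<not> u j < t"
      then have "a j = t" "a (Suc j) = t" using rt simple_integrandD(2)[OF si j(1)] by (auto simp: a_def clip_def)
      then show False using j by (simp add: D_def)
    qed
    then have "u j \<le> a j" by (auto simp: a_def clip_def)
    then show ?thesis by (rule filt_measurable_mono[OF _ simple_integrandD(4)[OF si j(1)]])
  qed
  have qm: "q i \<in> borel_measurable (filt (a j))" if "i \<le> j" "j < n" for i j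
  proof (cases "D i = 0")
    case True
    then show ?thesis by (simp add: q_def[abs_def])
  next
    case False
    have [measurable]: "\<eta> i \<in> borel_measurable (filt (a j))"
      using filt_measurable_mono[OF amono[of i j] \<eta>m[of i]] that False by auto
    show ?thesis unfolding q_def by measurable
  qed
  have cm: "c j \<in> borel_measurable (filt (a j))" if "j < n" for j
  proof -
    have [measurable]: "(\<lambda>\<omega>. \<Sum>i<Suc j. q i \<omega>) \<in> borel_measurable (filt (a j))"
      using qm that by (intro borel_measurable_sum) auto
    show ?thesis unfolding c_def by measurable
  qed
  have Qt_le: "Qt m \<omega> \<le> N \<and> Qt m \<omega> \<le> (\<Sum>i<m. q i \<omega>)" if "m \<le> n" for m \<omega>
    using that
  proof (induction m)
    case (Suc m)
    then show ?case using q0[of m \<omega>] by (auto simp: Qt_def c_def)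
  qed (simp add: Qt_def N)
  have main: "Z m \<in> borel_measurable (filt (a m)) \<and> (\<forall>\<omega>\<in>space M. norm (Z m \<omega>) \<le> C * exp (x\<^sup>2 * N / 2)) \<and>
     (LINT \<omega>|M. Z m \<omega>) = (LINT \<omega>|M. Y \<omega>)" if "m \<le> n" for m
    using that
  proof (induction m)
    case 0
    have "norm (Y \<omega>) \<le> C * exp (x\<^sup>2 * N / 2)" if "\<omega> \<in> space M" for \<omega>
    proof -
      have "1 \<le> exp (x\<^sup>2 * N / 2)" using N by simp
      from mult_left_mono[OF this order_trans[OF norm_ge_zero Y(2)[OF that]]]
      show ?thesis using Y(2)[OF that] by simp
    qed
    then show ?case using filt_measurable_mono[OF ar(1) Y(1)] by (simp add: Z_def[abs_def] Qt_def It_def)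
  next
    case (Suc m)
    then have m: "m < n" and IH: "Z m \<in> borel_measurable (filt (a m))"
      "\<And>\<omega>. \<omega> \<in> space M \<Longrightarrow> norm (Z m \<omega>) \<le> C * exp (x\<^sup>2 * N / 2)" "(LINT \<omega>|M. Z m \<omega>) = (LINT \<omega>|M. Y \<omega>)"
      by auto
    have bound: "norm (Z (Suc m) \<omega>) \<le> C * exp (x\<^sup>2 * N / 2)" if w: "\<omega> \<in> space M" for \<omega>
    proof -
      have "x\<^sup>2 * Qt (Suc m) \<omega> \<le> x\<^sup>2 * N" using Qt_le[of "Suc m" \<omega>] m by (intro mult_left_mono) auto
      then show ?thesis
        unfolding Z_def norm_mult using Y(2)[OF w] order_trans[OF norm_ge_zero Y(2)[OF w]]
        by (simp add: mult_mono)
    qed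
    show ?case
    proof (cases "D m = 0")
      case True
      then have "a (Suc m) = a m" by (simp add: D_def)
      moreover have "Z (Suc m) = Z m"
        using True \<open>a (Suc m) = a m\<close> by (simp add: Z_def[abs_def] Qt_def It_def q_def dW_def)
      ultimately show ?thesis using IH by simp
    next
      case False
      let ?e = "\<lambda>\<omega>. (x * c m \<omega>) *\<^sub>R \<eta> m \<omega>"
      note [measurable] = cm[OF m] \<eta>m[OF m False] IH(1)
      have em: "?e \<in> borel_measurable (filt (a m))" by measurable
      have eb: "bounded (?e ` space M)"
      proof -
        obtain R where R: "\<And>\<omega>. \<omega> \<in> space M \<Longrightarrow> norm (\<eta> m \<omega>) \<le> R"
          using simple_integrandD(5)[OF si m] by (auto simp: bounded_iff)
        have "norm (?e \<omega>) \<le> \<bar>x\<bar> * R" if "\<omega> \<in> space M" for \<omega>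
          using R[OF that] order_trans[OF norm_ge_zero R[OF that]] by (auto simp: c_def intro!: mult_left_mono)
        then show ?thesis by (auto simp: bounded_iff)
      qed
      have Zeq: "Z (Suc m) \<omega> = Z m \<omega> * of_real (exp ((norm (?e \<omega>))\<^sup>2 * (a (Suc m) - a m) / 2)) *
           iexp (?e \<omega> \<bullet> (WS (a (Suc m)) \<omega> - WS (a m) \<omega>))" for \<omega>
      proof -
        have "(c m \<omega>)\<^sup>2 = c m \<omega>" by (simp add: c_def)
        then have 1: "(norm (?e \<omega>))\<^sup>2 * (a (Suc m) - a m) = x\<^sup>2 * (c m \<omega> * q m \<omega>)"
          by (simp add: q_def D_def power_mult_distrib)
        have 2: "?e \<omega> \<bullet> (WS (a (Suc m)) \<omega> - WS (a m) \<omega>) = x * (c m \<omega> * (\<eta> m \<omega> \<bullet> dW m \<omega>))"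
          by (simp add: dW_def)
        show ?thesis unfolding 1 2
          by (simp add: Z_def Qt_def It_def distrib_left add_divide_distrib exp_add mult_ac)
      qed
      have am: "0 \<le> a m" "a m \<le> a (Suc m)" "a (Suc m) \<le> T"
        using ar[of m] ar[of "Suc m"] rt amono[of m "Suc m"] m by auto
      have "(LINT \<omega>|M. Z (Suc m) \<omega>) = (LINT \<omega>|M. Z m \<omega>)"
        unfolding Zeq by (rule increment_exponential[OF am IH(1,2) em eb])
      moreover have "Z (Suc m) \<in> borel_measurable (filt (a (Suc m)))"
      proof -
        have [measurable]: "Z m \<in> borel_measurable (filt (a (Suc m)))" "?e \<in> borel_measurable (filt (a (Suc m)))"
          by (rule filt_measurable_mono[OF am(2) IH(1)], rule filt_measurable_mono[OF am(2) em])
        have [measurable]: "WS (a (Suc m)) \<in> borel_measurable (filt (a (Suc m)))" "WS (a m) \<in> borel_measurable (filt (a (Suc m)))"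
          using am by (auto intro!: WS_filt_measurable)
        show ?thesis unfolding Zeq[abs_def] by measurable
      qed
      ultimately show ?thesis using bound IH(3) by auto
    qed
  qed
  have "Z n \<in> borel_measurable M" using main[of n] ar(2)[of n] rt by (intro filt_measurable_M[of "a n"]) auto
  moreover have "Z n \<omega> = Y \<omega> * of_real (exp (x\<^sup>2 * Q \<omega> / 2)) * iexp (x * (J t \<omega> - J r \<omega>))"
    if "Q \<omega> \<le> N" for \<omega>
  proof -
    have Q: "Q \<omega> = (\<Sum>j<n. q j \<omega>)"
      unfolding Q_def P simple_process_energy[OF si rt(2)]
      by (subst enn2real_ennreal) (auto intro!: sum_nonneg q0 simp: q_def[symmetric] D_def[symmetric] a_def[symmetric])
    have c: "c j \<omega> = 1" if "j < n" for j
    proof -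
      have "(\<Sum>i<Suc j. q i \<omega>) \<le> (\<Sum>i<n. q i \<omega>)" by (intro sum_mono2) (use that q0 in auto)
      then show ?thesis using \<open>Q \<omega> \<le> N\<close> by (simp add: c_def Q)
    qed
    have "Qt n \<omega> = Q \<omega>" by (simp add: Qt_def Q c)
    moreover have "It n \<omega> = J t \<omega> - J r \<omega>"
      unfolding J simple_integral_diff[OF rt(2)] by (simp add: It_def c dW_def a_def)
    ultimately show ?thesis by (simp add: Z_def)
  qed
  ultimately show ?thesis using main[of n] by (intro bexI[of _ "Z n"]) auto
qed

text \<open>Passage to the limit with truncation level B + 1. The energies converge to V <= B, so at
  almost every omega the truncation is eventually inactive, while the bound it provides dominates
  the whole sequence.\<close>

lemma ito_exponential:
  fixes Y :: "'a \<Rightarrow> complex"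
  assumes ito: "ito_integral h Z" and rt: "0 \<le> r" "r \<le> t" "t \<le> T"
    and Y: "Y \<in> borel_measurable (filt r)" "\<And>\<omega>. \<omega> \<in> space M \<Longrightarrow> norm (Y \<omega>) \<le> C"
    and h: "\<And>\<omega>. \<omega> \<in> space M \<Longrightarrow> (\<lambda>s. h s \<omega>) \<in> borel_measurable borel"
    and V: "\<And>\<omega>. \<omega> \<in> space M \<Longrightarrow> energy {r..t} (\<lambda>s. h s \<omega>) = ennreal (V \<omega>)"
      "\<And>\<omega>. \<omega> \<in> space M \<Longrightarrow> 0 \<le> V \<omega> \<and> V \<omega> \<le> B"
  shows "(LINT \<omega>|M. Y \<omega> * of_real (exp (x\<^sup>2 * V \<omega> / 2)) * iexp (x * (Z t \<omega> - Z r \<omega>))) = (LINT \<omega>|M. Y \<omega>)"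
proof -
  obtain P J where el: "\<And>m. elementary (P m) (J m)"
    and L2: "AE \<omega> in M. (\<lambda>m. energy {0..T} (\<lambda>s. P m s \<omega> - h s \<omega>)) \<longlonglongrightarrow> 0"
    and ul: "AE \<omega> in M. uniform_limit {0..T} (\<lambda>m t. J m t \<omega>) (\<lambda>t. Z t \<omega>) sequentially"
    using ito unfolding ito_integral_altdef by blast
  define Q where "Q m \<omega> = enn2real (energy {r..t} (\<lambda>s. P m s \<omega>))" for m \<omega>
  obtain \<omega>0 where w0: "\<omega>0 \<in> space M" using not_empty by blast
  have B: "B + 1 \<ge> 0" using V(2)[OF w0] by linarith
  let ?E = "\<lambda>m \<omega>. Y \<omega> * of_real (exp (x\<^sup>2 * Q m \<omega> / 2)) * iexp (x * (J m t \<omega> - J m r \<omega>))"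
  let ?R = "\<lambda>m Z. Z \<in> borel_measurable M \<and> (\<forall>\<omega>\<in>space M. norm (Z \<omega>) \<le> C * exp (x\<^sup>2 * (B + 1) / 2)) \<and>
     (LINT \<omega>|M. Z \<omega>) = (LINT \<omega>|M. Y \<omega>) \<and> (\<forall>\<omega>\<in>space M. Q m \<omega> \<le> B + 1 \<longrightarrow> Z \<omega> = ?E m \<omega>)"
  have "\<forall>m. \<exists>Z. ?R m Z"
    unfolding Q_def Bex_def[symmetric] by (intro allI simple_exponential[OF el rt Y B])
  from choice[OF this] obtain Zm where Zm': "\<forall>m. ?R m (Zm m)" ..
  note Zm = Zm'[rule_format, THEN conjunct1]
    Zm'[rule_format, THEN conjunct2, THEN conjunct1, rule_format]
    Zm'[rule_format, THEN conjunct2, THEN conjunct2, THEN conjunct1]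
    Zm'[rule_format, THEN conjunct2, THEN conjunct2, THEN conjunct2, rule_format]
  have lim: "AE \<omega> in M. (\<lambda>m. Zm m \<omega>) \<longlonglongrightarrow> Y \<omega> * of_real (exp (x\<^sup>2 * V \<omega> / 2)) * iexp (x * (Z t \<omega> - Z r \<omega>))"
    using L2 ul AE_space
  proof eventually_elim
    case (elim \<omega>)
    have "(\<lambda>m. Q m \<omega>) \<longlonglongrightarrow> V \<omega>"
    proof (rule energy_tendsto)
      show "(\<lambda>m. energy {r..t} (\<lambda>s. P m s \<omega> - h s \<omega>)) \<longlonglongrightarrow> 0"
      proof (rule tendsto_sandwich[OF _ _ tendsto_const elim(1)])
        show "\<forall>\<^sub>F m in sequentially. energy {r..t} (\<lambda>s. P m s \<omega> - h s \<omega>) \<le> energy {0..T} (\<lambda>s. P m s \<omega> - h s \<omega>)"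
          using rt by (intro always_eventually allI nn_integral_mono) (auto split: split_indicator)
      qed simp
      show "energy {r..t} (\<lambda>s. P m s \<omega>) = ennreal (Q m \<omega>)" for m
        unfolding Q_def by (rule elementary_energy[OF el rt(2)])
    qed (use elim V h in \<open>auto simp: Q_def intro: elementary_measurable[OF el]\<close>)
    moreover have "(\<lambda>m. J m s \<omega>) \<longlonglongrightarrow> Z s \<omega>" if "s \<in> {0..T}" for s
      using elim(2) that by (rule tendsto_uniform_limitI)
    ultimately have l: "(\<lambda>m. ?E m \<omega>) \<longlonglongrightarrow> Y \<omega> * of_real (exp (x\<^sup>2 * V \<omega> / 2)) * iexp (x * (Z t \<omega> - Z r \<omega>))"
      using rt by (intro tendsto_intros) auto
    have "V \<omega> < B + 1" using V(2)[of \<omega>] elim by auto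
    then have "\<forall>\<^sub>F m in sequentially. Q m \<omega> < B + 1"
      using \<open>(\<lambda>m. Q m \<omega>) \<longlonglongrightarrow> V \<omega>\<close> by (rule order_tendstoD(2)[rotated])
    then have "\<forall>\<^sub>F m in sequentially. ?E m \<omega> = Zm m \<omega>"
      by eventually_elim (use Zm(4) elim(3) in auto)
    then show ?case by (rule Lim_transform_eventually[OF l])
  qed
  have "(\<lambda>m. LINT \<omega>|M. Zm m \<omega>) \<longlonglongrightarrow> (LINT \<omega>|M. Y \<omega> * of_real (exp (x\<^sup>2 * V \<omega> / 2)) * iexp (x * (Z t \<omega> - Z r \<omega>)))"
  proof (rule integral_dominated_convergence[OF _ _ _ lim])
    show "(\<lambda>\<omega>. Y \<omega> * of_real (exp (x\<^sup>2 * V \<omega> / 2)) * iexp (x * (Z t \<omega> - Z r \<omega>))) \<in> borel_measurable M"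
      by (rule borel_measurable_AE_limit[OF Zm(1) lim])
    show "integrable M (\<lambda>_. C * exp (x\<^sup>2 * (B + 1) / 2))" by simp
  qed (use Zm in auto)
  then show ?thesis unfolding Zm(3) by (simp add: LIMSEQ_const_iff)
qed

end

section \<open>Uniqueness of stochastic integrals\<close>

context market
begin

text \<open>Two simple integrands can be subtracted coefficient by coefficient only on a common
  grid.\<close>

lemma simple_refine:
  assumes si: "simple_integrand n u \<eta>"
    and w: "\<And>l. l < N \<Longrightarrow> w l < w (Suc l)" "0 \<le> w 0" "w N \<le> T" and sub: "u ` {..n} \<subseteq> w ` {..N}"
  obtains \<eta>' where "simple_integrand N w \<eta>'"
    "\<And>s \<omega>. simple_process N w \<eta>' s \<omega> = simple_process n u \<eta> s \<omega>"
    "\<And>t \<omega>. simple_integral N w \<eta>' t \<omega> = simple_integral n u \<eta> t \<omega>"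
proof -
  have "\<exists>l\<le>N. w l = u j" if "j \<le> n" for j
  proof -
    have "u j \<in> w ` {..N}" using sub that by auto
    then show ?thesis by auto
  qed
  then obtain p where p: "\<And>j. j \<le> n \<Longrightarrow> p j \<le> N" "\<And>j. j \<le> n \<Longrightarrow> w (p j) = u j" by metis
  note mono = grid_mono[of N w, OF w(1)]
  have pp: "p j \<le> p (Suc j)" if "j < n" for j
  proof (rule ccontr)
    assume "\<not> p j \<le> p (Suc j)"
    then have "w (p (Suc j)) \<le> w (p j)" using p(1)[of j] that by (intro mono) auto
    then show False using p(2) simple_integrandD(2)[OF si that] that by simp
  qed
  \<comment> \<open>The coefficient is 1 exactly when the fine cell l lies in the coarse cell j, as
    \<open>p\<close> locates the coarse points in the fine grid. The telescoping below is stated for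
    an arbitrary function of time, to serve both the process and its integral.\<close>
  define e where "e j l = (if p j \<le> l \<and> l < p (Suc j) then 1 else 0 :: real)" for j l
  have tele: "(\<Sum>l<N. e j l *\<^sub>R (f (w (Suc l)) - f (w l))) = f (u (Suc j)) - f (u j)"
    if j: "j < n" for j and f :: "real \<Rightarrow> 'z::real_vector"
  proof -
    have "(\<Sum>l<N. e j l *\<^sub>R (f (w (Suc l)) - f (w l))) = (\<Sum>l\<in>{p j..<p (Suc j)}. f (w (Suc l)) - f (w l))"
      using p(1)[of "Suc j"] j by (intro sum.mono_neutral_cong_right) (auto simp: e_def)
    also have "\<dots> = f (w (p (Suc j))) - f (w (p j))"
      using sum_Suc_diff'[OF pp[OF j], of "\<lambda>l. f (w l)"] .
    finally show ?thesis using p(2) j by simp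
  qed
  define \<eta>' where "\<eta>' l \<omega> = (\<Sum>j<n. e j l *\<^sub>R \<eta> j \<omega>)" for l \<omega>
  have "simple_integrand N w \<eta>'"
    unfolding simple_integrand_def
  proof (intro conjI allI impI)
    fix l assume l: "l < N"
    have "(\<lambda>\<omega>. e j l *\<^sub>R \<eta> j \<omega>) \<in> borel_measurable (filt (w l))" if j: "j < n" for j
    proof (cases "e j l = 0")
      case False
      then have "w (p j) \<le> w l" using l by (intro mono) (auto simp: e_def split: if_splits)
      then have "\<eta> j \<in> borel_measurable (filt (w l))"
        using p(2)[of j] j by (intro filt_measurable_mono[OF _ simple_integrandD(4)[OF si j]]) auto
      then show ?thesis by simp
    qed simp
    then show "\<eta>' l \<in> borel_measurable (filt (w l))" unfolding \<eta>'_def by (intro borel_measurable_sum) auto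
    have "\<forall>j. \<exists>R. j < n \<longrightarrow> (\<forall>\<omega>\<in>space M. norm (\<eta> j \<omega>) \<le> R)"
      using simple_integrandD(5)[OF si] unfolding bounded_iff by (metis imageI)
    then obtain R where R: "\<And>j \<omega>. j < n \<Longrightarrow> \<omega> \<in> space M \<Longrightarrow> norm (\<eta> j \<omega>) \<le> R j" by metis
    have "norm (\<eta>' l \<omega>) \<le> (\<Sum>j<n. R j)" if "\<omega> \<in> space M" for \<omega>
      unfolding \<eta>'_def
    proof (rule sum_norm_le)
      fix j assume "j \<in> {..<n}"
      then show "norm (e j l *\<^sub>R \<eta> j \<omega>) \<le> R j"
        using R[of j \<omega>] that order_trans[OF norm_ge_zero R[of j \<omega>]] by (auto simp: e_def)
    qed
    then show "bounded (\<eta>' l ` space M)" by (auto simp: bounded_iff)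
  qed (use w in auto)
  moreover have "simple_process N w \<eta>' s \<omega> = simple_process n u \<eta> s \<omega>" for s \<omega>
  proof -
    \<comment> \<open>With this sign the increment of f over (a, b] is 1 exactly when a < s <= b, so
      the indicator of a cell telescopes as well.\<close>
    define f where "f x = - (if x < s then 1 else 0 :: real)" for x
    have ind: "indicat_real {a<..b} s = f b - f a" if "a \<le> b" for a b
      using that by (auto simp: f_def indicator_def)
    have "simple_process N w \<eta>' s \<omega> = (\<Sum>l<N. \<Sum>j<n. (e j l * (f (w (Suc l)) - f (w l))) *\<^sub>R \<eta> j \<omega>)"
      unfolding simple_process_def \<eta>'_def scaleR_sum_right
      by (intro sum.cong refl) (simp add: ind[OF less_imp_le[OF w(1)]] mult.commute)
    also have "\<dots> = (\<Sum>j<n. (\<Sum>l<N. e j l *\<^sub>R (f (w (Suc l)) - f (w l))) *\<^sub>R \<eta> j \<omega>)"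
      by (subst sum.swap) (simp add: scaleR_sum_left)
    also have "\<dots> = simple_process n u \<eta> s \<omega>"
      unfolding simple_process_def
      by (intro sum.cong refl) (simp only: tele[of _ f] lessThan_iff ind[OF less_imp_le[OF simple_integrandD(2)[OF si]]])
    finally show ?thesis .
  qed
  moreover have "simple_integral N w \<eta>' t \<omega> = simple_integral n u \<eta> t \<omega>" for t \<omega>
  proof -
    let ?G = "\<lambda>x. WS (min x t) \<omega>"
    have "simple_integral N w \<eta>' t \<omega> = (\<Sum>l<N. \<Sum>j<n. \<eta> j \<omega> \<bullet> (e j l *\<^sub>R (?G (w (Suc l)) - ?G (w l))))"
      unfolding simple_integral_def \<eta>'_def inner_sum_left by simp
    also have "\<dots> = (\<Sum>j<n. \<eta> j \<omega> \<bullet> (\<Sum>l<N. e j l *\<^sub>R (?G (w (Suc l)) - ?G (w l))))"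
      by (subst sum.swap) (simp only: inner_sum_right)
    also have "\<dots> = simple_integral n u \<eta> t \<omega>"
      unfolding simple_integral_def by (intro sum.cong refl) (simp only: tele[of _ ?G] lessThan_iff)
    finally show ?thesis .
  qed
  ultimately show ?thesis using that by blast
qed

lemma elementary_diff:
  assumes el: "elementary P J" "elementary P' J'"
  shows "elementary (\<lambda>s \<omega>. P s \<omega> - P' s \<omega>) (\<lambda>t \<omega>. J t \<omega> - J' t \<omega>)"
proof -
  obtain n u \<eta> where si: "simple_integrand n u \<eta>" and P: "P = simple_process n u \<eta>" "J = simple_integral n u \<eta>"
    using el(1) unfolding elementary_def by blast
  obtain n' u' \<eta>' where si': "simple_integrand n' u' \<eta>'"
    and P': "P' = simple_process n' u' \<eta>'" "J' = simple_integral n' u' \<eta>'"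
    using el(2) unfolding elementary_def by blast
  obtain N w where w: "\<And>l. l < N \<Longrightarrow> w l < w (Suc l)" "w ` {..N} = u ` {..n} \<union> u' ` {..n'}"
    using finite_set_grid[of "u ` {..n} \<union> u' ` {..n'}"] by auto
  have "w l \<in> {0..T}" if "l \<le> N" for l
  proof -
    have "w l \<in> u ` {..n} \<union> u' ` {..n'}" using w(2) that by auto
    then show ?thesis using simple_integrand_range[OF si] simple_integrand_range[OF si'] by auto
  qed
  from this[of 0] this[of N] have w0: "0 \<le> w 0" "w N \<le> T" by auto
  obtain a where a: "simple_integrand N w a"
    "\<And>s \<omega>. simple_process N w a s \<omega> = simple_process n u \<eta> s \<omega>"
    "\<And>t \<omega>. simple_integral N w a t \<omega> = simple_integral n u \<eta> t \<omega>"
    by (rule simple_refine[OF si w(1) w0]) (auto simp: w(2))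
  obtain b where b: "simple_integrand N w b"
    "\<And>s \<omega>. simple_process N w b s \<omega> = simple_process n' u' \<eta>' s \<omega>"
    "\<And>t \<omega>. simple_integral N w b t \<omega> = simple_integral n' u' \<eta>' t \<omega>"
    by (rule simple_refine[OF si' w(1) w0]) (auto simp: w(2))
  show ?thesis
    unfolding elementary_def
  proof (intro exI conjI ext)
    show "simple_integrand N w (\<lambda>l \<omega>. a l \<omega> - b l \<omega>)"
      using a(1) b(1) unfolding simple_integrand_def
      by (auto intro!: borel_measurable_diff bounded_minus_comp)
    show "P s \<omega> - P' s \<omega> = simple_process N w (\<lambda>l \<omega>. a l \<omega> - b l \<omega>) s \<omega>" for s \<omega>
      unfolding P P' a(2)[symmetric] b(2)[symmetric] by (simp add: simple_process_def scaleR_diff_right sum_subtractf)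
    show "J t \<omega> - J' t \<omega> = simple_integral N w (\<lambda>l \<omega>. a l \<omega> - b l \<omega>) t \<omega>" for t \<omega>
      unfolding P P' a(3)[symmetric] b(3)[symmetric] by (simp add: simple_integral_def inner_diff_left sum_subtractf)
  qed
qed

lemma ito_integral_diff:
  assumes ito: "ito_integral h Z" "ito_integral h' Z'"
    and h: "\<And>\<omega>. \<omega> \<in> space M \<Longrightarrow> (\<lambda>s. h s \<omega>) \<in> borel_measurable borel"
      "\<And>\<omega>. \<omega> \<in> space M \<Longrightarrow> (\<lambda>s. h' s \<omega>) \<in> borel_measurable borel"
  shows "ito_integral (\<lambda>s \<omega>. h s \<omega> - h' s \<omega>) (\<lambda>t \<omega>. Z t \<omega> - Z' t \<omega>)"
proof -
  obtain P J where A: "\<And>m. elementary (P m) (J m)"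
    "AE \<omega> in M. (\<lambda>m. energy {0..T} (\<lambda>s. P m s \<omega> - h s \<omega>)) \<longlonglongrightarrow> 0"
    "AE \<omega> in M. uniform_limit {0..T} (\<lambda>m t. J m t \<omega>) (\<lambda>t. Z t \<omega>) sequentially"
    using ito(1) unfolding ito_integral_altdef by blast
  obtain P' J' where B: "\<And>m. elementary (P' m) (J' m)"
    "AE \<omega> in M. (\<lambda>m. energy {0..T} (\<lambda>s. P' m s \<omega> - h' s \<omega>)) \<longlonglongrightarrow> 0"
    "AE \<omega> in M. uniform_limit {0..T} (\<lambda>m t. J' m t \<omega>) (\<lambda>t. Z' t \<omega>) sequentially"
    using ito(2) unfolding ito_integral_altdef by blast
  show ?thesis
    unfolding ito_integral_altdef
  proof (intro exI conjI allI)
    show "elementary (\<lambda>s \<omega>. P m s \<omega> - P' m s \<omega>) (\<lambda>t \<omega>. J m t \<omega> - J' m t \<omega>)" for m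
      by (rule elementary_diff[OF A(1) B(1)])
    show "AE \<omega> in M. (\<lambda>m. energy {0..T} (\<lambda>s. P m s \<omega> - P' m s \<omega> - (h s \<omega> - h' s \<omega>))) \<longlonglongrightarrow> 0"
      using A(2) B(2) AE_space
    proof eventually_elim
      case (elim \<omega>)
      let ?a = "\<lambda>m s. P m s \<omega> - h s \<omega>" and ?b = "\<lambda>m s. P' m s \<omega> - h' s \<omega>"
      let ?u = "\<lambda>m. ennreal (1 + 1) * energy {0..T} (?a m) + ennreal (1 + 1 / 1) * energy {0..T} (?b m)"
      note [measurable] = h(1)[OF elim(3)] h(2)[OF elim(3)] elementary_measurable[OF A(1)] elementary_measurable[OF B(1)]
      have le: "energy {0..T} (\<lambda>s. P m s \<omega> - P' m s \<omega> - (h s \<omega> - h' s \<omega>)) \<le> ?u m" for m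
      proof -
        have "energy {0..T} (\<lambda>s. ?a m s + - ?b m s) \<le>
          ennreal (1 + 1) * energy {0..T} (?a m) + ennreal (1 + 1 / 1) * energy {0..T} (\<lambda>s. - ?b m s)"
          by (rule nn_integral_square_add_le) auto
        moreover have "?a m s + - ?b m s = P m s \<omega> - P' m s \<omega> - (h s \<omega> - h' s \<omega>)" for s by simp
        ultimately show ?thesis by (simp only: norm_minus_cancel)
      qed
      have "?u \<longlonglongrightarrow> ennreal (1 + 1) * 0 + ennreal (1 + 1 / 1) * 0"
        using elim(1,2) by (intro tendsto_add ennreal_tendsto_cmult) auto
      then have l: "?u \<longlonglongrightarrow> 0" by simp
      show ?case by (rule tendsto_sandwich[OF _ _ tendsto_const l]) (use le in auto)
    qed
    show "AE \<omega> in M. uniform_limit {0..T} (\<lambda>m t. J m t \<omega> - J' m t \<omega>) (\<lambda>t. Z t \<omega> - Z' t \<omega>) sequentially"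
      using A(3) B(3) by eventually_elim (rule uniform_limit_minus)
  qed
qed

lemma simple_integral_measurable:
  assumes si: "simple_integrand n u \<eta>" and t: "0 \<le> t"
  shows "simple_integral n u \<eta> t \<in> borel_measurable (filt t)"
  unfolding simple_integral_def
proof (rule borel_measurable_sum)
  fix j assume "j \<in> {..<n}"
  then have j: "j < n" by simp
  have u: "u j \<ge> 0" "u (Suc j) \<ge> 0" using simple_integrand_range[OF si, of j] simple_integrand_range[OF si, of "Suc j"] j by auto
  show "(\<lambda>\<omega>. \<eta> j \<omega> \<bullet> (WS (min (u (Suc j)) t) \<omega> - WS (min (u j) t) \<omega>)) \<in> borel_measurable (filt t)"
  proof (cases "u j \<le> t")
    case True
    have [measurable]: "\<eta> j \<in> borel_measurable (filt t)"
      by (rule filt_measurable_mono[OF True simple_integrandD(4)[OF si j]])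
    have [measurable]: "WS (min (u (Suc j)) t) \<in> borel_measurable (filt t)" "WS (min (u j) t) \<in> borel_measurable (filt t)"
      using u t by (auto intro!: WS_filt_measurable)
    show ?thesis by measurable
  next
    case False
    then have "min (u (Suc j)) t = min (u j) t" using simple_integrandD(2)[OF si j] by auto
    then show ?thesis by simp
  qed
qed

lemma elementary_adapted: "elementary P J \<Longrightarrow> 0 \<le> t \<Longrightarrow> J t \<in> borel_measurable (filt t)"
  using simple_integral_measurable by (auto simp: elementary_def)

lemma elementary_zero: "elementary P J \<Longrightarrow> J 0 \<omega> = 0"
proof -
  assume "elementary P J"
  then obtain n u \<eta> where si: "simple_integrand n u \<eta>" and J: "J = simple_integral n u \<eta>"
    unfolding elementary_def by blast
  show ?thesis
    unfolding J simple_integral_def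
  proof (rule sum.neutral, rule ballI)
    fix j assume "j \<in> {..<n}"
    then have "u j \<ge> 0" "u (Suc j) \<ge> 0" using simple_integrand_range[OF si] by auto
    then show "\<eta> j \<omega> \<bullet> (WS (min (u (Suc j)) 0) \<omega> - WS (min (u j) 0) \<omega>) = 0" by (simp add: min_absorb2)
  qed
qed

text \<open>The pointwise limit of the adapted approximants. A version is enough, since the integral
  up to t enters the conditional mean only through almost sure identities.\<close>

lemma ito_adapted_version:
  assumes ito: "ito_integral h Z" and t: "t \<in> {0..T}"
  obtains Z' where "Z' \<in> borel_measurable (filt t)" "AE \<omega> in M. Z t \<omega> = Z' \<omega>"
proof -
  obtain P J where A: "\<And>m. elementary (P m) (J m)"
    "AE \<omega> in M. uniform_limit {0..T} (\<lambda>m t. J m t \<omega>) (\<lambda>t. Z t \<omega>) sequentially"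
    using ito unfolding ito_integral_altdef by blast
  show ?thesis
  proof (rule that)
    show "(\<lambda>\<omega>. lim (\<lambda>m. J m t \<omega>)) \<in> borel_measurable (filt t)"
      using t by (intro borel_measurable_lim_metric elementary_adapted[OF A(1)]) auto
    show "AE \<omega> in M. Z t \<omega> = lim (\<lambda>m. J m t \<omega>)"
      using A(2)
    proof eventually_elim
      case (elim \<omega>)
      from tendsto_uniform_limitI[OF this t] show ?case by (rule limI[symmetric])
    qed
  qed
qed

lemma ito_measurable: "ito_integral h Z \<Longrightarrow> t \<in> {0..T} \<Longrightarrow> Z t \<in> borel_measurable M"
proof -
  assume "ito_integral h Z" and t: "t \<in> {0..T}"
  then obtain Z' where Z': "Z' \<in> borel_measurable (filt t)" "AE \<omega> in M. Z t \<omega> = Z' \<omega>" by (rule ito_adapted_version)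
  show ?thesis
  proof (rule measurable_AE_eq)
    show "Z' \<in> borel_measurable M" using t by (intro filt_measurable_M[OF _ Z'(1)]) auto
    show "AE \<omega> in M. Z' \<omega> = Z t \<omega>" using Z'(2) by auto
  qed simp
qed

lemma ito_zero: assumes ito: "ito_integral h Z" shows "AE \<omega> in M. Z 0 \<omega> = 0"
proof -
  obtain P J where A: "\<And>m. elementary (P m) (J m)"
    "AE \<omega> in M. uniform_limit {0..T} (\<lambda>m t. J m t \<omega>) (\<lambda>t. Z t \<omega>) sequentially"
    using ito unfolding ito_integral_altdef by blast
  from A(2) show ?thesis
  proof eventually_elim
    case (elim \<omega>)
    have "(\<lambda>m. J m 0 \<omega>) \<longlonglongrightarrow> Z 0 \<omega>"
      using T_pos by (intro tendsto_uniform_limitI[OF elim]) auto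
    then show ?case by (simp add: elementary_zero[OF A(1)] LIMSEQ_const_iff)
  qed
qed

text \<open>The difference is an integral with zero energy on [0, t]. The exponential identity with
  Y = 1 and V = 0 makes its characteristic function identically 1, so its law is the point mass at
  0. Agreement is asked on [0, t) because a perturbation is already active at its starting time
  t.\<close>

lemma ito_integral_unique:
  assumes ito: "ito_integral h Z" "ito_integral h' Z'"
    and h: "\<And>\<omega>. \<omega> \<in> space M \<Longrightarrow> (\<lambda>s. h s \<omega>) \<in> borel_measurable borel"
      "\<And>\<omega>. \<omega> \<in> space M \<Longrightarrow> (\<lambda>s. h' s \<omega>) \<in> borel_measurable borel"
    and t: "t \<in> {0..T}" and eq: "\<And>s \<omega>. \<omega> \<in> space M \<Longrightarrow> s \<in> {0..<t} \<Longrightarrow> h s \<omega> = h' s \<omega>"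
  shows "AE \<omega> in M. Z t \<omega> = Z' t \<omega>"
proof -
  let ?D = "\<lambda>s \<omega>. Z s \<omega> - Z' s \<omega>" and ?h = "\<lambda>s \<omega>. h s \<omega> - h' s \<omega>"
  have itoD: "ito_integral ?h ?D" by (rule ito_integral_diff[OF ito h])
  have D[measurable]: "?D t \<in> borel_measurable M" by (rule ito_measurable[OF itoD t])
  have ch: "(LINT \<omega>|M. iexp (x * ?D t \<omega>)) = 1" for x
  proof -
    have "(LINT \<omega>|M. 1 * of_real (exp (x\<^sup>2 * 0 / 2)) * iexp (x * (?D t \<omega> - ?D 0 \<omega>))) = (LINT \<omega>|M. 1)"
    proof (rule ito_exponential[OF itoD, where B = 0 and C = 1 and V = "\<lambda>_. 0"])
      fix \<omega> assume w: "\<omega> \<in> space M"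
      then show "(\<lambda>s. ?h s \<omega>) \<in> borel_measurable borel" using h by measurable
      show "energy {0..t} (\<lambda>s. ?h s \<omega>) = ennreal 0"
      proof -
        \<comment> \<open>The integrands may differ at t, which is a Lebesgue null set.\<close>
        have "energy {0..t} (\<lambda>s. ?h s \<omega>) = (\<integral>\<^sup>+ (s::real). 0 \<partial>lborel)"
          by (rule nn_integral_cong_AE, rule AE_mp[OF AE_lborel_singleton[of t]])
            (use eq[OF w] in \<open>auto split: split_indicator\<close>)
        then show ?thesis by simp
      qed
    qed (use t in auto)
    moreover have "(LINT \<omega>|M. iexp (x * (?D t \<omega> - ?D 0 \<omega>))) = (LINT \<omega>|M. iexp (x * ?D t \<omega>))"
    proof (rule integral_cong_AE)
      show "AE \<omega> in M. iexp (x * (?D t \<omega> - ?D 0 \<omega>)) = iexp (x * ?D t \<omega>)"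
        using ito_zero[OF itoD] by eventually_elim simp
      have [measurable]: "?D 0 \<in> borel_measurable M" using T_pos by (intro ito_measurable[OF itoD]) auto
      show "(\<lambda>\<omega>. iexp (x * (?D t \<omega> - ?D 0 \<omega>))) \<in> borel_measurable M" by measurable
    qed measurable
    ultimately show ?thesis by (simp add: prob_space)
  qed
  have "distr M borel (?D t) = return borel 0"
  proof (rule Levy_uniqueness)
    show "real_distribution (distr M borel (?D t))" by (rule real_distribution_distr) measurable
    have "prob_space (return borel (0::real))" by (rule prob_space_return) simp
    then show "real_distribution (return borel (0::real))"
      by (simp add: real_distribution_def real_distribution_axioms_def)
    show "char (distr M borel (?D t)) = char (return borel 0)"
    proof (rule ext)
      fix x
      have "char (distr M borel (?D t)) x = (LINT \<omega>|M. iexp (x * ?D t \<omega>))"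
        unfolding char_def by (rule integral_distr) measurable
      also have "\<dots> = char (return borel 0) x" unfolding ch char_def by (simp add: integral_return)
      finally show "char (distr M borel (?D t)) x = char (return borel 0) x" .
    qed
  qed
  then have "emeasure (distr M borel (?D t)) (- {0}) = 0" by simp
  then have "emeasure M (?D t -` (- {0}) \<inter> space M) = 0" by (subst (asm) emeasure_distr) auto
  then have "?D t -` (- {0}) \<inter> space M \<in> null_sets M" by (auto intro!: null_setsI)
  then have "AE \<omega> in M. ?D t \<omega> = 0" by (rule AE_I') auto
  then show ?thesis by auto
qed

end

section \<open>Conditional laws\<close>

lemma real_distribution_prob_algebra:
  assumes "L \<in> space (prob_algebra borel)" shows "real_distribution L"
  using assms by (simp add: space_prob_algebra real_distribution_def real_distribution_axioms_def sets_eq_imp_space_eq)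

text \<open>By right continuity rational points determine a distribution function. A conditional law
  is fixed on each Borel set only up to a null set, and countably many such null sets can be
  united.\<close>

lemma cdf_le_if_rat:
  assumes "real_distribution L" "real_distribution L'"
    and le: "\<And>q. cdf L' (real_of_rat q) \<le> cdf L (real_of_rat q)"
  shows "cdf L' x \<le> cdf L x"
proof (rule ccontr)
  interpret L: real_distribution L by fact
  interpret L': real_distribution L' by fact
  assume "\<not> cdf L' x \<le> cdf L x"
  then have "\<forall>\<^sub>F y in at_right x. cdf L y < cdf L' x"
    using L.cdf_is_right_cont[of x] by (intro order_tendstoD) (auto simp: continuous_within)
  then obtain b where b: "b > x" "\<And>y. x < y \<Longrightarrow> y < b \<Longrightarrow> cdf L y < cdf L' x"
    by (auto simp: eventually_at_right_field)
  obtain q where q: "x < real_of_rat q" "real_of_rat q < b" using of_rat_dense[OF b(1)] by blast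
  have "cdf L' x \<le> cdf L' (real_of_rat q)" using q by (intro L'.cdf_nondecreasing) auto
  then show False using b(2)[OF q] le[of q] by linarith
qed

lemma measure_eq_if_rat:
  assumes "real_distribution L" "real_distribution L'"
    and eq: "\<And>q. measure L {..real_of_rat q} = measure L' {..real_of_rat q}"
  shows "L = L'"
proof (rule cdf_unique[OF assms(1,2)], rule ext)
  fix x show "cdf L x = cdf L' x"
    using cdf_le_if_rat[OF assms(1,2), of x] cdf_le_if_rat[OF assms(2,1), of x] eq
    by (simp add: cdf_def)
qed

text \<open>The absolute value is the square of \<open>sqrt v\<close>, also for negative v, where
  \<open>sqrt\<close> is extended as an odd function.\<close>

lemma char_normal_affine:
  "(LINT x|std_normal. iexp (y * (m + sqrt v * x))) = iexp (y * m) * of_real (exp (- y\<^sup>2 * \<bar>v\<bar> / 2))"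
proof -
  have "(LINT x|std_normal. iexp (y * (m + sqrt v * x))) =
    (LINT x|std_normal. iexp (y * m) * iexp ((y * sqrt v) * x))"
    by (intro Bochner_Integration.integral_cong refl) (simp add: exp_add[symmetric] algebra_simps)
  also have "\<dots> = iexp (y * m) * char std_normal (y * sqrt v)"
    by (simp add: char_def)
  also have "char std_normal (y * sqrt v) = of_real (exp (- y\<^sup>2 * \<bar>v\<bar> / 2))"
    by (simp add: char_std_normal_distribution power_mult_distrib real_sqrt_power[symmetric] power2_eq_square)
  finally show ?thesis .
qed

text \<open>An affine image of the standard normal law rather than a density, so that v = 0 gives a
  point mass and the law depends measurably on its parameters there too.\<close>

definition normal_law :: "real \<Rightarrow> real \<Rightarrow> real measure" where
  "normal_law m v = distr std_normal borel (\<lambda>x. m + sqrt v * x)"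

lemma measurable_normal_law:
  assumes [measurable]: "m \<in> borel_measurable N" "v \<in> borel_measurable N"
  shows "(\<lambda>\<omega>. normal_law (m \<omega>) (v \<omega>)) \<in> N \<rightarrow>\<^sub>M prob_algebra borel"
  unfolding normal_law_def
proof (rule measurable_distr_prob_space2[where M = borel])
  show "(\<lambda>_. std_normal) \<in> N \<rightarrow>\<^sub>M prob_algebra borel"
    by (rule measurable_const) (simp add: space_prob_algebra prob_space_std_normal)
qed measurable

context market
begin

lemma cond_law_unique:
  assumes "t \<in> {0..T}" "cond_law t Y L" "cond_law t Y L'"
  shows "AE \<omega> in M. L \<omega> = L' \<omega>"
proof -
  have "AE \<omega> in M. measure (L \<omega>) {..real_of_rat q} = measure (L' \<omega>) {..real_of_rat q}" for q
  proof -
    have 1: "AE \<omega> in M. measure (L \<omega>) {..real_of_rat q} =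
        real_cond_exp M (filt t) (indicat_real (Y -` {..real_of_rat q} \<inter> space M)) \<omega>"
      using assms(2) unfolding cond_law_def by auto
    have 2: "AE \<omega> in M. measure (L' \<omega>) {..real_of_rat q} =
        real_cond_exp M (filt t) (indicat_real (Y -` {..real_of_rat q} \<inter> space M)) \<omega>"
      using assms(3) unfolding cond_law_def by auto
    from 1 2 show ?thesis by eventually_elim simp
  qed
  then have "AE \<omega> in M. \<forall>q. measure (L \<omega>) {..real_of_rat q} = measure (L' \<omega>) {..real_of_rat q}"
    by (simp add: AE_all_countable)
  then show ?thesis using AE_space
  proof eventually_elim
    case (elim \<omega>)
    have "L \<omega> \<in> space (prob_algebra borel)" "L' \<omega> \<in> space (prob_algebra borel)"
      using assms(2,3) elim(2) unfolding cond_law_def by (auto dest: measurable_space)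
    then show ?case using elim(1) by (intro measure_eq_if_rat real_distribution_prob_algebra) auto
  qed
qed

text \<open>For each event A known at time t, the law of Y under the probability conditioned on A is
  compared with the mixture of the claimed normal laws. Their characteristic functions agree by the
  exponential identity, and testing over all A identifies the conditional law.\<close>

lemma ito_cond_law:
  assumes ito: "ito_integral h Z" and t: "t \<in> {0..T}"
    and h: "\<And>\<omega>. \<omega> \<in> space M \<Longrightarrow> (\<lambda>s. h s \<omega>) \<in> borel_measurable borel"
    and V: "\<And>\<omega>. \<omega> \<in> space M \<Longrightarrow> energy {t..T} (\<lambda>s. h s \<omega>) = ennreal (V \<omega>)"
      "\<And>\<omega>. \<omega> \<in> space M \<Longrightarrow> 0 \<le> V \<omega> \<and> V \<omega> \<le> B" "V \<in> borel_measurable (filt t)"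
    and m: "m \<in> borel_measurable (filt t)"
    and Y: "AE \<omega> in M. Y \<omega> = m \<omega> + (Z T \<omega> - Z t \<omega>)"
  shows "cond_law t Y (\<lambda>\<omega>. normal_law (m \<omega>) (V \<omega>))"
proof -
  let ?L = "\<lambda>\<omega>. normal_law (m \<omega>) (V \<omega>)" and ?N = std_normal
  have tT: "t \<le> T" and TT: "T \<in> {0..T}" using t by auto
  have [measurable]: "m \<in> borel_measurable M" "V \<in> borel_measurable M"
    by (rule filt_measurable_M[OF tT], fact)+
  have [measurable]: "Z T \<in> borel_measurable M" "Z t \<in> borel_measurable M"
    by (rule ito_measurable[OF ito TT], rule ito_measurable[OF ito t])
  have Ym[measurable]: "Y \<in> borel_measurable M"
  proof (rule measurable_AE_eq)
    show "(\<lambda>\<omega>. m \<omega> + (Z T \<omega> - Z t \<omega>)) \<in> borel_measurable M" by measurable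
    show "AE \<omega> in M. m \<omega> + (Z T \<omega> - Z t \<omega>) = Y \<omega>" using Y by auto
  qed simp
  have L: "?L \<in> filt t \<rightarrow>\<^sub>M prob_algebra borel" by (rule measurable_normal_law[OF m V(3)])
  interpret N: prob_space ?N by (rule prob_space_std_normal)
  interpret sub: finite_measure_subalgebra M "filt t"
    by unfold_locales (rule subalgebra_filt[OF tT])
  have LB: "(\<lambda>\<omega>. measure (?L \<omega>) B) \<in> borel_measurable (filt t)" if "B \<in> sets borel" for B
    by (rule measurable_compose[OF measurable_prob_algebraD[OF L] measurable_measure_subprob_algebra[OF that]])
  have key: "(LINT \<omega>|M. indicat_real A \<omega> * indicat_real B (Y \<omega>)) = (LINT \<omega>|M. indicat_real A \<omega> * measure (?L \<omega>) B)"
    if A: "A \<in> sets (filt t)" and B: "B \<in> sets borel" for A B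
  proof (cases "prob A = 0")
    case True
    have "A \<in> events" using A sets_filt_subset[OF tT] by auto
    then have "AE \<omega> in M. \<omega> \<notin> A"
      using True by (intro AE_not_in null_setsI) (auto simp: emeasure_eq_measure)
    then have "AE \<omega> in M. indicat_real A \<omega> * indicat_real B (Y \<omega>) = 0" "AE \<omega> in M. indicat_real A \<omega> * measure (?L \<omega>) B = 0"
      by (auto elim!: eventually_mono)
    then show ?thesis by (simp add: integral_eq_zero_AE)
  next
    case False
    then have pA: "prob A > 0" using measure_nonneg[of M A] by linarith
    have [measurable]: "A \<in> events" using A sets_filt_subset[OF tT] by auto
    \<comment> \<open>Division by \<open>prob A\<close> makes the reweighted measure a probability,
      as uniqueness of characteristic functions requires; events of probability 0 were handled
      separately.\<close>
    define w where "w \<omega> = indicat_real A \<omega> / prob A" for \<omega>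
    have [measurable]: "w \<in> borel_measurable M" unfolding w_def by measurable
    have w0: "AE \<omega> in M. 0 \<le> w \<omega>" by (simp add: w_def)
    define MA where "MA = density M (\<lambda>\<omega>. ennreal (w \<omega>))"
    have "emeasure MA (space MA) = 1"
    proof -
      have "emeasure MA (space MA) = (\<integral>\<^sup>+ \<omega>. ennreal (1 / prob A) * indicator A \<omega> \<partial>M)"
        unfolding MA_def by (subst emeasure_density)
          (auto simp: w_def intro!: nn_integral_cong split: split_indicator)
      also have "\<dots> = ennreal (1 / prob A) * ennreal (prob A)"
        by (subst nn_integral_cmult_indicator) (auto simp: emeasure_eq_measure)
      also have "\<dots> = 1" using pA by (subst ennreal_mult[symmetric]) auto
      finally show ?thesis .
    qed
    then interpret MA: prob_space MA by (rule prob_spaceI)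
    have [measurable_cong]: "sets MA = sets M" by (simp add: MA_def)
    interpret P: pair_prob_space MA ?N ..
    \<comment> \<open>The claimed mixture, realised on a product space: the second coordinate is a
      standard normal variable independent of everything in M.\<close>
    define f where "f = (\<lambda>(\<omega>, x). m \<omega> + sqrt (V \<omega>) * x)"
    have f[measurable]: "f \<in> borel_measurable (MA \<Otimes>\<^sub>M ?N)" unfolding f_def by measurable
    let ?PN = "MA \<Otimes>\<^sub>M ?N"
    have "distr MA borel Y = distr ?PN borel f"
    proof (rule Levy_uniqueness)
      show "real_distribution (distr MA borel Y)" by (rule MA.real_distribution_distr) measurable
      show "real_distribution (distr ?PN borel f)" by (rule P.real_distribution_distr) measurable
      show "char (distr MA borel Y) = char (distr ?PN borel f)"
      proof (rule ext)
        fix y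
        \<comment> \<open>The part of the integrand known at time t. It carries the reciprocal of
          the martingale factor exp(y^2 V / 2), and it is what remains after the exponential
          identity.\<close>
        let ?c = "\<lambda>\<omega>. complex_of_real (w \<omega>) * iexp (y * m \<omega>) * of_real (exp (- y\<^sup>2 * V \<omega> / 2))"
        have "char (distr MA borel Y) y = (LINT \<omega>|MA. iexp (y * Y \<omega>))"
          unfolding char_def by (rule integral_distr) measurable
        also have "\<dots> = (LINT \<omega>|M. w \<omega> *\<^sub>R iexp (y * Y \<omega>))"
          unfolding MA_def by (rule integral_density[OF _ _ w0]) measurable
        also have "\<dots> = (LINT \<omega>|M. ?c \<omega> * of_real (exp (y\<^sup>2 * V \<omega> / 2)) * iexp (y * (Z T \<omega> - Z t \<omega>)))"
        proof (rule integral_cong_AE)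
          show "AE \<omega> in M. w \<omega> *\<^sub>R iexp (y * Y \<omega>) = ?c \<omega> * of_real (exp (y\<^sup>2 * V \<omega> / 2)) * iexp (y * (Z T \<omega> - Z t \<omega>))"
            using Y
          proof eventually_elim
            case (elim \<omega>)
            have "complex_of_real (exp (- y\<^sup>2 * V \<omega> / 2)) * of_real (exp (y\<^sup>2 * V \<omega> / 2)) = 1"
              by (simp add: exp_minus)
            moreover have "iexp (y * Y \<omega>) = iexp (y * m \<omega>) * iexp (y * (Z T \<omega> - Z t \<omega>))"
              by (simp add: elim exp_add[symmetric] algebra_simps)
            ultimately show ?case by (simp add: scaleR_conv_of_real mult.assoc)
          qed
        qed measurable
        also have "\<dots> = (LINT \<omega>|M. ?c \<omega>)"
        proof (rule ito_exponential[OF ito _ tT order_refl _ _ h V(1,2)])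
          show "?c \<in> borel_measurable (filt t)"
            using A m V(3) unfolding w_def by measurable
          fix \<omega> assume "\<omega> \<in> space M"
          then have "exp (- y\<^sup>2 * V \<omega> / 2) \<le> 1" using V(2) by simp
          moreover have "\<bar>w \<omega>\<bar> \<le> 1 / prob A" by (simp add: w_def split: split_indicator)
          moreover have "norm (?c \<omega>) = \<bar>w \<omega>\<bar> * exp (- y\<^sup>2 * V \<omega> / 2)" by (simp add: norm_mult)
          ultimately show "norm (?c \<omega>) \<le> 1 / prob A * 1"
            using pA by (simp only:) (intro mult_mono, auto)
        qed (use t in auto)
        also have "\<dots> = (LINT \<omega>|M. w \<omega> *\<^sub>R (LINT x|?N. iexp (y * f (\<omega>, x))))"
        proof (rule Bochner_Integration.integral_cong[OF refl])
          fix \<omega> assume "\<omega> \<in> space M"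
          then have "\<bar>V \<omega>\<bar> = V \<omega>" using V(2) by simp
          then show "?c \<omega> = w \<omega> *\<^sub>R (LINT x|?N. iexp (y * f (\<omega>, x)))"
            unfolding f_def prod.case char_normal_affine by (simp add: scaleR_conv_of_real)
        qed
        also have "\<dots> = (LINT \<omega>|MA. LINT x|?N. iexp (y * f (\<omega>, x)))"
          unfolding MA_def by (rule integral_density[symmetric, OF _ _ w0]) (auto simp: f_def)
        also have "\<dots> = integral\<^sup>L ?PN (\<lambda>p. iexp (y * f p))"
          by (rule P.integral_fst'[OF P.integrable_const_bound[where B = 1]]) auto
        also have "\<dots> = char (distr ?PN borel f) y"
          unfolding char_def by (rule integral_distr[symmetric]) measurable
        finally show "char (distr MA borel Y) y = char (distr ?PN borel f) y" .
      qed
    qed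
    then have eq: "(LINT z|distr MA borel Y. indicat_real B z) = (LINT z|distr ?PN borel f. indicat_real B z)"
      by simp
    have "(LINT z|distr MA borel Y. indicat_real B z) = (LINT \<omega>|MA. indicat_real B (Y \<omega>))"
      using B by (intro integral_distr) auto
    also have "\<dots> = (LINT \<omega>|M. w \<omega> *\<^sub>R indicat_real B (Y \<omega>))"
      unfolding MA_def using B by (intro integral_density[OF _ _ w0]) auto
    finally have lhs: "(LINT z|distr MA borel Y. indicat_real B z) = (LINT \<omega>|M. indicat_real A \<omega> * indicat_real B (Y \<omega>)) / prob A"
      by (simp add: w_def)
    have "(LINT z|distr ?PN borel f. indicat_real B z) = integral\<^sup>L ?PN (\<lambda>p. indicat_real B (f p))"
      using B by (intro integral_distr) auto
    also have "\<dots> = (LINT \<omega>|MA. LINT x|?N. indicat_real B (f (\<omega>, x)))"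
    proof (rule P.integral_fst'[symmetric, OF P.integrable_const_bound[where B = 1]])
      show "(\<lambda>p. indicat_real B (f p)) \<in> borel_measurable ?PN" using B by measurable
    qed simp
    also have "\<dots> = (LINT \<omega>|MA. measure (?L \<omega>) B)"
    proof (rule Bochner_Integration.integral_cong[OF refl])
      fix \<omega>
      have "(LINT x|?N. indicat_real B (f (\<omega>, x))) = (LINT z|?L \<omega>. indicat_real B z)"
        unfolding normal_law_def f_def prod.case using B by (intro integral_distr[symmetric]) auto
      also have "\<dots> = measure (?L \<omega>) B" using B by (simp add: normal_law_def)
      finally show "(LINT x|?N. indicat_real B (f (\<omega>, x))) = measure (?L \<omega>) B" .
    qed
    also have "\<dots> = (LINT \<omega>|M. w \<omega> *\<^sub>R measure (?L \<omega>) B)"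
      unfolding MA_def using filt_measurable_M[OF tT LB[OF B]] by (intro integral_density[OF _ _ w0]) auto
    finally have rhs: "(LINT z|distr ?PN borel f. indicat_real B z) = (LINT \<omega>|M. indicat_real A \<omega> * measure (?L \<omega>) B) / prob A"
      by (simp add: w_def)
    show ?thesis using eq lhs rhs pA by simp
  qed
  have "AE \<omega> in M. measure (?L \<omega>) B = real_cond_exp M (filt t) (indicat_real (Y -` B \<inter> space M)) \<omega>"
    if B: "B \<in> sets borel" for B
  proof -
    have [measurable]: "Y -` B \<inter> space M \<in> events" using measurable_sets[OF Ym B] .
    have "AE \<omega> in M. real_cond_exp M (filt t) (indicat_real (Y -` B \<inter> space M)) \<omega> = measure (?L \<omega>) B"
    proof (rule sub.real_cond_exp_charact)
      fix A assume A: "A \<in> sets (filt t)"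
      have "(LINT \<omega>:A|M. indicat_real (Y -` B \<inter> space M) \<omega>) = (LINT \<omega>|M. indicat_real A \<omega> * indicat_real B (Y \<omega>))"
        unfolding set_lebesgue_integral_def
        by (rule Bochner_Integration.integral_cong) (auto split: split_indicator)
      then show "(LINT \<omega>:A|M. indicat_real (Y -` B \<inter> space M) \<omega>) = (LINT \<omega>:A|M. measure (?L \<omega>) B)"
        using key[OF A B] by (simp add: set_lebesgue_integral_def)
    next
      show "integrable M (indicat_real (Y -` B \<inter> space M))"
        by (rule integrable_const_bound[where B = 1]) auto
      show "(\<lambda>\<omega>. measure (?L \<omega>) B) \<in> borel_measurable (filt t)" by (rule LB[OF B])
      show "integrable M (\<lambda>\<omega>. measure (?L \<omega>) B)"
      proof (rule integrable_const_bound[where B = 1])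
        have "prob_space (?L \<omega>)" for \<omega> unfolding normal_law_def by (rule N.prob_space_distr) simp
        then show "AE \<omega> in M. norm (measure (?L \<omega>) B) \<le> 1" by (simp add: prob_space.prob_le_1)
      qed (rule filt_measurable_M[OF tT LB[OF B]])
    qed
    then show ?thesis by auto
  qed
  then show ?thesis unfolding cond_law_def using Ym L by blast
qed

end

section \<open>First-order bounds\<close>

lemma borel_measurable_nth2:
  fixes A :: "'a \<Rightarrow> real^'n^'m"
  assumes "A \<in> borel_measurable N"
  shows "(\<lambda>x. A x $ i $ j) \<in> borel_measurable N"
  by (rule measurable_compose[OF assms borel_measurable_continuous_onI]) (intro continuous_intros)

lemma borel_measurable_matI:
  fixes A :: "'a \<Rightarrow> real^'n::finite^'m::finite"
  assumes "\<And>i j. (\<lambda>x. A x $ i $ j) \<in> borel_measurable N"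
  shows "A \<in> borel_measurable N"
  unfolding borel_measurable_euclidean_space[of A]
  using assms by (auto simp: Basis_vec_def inner_axis)

lemma borel_measurable_vector_matrix[measurable]:
  fixes A :: "'a \<Rightarrow> real^'n::finite^'m::finite"
  assumes A: "A \<in> borel_measurable N" and f[measurable]: "f \<in> borel_measurable N"
  shows "(\<lambda>x. f x v* A x) \<in> borel_measurable N"
proof (rule borel_measurable_vecI)
  show "(\<lambda>x. (f x v* A x) $ i) \<in> borel_measurable N" for i
    unfolding vector_matrix_mult_def vec_lambda_beta
    by (intro borel_measurable_sum borel_measurable_times borel_measurable_nth2[OF A]
        measurable_compose[OF f borel_measurable_nth])
qed

lemma borel_measurable_matrix_vector[measurable]:
  fixes A :: "'a \<Rightarrow> real^'n::finite^'m::finite"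
  assumes A: "A \<in> borel_measurable N" and f[measurable]: "f \<in> borel_measurable N"
  shows "(\<lambda>x. A x *v f x) \<in> borel_measurable N"
proof (rule borel_measurable_vecI)
  show "(\<lambda>x. (A x *v f x) $ i) \<in> borel_measurable N" for i
    unfolding matrix_vector_mult_def vec_lambda_beta
    by (intro borel_measurable_sum borel_measurable_times borel_measurable_nth2[OF A]
        measurable_compose[OF f borel_measurable_nth])
qed

lemma borel_measurable_det:
  fixes A :: "'a \<Rightarrow> real^'n::finite^'n"
  assumes "\<And>i j. (\<lambda>x. A x $ i $ j) \<in> borel_measurable N"
  shows "(\<lambda>x. det (A x)) \<in> borel_measurable N"
  unfolding det_def by (intro borel_measurable_sum borel_measurable_times borel_measurable_prod assms) simp

lemma borel_measurable_transpose[measurable]: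
  fixes A :: "'a \<Rightarrow> real^'n::finite^'m::finite"
  assumes "A \<in> borel_measurable N"
  shows "(\<lambda>x. transpose (A x)) \<in> borel_measurable N"
  by (rule borel_measurable_matI) (simp add: transpose_def borel_measurable_nth2[OF assms])

lemma matrix_inv_mult:
  fixes A :: "'a::semiring_1^'n^'n"
  assumes "invertible A"
  shows "A ** matrix_inv A = mat 1" "matrix_inv A ** A = mat 1"
  using someI_ex[OF assms[unfolded invertible_def]] by (auto simp: matrix_inv_def)

text \<open>For a singular matrix \<open>matrix_inv\<close> is the choice from the empty predicate, hence constant; for
  a regular one Cramer's rule applies.\<close>

lemma borel_measurable_matrix_inv[measurable]:
  fixes A :: "'a \<Rightarrow> real^'n::finite^'n"
  assumes A: "A \<in> borel_measurable N"
  shows "(\<lambda>x. matrix_inv (A x)) \<in> borel_measurable N"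
proof -
  define Z :: "real^'n^'n" where "Z = (SOME B. False)"
  define C where "C x = (\<chi> i j. det (\<chi> r c. if c = i then axis j 1 $ r else A x $ r $ c) / det (A x))" for x
  note [measurable] = borel_measurable_nth2[OF A]
  have [measurable]: "(\<lambda>x. det (A x)) \<in> borel_measurable N" by (rule borel_measurable_det) measurable
  have [measurable]: "C \<in> borel_measurable N"
  proof (rule borel_measurable_matI)
    fix i j
    have [measurable]: "(\<lambda>x. det (\<chi> r c. if c = i then axis j 1 $ r else A x $ r $ c)) \<in> borel_measurable N"
      by (rule borel_measurable_det) simp
    show "(\<lambda>x. C x $ i $ j) \<in> borel_measurable N" unfolding C_def by simp
  qed
  have eq: "matrix_inv (A x) = (if det (A x) = 0 then Z else C x)" for x
  proof (cases "det (A x) = 0")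
    case True
    then have "\<not> invertible (A x)" by (simp add: invertible_det_nz)
    then have "(\<lambda>B. A x ** B = mat 1 \<and> B ** A x = mat 1) = (\<lambda>B. False)" by (auto simp: invertible_def)
    then show ?thesis using True by (simp add: matrix_inv_def Z_def)
  next
    case False
    then have inv: "A x ** matrix_inv (A x) = mat 1" by (simp add: invertible_det_nz matrix_inv_mult)
    have "matrix_inv (A x) $ i $ j = C x $ i $ j" for i j
    proof -
      have "A x *v (matrix_inv (A x) *v axis j 1) = axis j 1" by (simp add: matrix_vector_mul_assoc inv)
      then have "matrix_inv (A x) *v axis j 1 = (\<chi> k. det (\<chi> r c. if c = k then axis j 1 $ r else A x $ r $ c) / det (A x))"
        by (simp only: cramer[OF False])
      then have "(matrix_inv (A x) *v axis j 1) $ i = C x $ i $ j" by (simp add: C_def)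
      then show ?thesis by (simp add: matrix_vector_mul_component inner_axis)
    qed
    then show ?thesis using False by (simp add: vec_eq_iff)
  qed
  have "(\<lambda>x. if det (A x) = 0 then Z else C x) \<in> borel_measurable N" by measurable
  then show ?thesis by (simp only: eq)
qed

text \<open>The bounds are asked only almost everywhere, since ellipticity of the volatility holds
  only there.\<close>

lemma set_integral_bounded:
  fixes f :: "real \<Rightarrow> real"
  assumes [measurable]: "f \<in> borel_measurable borel" and le: "l \<le> h"
    and b: "AE s in lborel. s \<in> {l..<h} \<longrightarrow> \<bar>f s\<bar> \<le> C"
  shows "set_integrable lborel {l..<h} f" "\<bar>LINT s:{l..<h}|lborel. f s\<bar> \<le> C * (h - l)"
    "(AE s in lborel. s \<in> {l..<h} \<longrightarrow> f s \<le> D) \<Longrightarrow> (LINT s:{l..<h}|lborel. f s) \<le> D * (h - l)"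
proof -
  show si: "set_integrable lborel {l..<h} f"
    unfolding set_integrable_def
  proof (rule integrableI_bounded_set[where A = "{l..<h}" and B = C])
    show "AE x in lborel. x \<in> {l..<h} \<longrightarrow> norm (indicat_real {l..<h} x *\<^sub>R f x) \<le> C"
      using b by eventually_elim (auto split: split_indicator)
  qed (use le in \<open>auto simp: less_top[symmetric]\<close>)
  have const: "(LINT s:{l..<h}|lborel. D) = D * (h - l)" "set_integrable lborel {l..<h} (\<lambda>_. D)" for D
    using le by (auto simp: set_lebesgue_integral_def set_integrable_def integrable_const_ivl less_top[symmetric] mult.commute)
  show mono: "(LINT s:{l..<h}|lborel. f s) \<le> D * (h - l)" if "AE s in lborel. s \<in> {l..<h} \<longrightarrow> f s \<le> D" for D
    unfolding const(1)[symmetric] by (rule set_integral_mono_AE[OF si const(2)]) (use that in auto)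
  have "(LINT s:{l..<h}|lborel. f s) \<le> C * (h - l)" by (rule mono) (use b in \<open>auto elim!: eventually_mono\<close>)
  moreover have "- C * (h - l) \<le> (LINT s:{l..<h}|lborel. f s)"
    unfolding const(1)[symmetric]
    by (rule set_integral_mono_AE[OF const(2) si]) (use b in \<open>auto elim!: eventually_mono\<close>)
  ultimately show "\<bar>LINT s:{l..<h}|lborel. f s\<bar> \<le> C * (h - l)" by (simp add: abs_le_iff)
qed

text \<open>Scaling by v reduces this to sqrt(1 + x) >= 1 + x/2 - x^2/2 for x >= -1: a first-order
  expansion with a remainder valid on the whole range, including v + d = 0.\<close>

lemma sqrt_product_ge:
  assumes "v > 0" "v + d \<ge> 0"
  shows "v + d / 2 - d\<^sup>2 / (2 * v) \<le> sqrt (v + d) * sqrt (v::real)"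
proof -
  define x where "x = d / v"
  have d: "d = v * x" and x: "x \<ge> -1" using assms by (auto simp: x_def field_simps)
  have "1 + x / 2 - x\<^sup>2 / 2 \<le> sqrt (1 + x)"
  proof (cases "1 + x / 2 - x\<^sup>2 / 2 \<le> 0")
    case False
    \<comment> \<open>If this product is positive, both factors are, so -1 < x < 2. The term
      subtracted in the squared identity below is then nonnegative.\<close>
    have "1 + x / 2 - x\<^sup>2 / 2 = (1 + x) * (1 - x / 2)" by (simp add: power2_eq_square field_simps)
    with False x have "0 \<le> 1 - x / 2" "1 + x > 0" by (auto simp: zero_less_mult_iff not_le)
    have "(1 + x / 2 - x\<^sup>2 / 2)\<^sup>2 = (1 + x) - (1 + x) * (x\<^sup>2 * (3 - x) / 4)"
      by (simp add: power2_eq_square field_simps)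
    also have "\<dots> \<le> 1 + x" using \<open>1 + x > 0\<close> \<open>0 \<le> 1 - x / 2\<close> by simp
    finally show ?thesis by (rule real_le_rsqrt)
  qed (use x in \<open>simp add: order_trans[OF _ real_sqrt_ge_zero]\<close>)
  then have "v * (1 + x / 2 - x\<^sup>2 / 2) \<le> v * sqrt (1 + x)" using assms by (intro mult_left_mono) auto
  also have "\<dots> = sqrt (v + d) * sqrt v"
  proof -
    have "sqrt (v + d) = sqrt v * sqrt (1 + x)" by (simp add: d real_sqrt_mult[symmetric] algebra_simps)
    then show ?thesis using assms by simp
  qed
  finally show ?thesis using assms by (simp add: d power2_eq_square field_simps)
qed

section \<open>The expansion of H in the variance\<close>

context cara
begin

lemma first_order_bound:
  assumes v: "v > 0" "v + d \<ge> 0"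
  shows "H_fun F (v + d) - H_fun F v \<le> - d / (2 * G_fun F v) + d\<^sup>2 / (2 * v * G_fun F v)"
proof -
  have "- (sqrt (v + d) - sqrt v) * sqrt v \<le> - d / 2 + d\<^sup>2 / (2 * v)"
    using sqrt_product_ge[OF v] v by (simp add: algebra_simps)
  then have "- (sqrt (v + d) - sqrt v) * sqrt v / G_fun F v \<le> (- d / 2 + d\<^sup>2 / (2 * v)) / G_fun F v"
    using G_pos[of v] by (intro divide_right_mono) auto
  also have "\<dots> = - d / (2 * G_fun F v) + d\<^sup>2 / (2 * v * G_fun F v)" 
    using G_pos[of v] v by (simp add: field_simps)
  finally show ?thesis using H_increment_le[of "v + d" v] by linarith
qed

text \<open>For v > 0 half of the tolerance e absorbs the quadratic remainder, as d is of order
  epsilon, and half the uncancelled first-order part. The remainder has v in the denominator, so v =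
  0 is separate: there H cannot increase, and the hypothesis removes the change of mean.\<close>

lemma Limsup_increment_le_0:
  fixes a d :: "real \<Rightarrow> real"
  assumes v: "v \<ge> 0" and \<delta>: "\<delta> > 0"
    and d: "\<And>\<epsilon>. \<epsilon> \<in> {0<..<\<delta>} \<Longrightarrow> v + d \<epsilon> \<ge> 0" "\<And>\<epsilon>. \<epsilon> \<in> {0<..<\<delta>} \<Longrightarrow> \<bar>d \<epsilon>\<bar> \<le> C * \<epsilon>"
    and a: "\<And>e. e > 0 \<Longrightarrow> \<forall>\<^sub>F \<epsilon> in at_right 0. a \<epsilon> - d \<epsilon> / (2 * G_fun F v) \<le> e * \<epsilon>"
    and a0: "v = 0 \<Longrightarrow> \<forall>\<^sub>F \<epsilon> in at_right 0. a \<epsilon> = 0"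
  shows "Limsup (at_right 0) (\<lambda>\<epsilon>. ereal ((a \<epsilon> + H_fun F (v + d \<epsilon>) - H_fun F v) / \<epsilon>)) \<le> 0"
proof -
  have ev: "\<forall>\<^sub>F \<epsilon> in at_right 0. \<epsilon> \<in> {0<..<\<delta>}" using \<delta> by (auto simp: eventually_at_right_field)
  show ?thesis
  proof (cases "v = 0")
    case True
    have "\<forall>\<^sub>F \<epsilon> in at_right 0. ereal ((a \<epsilon> + H_fun F (v + d \<epsilon>) - H_fun F v) / \<epsilon>) \<le> 0"
      using ev a0[OF True]
    proof eventually_elim
      case (elim \<epsilon>)
      have "H_fun F (v + d \<epsilon>) - H_fun F v \<le> 0" using H_increment_le[of "v + d \<epsilon>" v] True by simp
      then show ?case using elim by (auto simp: divide_nonpos_pos)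
    qed
    then show ?thesis by (rule Limsup_bounded)
  next
    case False
    then have v: "v > 0" using v by simp
    define B where "B = C\<^sup>2 / (2 * v * G_fun F v)"
    show ?thesis
    proof (rule ereal_le_epsilon2)
      fix e :: real assume e: "e > 0"
      have "((\<lambda>\<epsilon>. B * \<epsilon>) \<longlongrightarrow> B * 0) (at_right 0)" by (intro tendsto_intros)
      then have "\<forall>\<^sub>F \<epsilon> in at_right 0. B * \<epsilon> < e / 2" using e by (intro order_tendstoD) auto
      moreover have "\<forall>\<^sub>F \<epsilon> in at_right 0. a \<epsilon> - d \<epsilon> / (2 * G_fun F v) \<le> e / 2 * \<epsilon>" using e by (intro a) auto
      ultimately have "\<forall>\<^sub>F \<epsilon> in at_right 0. ereal ((a \<epsilon> + H_fun F (v + d \<epsilon>) - H_fun F v) / \<epsilon>) \<le> ereal e"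
        using ev
      proof eventually_elim
        case (elim \<epsilon>)
        have "(d \<epsilon>)\<^sup>2 \<le> (C * \<epsilon>)\<^sup>2" using d(2)[of \<epsilon>] elim by (metis abs_ge_zero power2_abs power_mono)
        then have "(d \<epsilon>)\<^sup>2 / (2 * v * G_fun F v) \<le> (C * \<epsilon>)\<^sup>2 / (2 * v * G_fun F v)"
          using v G_pos[of v] by (intro divide_right_mono) auto
        also have "\<dots> = (B * \<epsilon>) * \<epsilon>" by (simp add: B_def power2_eq_square)
        also have "\<dots> \<le> e / 2 * \<epsilon>" using elim by (intro mult_right_mono) auto
        finally have "(d \<epsilon>)\<^sup>2 / (2 * v * G_fun F v) \<le> e / 2 * \<epsilon>" .
        moreover have "H_fun F (v + d \<epsilon>) - H_fun F v \<le> - d \<epsilon> / (2 * G_fun F v) + (d \<epsilon>)\<^sup>2 / (2 * v * G_fun F v)"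
          using d(1)[of \<epsilon>] elim v by (intro first_order_bound) auto
        ultimately have "a \<epsilon> + H_fun F (v + d \<epsilon>) - H_fun F v \<le> e / 2 * \<epsilon> + e / 2 * \<epsilon>"
          using elim by linarith
        also have "\<dots> = e * \<epsilon>" by simp
        finally have "a \<epsilon> + H_fun F (v + d \<epsilon>) - H_fun F v \<le> e * \<epsilon>" .
        then show ?case using elim by (simp add: pos_divide_le_eq)
      qed
      then show "Limsup (at_right 0) (\<lambda>\<epsilon>. ereal ((a \<epsilon> + H_fun F (v + d \<epsilon>) - H_fun F v) / \<epsilon>)) \<le> 0 + ereal e"
        by (simp add: Limsup_bounded)
    qed
  qed
qed

end

section \<open>The equilibrium\<close>

context market
begin

text \<open>The coefficients are measurable only on [0, T]. Extension by 0 makes them Borel on the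
  whole line, where the integrals are taken.\<close>

definition theta0 :: "real \<Rightarrow> real^'d" where "theta0 s = indicat_real {0..T} s *\<^sub>R \<theta> s"
definition sigma0 :: "real \<Rightarrow> real^'d^'d" where "sigma0 s = indicat_real {0..T} s *\<^sub>R \<sigma> s"
definition kappa0 :: "real \<Rightarrow> real^'d" where
  "kappa0 s = indicat_real {0..T} s *\<^sub>R (matrix_inv (sigma0 s) *v theta0 s)"

lemma measurable_theta0[measurable]: "theta0 \<in> borel_measurable borel"
  using theta_meas unfolding theta0_def[abs_def] by (subst (asm) borel_measurable_restrict_space_iff) auto

lemma measurable_sigma0[measurable]: "sigma0 \<in> borel_measurable borel"
  using sigma_meas unfolding sigma0_def[abs_def] by (subst (asm) borel_measurable_restrict_space_iff) auto

lemma measurable_kappa0[measurable]: "kappa0 \<in> borel_measurable borel"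
  unfolding kappa0_def[abs_def] by measurable

lemma on_interval: "s \<in> {0..T} \<Longrightarrow> theta0 s = \<theta> s" "s \<in> {0..T} \<Longrightarrow> sigma0 s = \<sigma> s"
  "s \<in> {0..T} \<Longrightarrow> kappa0 s = kappa s"
  by (simp_all add: theta0_def sigma0_def kappa0_def kappa_def)

lemma kappa0_outside: "s \<notin> {0..T} \<Longrightarrow> kappa0 s = 0"
  by (simp add: kappa0_def)

lemma theta0_bounded: obtains K where "K \<ge> 0" "\<And>s. norm (theta0 s) \<le> K"
proof -
  obtain K where K: "\<And>s. s \<in> {0..T} \<Longrightarrow> norm (\<theta> s) \<le> K" using theta_bounded unfolding bounded_iff by blast
  have "norm (theta0 s) \<le> max K 0" for s using K[of s] by (auto simp: theta0_def split: split_indicator)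
  then show ?thesis by (intro that[of "max K 0"]) auto
qed

text \<open>What ellipticity gives at almost every time: the lower bound yields injectivity, hence
  invertibility, and the upper bound is kept. The vector \<open>a v* \<sigma> s\<close> is the
  transpose of \<open>\<sigma> s\<close> applied to a.\<close>

definition regular :: "real \<Rightarrow> real \<Rightarrow> bool" where
  "regular c s \<longleftrightarrow> invertible (\<sigma> s) \<and> (\<forall>a. (norm (a v* \<sigma> s))\<^sup>2 \<le> c * (norm a)\<^sup>2)"

lemma AE_regular: obtains c where "c > 0" "AE s in lborel. s \<in> {0..T} \<longrightarrow> regular c s"
proof -
  obtain c1 c2 where c: "c1 > 0" "c2 > 0" "AE s in lborel. s \<in> {0..T} \<longrightarrow>
     (\<forall>a. c1 * (norm a)\<^sup>2 \<le> (norm (transpose (\<sigma> s) *v a))\<^sup>2 \<and> (norm (transpose (\<sigma> s) *v a))\<^sup>2 \<le> c2 * (norm a)\<^sup>2)"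
    using sigma_elliptic by blast
  have "AE s in lborel. s \<in> {0..T} \<longrightarrow> regular c2 s"
    using c(3)
  proof eventually_elim
    case (elim s)
    show ?case
    proof
      assume s: "s \<in> {0..T}"
      have "inj ((*v) (transpose (\<sigma> s)))"
      proof (rule injI)
        fix x y assume "transpose (\<sigma> s) *v x = transpose (\<sigma> s) *v y"
        then have "transpose (\<sigma> s) *v (x - y) = 0" by (simp only: matrix_vector_mult_diff_distrib right_minus_eq)
        moreover have "c1 * (norm (x - y))\<^sup>2 \<le> (norm (transpose (\<sigma> s) *v (x - y)))\<^sup>2" using elim s by blast
        ultimately have "c1 * (norm (x - y))\<^sup>2 \<le> 0" by simp
        then have "(norm (x - y))\<^sup>2 \<le> 0" using c(1) by (simp add: mult_le_0_iff)
        then show "x = y" by simp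
      qed
      then have "invertible (transpose (\<sigma> s))"
        by (simp only: matrix_left_invertible_injective[symmetric] invertible_left_inverse[symmetric])
      then have "invertible (\<sigma> s)" by (simp add: invertible_det_nz)
      then show "regular c2 s" using elim s by (simp add: regular_def)
    qed
  qed
  then show ?thesis using c(2) that by blast
qed

lemma regular_kappa: "regular c s \<Longrightarrow> \<sigma> s *v kappa s = \<theta> s"
  by (simp add: regular_def kappa_def matrix_vector_mul_assoc matrix_inv_mult)

lemma regular_hedge: "regular c s \<Longrightarrow> (matrix_inv (transpose (\<sigma> s)) *v a) v* \<sigma> s = a"
proof -
  assume "regular c s"
  then have "invertible (transpose (\<sigma> s))" by (simp add: regular_def invertible_det_nz)
  then have "transpose (\<sigma> s) *v (matrix_inv (transpose (\<sigma> s)) *v a) = a"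
    by (simp only: matrix_vector_mul_assoc matrix_inv_mult matrix_vector_mul_lid)
  then show ?thesis by simp
qed

text \<open>The integrand enters only through energies, so it may be changed on null sets of times.
  This lets Borel functions of time replace the volatilities of the strategies.\<close>

lemma ito_integral_cong:
  assumes ito: "ito_integral h Z" and eq: "\<And>\<omega>. \<omega> \<in> space M \<Longrightarrow> AE s in lborel. s \<in> {0..T} \<longrightarrow> h s \<omega> = h' s \<omega>"
  shows "ito_integral h' Z"
proof -
  obtain P J where A: "\<And>m. elementary (P m) (J m)"
    "AE \<omega> in M. (\<lambda>m. energy {0..T} (\<lambda>s. P m s \<omega> - h s \<omega>)) \<longlonglongrightarrow> 0"
    "AE \<omega> in M. uniform_limit {0..T} (\<lambda>m t. J m t \<omega>) (\<lambda>t. Z t \<omega>) sequentially"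
    using ito unfolding ito_integral_altdef by blast
  have "AE \<omega> in M. (\<lambda>m. energy {0..T} (\<lambda>s. P m s \<omega> - h' s \<omega>)) \<longlonglongrightarrow> 0"
    using A(2) AE_space
  proof eventually_elim
    case (elim \<omega>)
    have "energy {0..T} (\<lambda>s. P m s \<omega> - h s \<omega>) = energy {0..T} (\<lambda>s. P m s \<omega> - h' s \<omega>)" for m
      by (rule nn_integral_cong_AE, rule AE_mp[OF eq[OF elim(2)]]) (auto split: split_indicator)
    then show ?case using elim(1) by simp
  qed
  then show ?thesis unfolding ito_integral_altdef using A(1,3) by blast
qed

end

section \<open>Changes of mean and variance under a perturbation\<close>

locale cara_market = market M T k W \<theta> \<sigma> + cara F
  for M :: "'a measure" and T :: real and k :: nat and W :: "'d::finite + nat \<Rightarrow> real \<Rightarrow> 'a \<Rightarrow> real"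
    and \<theta> :: "real \<Rightarrow> real^'d" and \<sigma> :: "real \<Rightarrow> real^'d^'d" and F :: "real \<Rightarrow> real" +
  assumes small: "(\<integral>\<^sup>+ s\<in>{0..T}. ennreal ((norm (kappa s))\<^sup>2) \<partial>lborel) < calG F \<infinity>"
begin

abbreviation c :: "real \<Rightarrow> real" where "c s \<equiv> (norm (kappa0 s))\<^sup>2"

definition V :: "real \<Rightarrow> real" where
  "V t = calG_inv F (\<integral>\<^sup>+ s\<in>{t..T}. ennreal ((norm (kappa s))\<^sup>2) \<partial>lborel)"

lemma small': "(\<integral>\<^sup>+ s\<in>{0..T}. ennreal (c s) \<partial>lborel) < calG F \<infinity>"
proof -
  have "(\<integral>\<^sup>+ s\<in>{0..T}. ennreal (c s) \<partial>lborel) = (\<integral>\<^sup>+ s\<in>{0..T}. ennreal ((norm (kappa s))\<^sup>2) \<partial>lborel)"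
    by (intro nn_integral_cong) (auto simp: on_interval split: split_indicator)
  then show ?thesis using small by simp
qed

lemma c_assms: "c \<in> borel_measurable borel" "\<And>s. 0 \<le> c s" "T > 0"
  using T_pos by simp_all

lemmas tail_energy_eq = tail_energy_def[OF c_assms small'] and tail_variance_eq = tail_variance_def[OF c_assms small']

lemma V_eq:
  assumes "t \<in> {0..T}"
  shows "V t = tail_variance c T t"
proof -
  have "(\<integral>\<^sup>+ s\<in>{t..T}. ennreal ((norm (kappa s))\<^sup>2) \<partial>lborel) = (\<integral>\<^sup>+ s\<in>{t..T}. ennreal (c s) \<partial>lborel)"
    by (intro nn_integral_cong) (use assms in \<open>auto simp: on_interval split: split_indicator\<close>)
  then show ?thesis by (simp add: V_def tail_variance_eq tail_energy_eq)
qed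

lemma V_nonneg: "t \<in> {0..T} \<Longrightarrow> V t \<ge> 0"
  using tail_variance_nonneg[OF c_assms small'] by (simp add: V_eq)

lemma continuous_V: "continuous_on {0..T} V"
  by (rule continuous_on_eq[OF continuous_tail_variance[OF c_assms small']]) (simp add: V_eq)

definition w :: "real \<Rightarrow> real" where "w s = (if s \<in> {0..T} then G_fun F (V s) else 0)"

lemma continuous_w: "continuous_on {0..T} w"
proof -
  have "continuous_on {0..T} (\<lambda>s. G_fun F (V s))"
    by (rule continuous_on_compose2[OF continuous_G continuous_V]) auto
  then show ?thesis by (rule continuous_on_eq) (simp add: w_def)
qed

lemma measurable_w[measurable]: "w \<in> borel_measurable borel"
proof -
  have "continuous_on {0..T} (\<lambda>s. G_fun F (V s))"
    by (rule continuous_on_compose2[OF continuous_G continuous_V]) auto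
  then show ?thesis unfolding w_def[abs_def]
    by (intro borel_measurable_continuous_on_if) auto
qed

lemma w_bounded: obtains B where "B \<ge> 0" "\<And>s. \<bar>w s\<bar> \<le> B"
proof -
  have "bounded (w ` {0..T})"
    by (intro compact_imp_bounded compact_continuous_image continuous_w compact_Icc)
  then obtain B where B: "\<And>s. s \<in> {0..T} \<Longrightarrow> \<bar>w s\<bar> \<le> B" unfolding bounded_iff real_norm_def by blast
  have "\<bar>w s\<bar> \<le> max B 0" for s using B[of s] by (cases "s \<in> {0..T}") (auto simp: w_def)
  then show ?thesis by (intro that[of "max B 0"]) auto
qed

text \<open>The volatility sigma^T pi of the candidate strategy, as a deterministic Borel function
  on the whole line.\<close>

definition p :: "real \<Rightarrow> real^'d" where "p s = w s *\<^sub>R kappa0 s"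

lemma measurable_p[measurable]: "p \<in> borel_measurable borel"
  unfolding p_def[abs_def] by measurable

lemma p_energy:
  assumes t: "t \<in> {0..T}"
  shows "energy {t..T} p = ennreal (V t)"
proof -
  have "energy {t..T} p =
    (\<integral>\<^sup>+ s\<in>{t..T}. ennreal ((G_fun F (tail_variance c T s))\<^sup>2 * c s) \<partial>lborel)"
    using t by (intro nn_integral_cong) (auto simp: p_def w_def V_eq power_mult_distrib split: split_indicator)
  then show ?thesis using tail_variance_equation[OF c_assms small' t] t by (simp add: V_eq)
qed

lemma V_eq_0_theta:
  assumes t: "t \<in> {0..T}" "V t = 0"
  shows "AE s in lborel. s \<in> {t..T} \<longrightarrow> theta0 s = 0"
proof -
  have "tail_energy c T t = 0" using tail_variance_eq_0D[OF c_assms small' t(1)] t by (simp add: V_eq)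
  then have "AE s in lborel. ennreal (c s) * indicator {t..T} s = 0"
    unfolding tail_energy_eq by (subst (asm) nn_integral_0_iff_AE) auto
  moreover obtain c2 where "AE s in lborel. s \<in> {0..T} \<longrightarrow> regular c2 s" by (rule AE_regular)
  ultimately show ?thesis
  proof eventually_elim
    case (elim s)
    show ?case
    proof
      assume s: "s \<in> {t..T}"
      then have "kappa s = 0" "regular c2 s" using elim t by (auto simp: on_interval indicator_def)
      then have "\<theta> s = 0" using regular_kappa[of c2 s] by simp
      then show "theta0 s = 0" by (simp add: theta0_def)
    qed
  qed
qed

definition drift_change :: "real \<Rightarrow> real \<Rightarrow> real^'d \<Rightarrow> real" where
  "drift_change t e a = (LINT s:{t..<t + e}|lborel. theta0 s \<bullet> a)"

text \<open>The difference |p + sigma^T a|^2 - |p|^2: the cross term is 2 w kappa . sigma^T a, and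
  sigma kappa = theta removes the volatility from it.\<close>

abbreviation (input) variance_rate :: "real^'d \<Rightarrow> real \<Rightarrow> real" where
  "variance_rate a s \<equiv> 2 * w s * (theta0 s \<bullet> a) + (norm (a v* sigma0 s))\<^sup>2"

definition variance_change :: "real \<Rightarrow> real \<Rightarrow> real^'d \<Rightarrow> real" where
  "variance_change t e a = (LINT s:{t..<t + e}|lborel. variance_rate a s)"

text \<open>Being linear in e, uniformly over |a| <= R, the bound makes the quadratic remainder in
  the expansion of H of order e^2. It also bounds the conditional variance uniformly when a is a
  random bounded vector.\<close>

lemma variance_change_bound:
  obtains C where "C \<ge> 0" "\<And>t e a. 0 \<le> e \<Longrightarrow> norm a \<le> R \<Longrightarrow> \<bar>variance_change t e a\<bar> \<le> C * e"
    "\<And>t e a. 0 \<le> e \<Longrightarrow>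
       set_integrable lborel {t..<t + e} (variance_rate a)"
proof -
  obtain c2 where c2: "c2 > 0" "AE s in lborel. s \<in> {0..T} \<longrightarrow> regular c2 s" by (rule AE_regular)
  obtain B where B: "B \<ge> 0" "\<And>s. \<bar>w s\<bar> \<le> B" by (rule w_bounded) (rule that)
  obtain K where K: "K \<ge> 0" "\<And>s. norm (theta0 s) \<le> K" by (rule theta0_bounded) (rule that)
  have b: "AE s in lborel. \<bar>variance_rate a s\<bar> \<le> 2 * B * (K * R) + c2 * R\<^sup>2"
    if a: "norm a \<le> R" for a R
    using c2(2)
  proof eventually_elim
    case (elim s)
    have R: "R \<ge> 0" using a norm_ge_zero[of a] by linarith
    have "\<bar>theta0 s \<bullet> a\<bar> \<le> norm (theta0 s) * norm a" by (rule Cauchy_Schwarz_ineq2)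
    also have "\<dots> \<le> K * R" using K a by (intro mult_mono) auto
    finally have "\<bar>w s\<bar> * \<bar>theta0 s \<bullet> a\<bar> \<le> B * (K * R)" using B by (intro mult_mono) auto
    then have 1: "\<bar>2 * w s * (theta0 s \<bullet> a)\<bar> \<le> 2 * B * (K * R)" by (simp add: abs_mult)
    have "(norm (a v* sigma0 s))\<^sup>2 \<le> c2 * R\<^sup>2"
    proof (cases "s \<in> {0..T}")
      case True
      then have "(norm (a v* sigma0 s))\<^sup>2 \<le> c2 * (norm a)\<^sup>2" using elim by (simp add: on_interval regular_def)
      also have "\<dots> \<le> c2 * R\<^sup>2" using a c2(1) by (intro mult_left_mono power_mono) auto
      finally show ?thesis .
    next
      case False
      then show ?thesis using c2(1) by (simp add: sigma0_def vector_matrix_mult_def zero_vec_def[symmetric])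
    qed
    moreover have "\<bar>(norm (a v* sigma0 s))\<^sup>2\<bar> = (norm (a v* sigma0 s))\<^sup>2" by simp
    ultimately show ?case
      using 1 abs_triangle_ineq[of "2 * w s * (theta0 s \<bullet> a)" "(norm (a v* sigma0 s))\<^sup>2"] by linarith
  qed
  show ?thesis
  \<comment> \<open>The absolute value of R keeps the constant nonnegative for every real R.\<close>
  proof (rule that[of "2 * B * (K * \<bar>R\<bar>) + c2 * R\<^sup>2"])
    show "0 \<le> 2 * B * (K * \<bar>R\<bar>) + c2 * R\<^sup>2" using B K c2 by simp
    show "\<bar>variance_change t e a\<bar> \<le> (2 * B * (K * \<bar>R\<bar>) + c2 * R\<^sup>2) * e" if "0 \<le> e" "norm a \<le> R" for t e a
    proof -
      have "norm a \<le> \<bar>R\<bar>" using that by linarith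
      then have "AE s in lborel. s \<in> {t..<t + e} \<longrightarrow> \<bar>variance_rate a s\<bar>
          \<le> 2 * B * (K * \<bar>R\<bar>) + c2 * R\<^sup>2" using b[of a "\<bar>R\<bar>"] by (auto elim!: eventually_mono)
      from set_integral_bounded(2)[OF _ _ this] show ?thesis
        using that by (simp add: variance_change_def)
    qed
    show "set_integrable lborel {t..<t + e} (variance_rate a)"
      if "0 \<le> e" for t e a
      by (rule set_integral_bounded(1)[where C = "2 * B * (K * norm a) + c2 * (norm a)\<^sup>2"])
        (use that b[of a "norm a"] in \<open>auto elim!: eventually_mono\<close>)
  qed
qed

lemma variance_change_integrable:
  assumes "0 \<le> e"
  shows "set_integrable lborel {t..<t + e} (variance_rate a)"
proof -
  obtain C where "\<And>t e a. 0 \<le> e \<Longrightarrow>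
    set_integrable lborel {t..<t + e} (variance_rate a)"
    by (rule variance_change_bound[of 0]) (rule that)
  then show ?thesis using assms .
qed

text \<open>The change of variance alone can be negative; its sum with V t is nonnegative because it
  is the integral of a square.\<close>

lemma perturbed_energy:
  assumes t: "t \<in> {0..<T}" and e: "e \<in> {0<..<T - t}"
  shows "energy {t..T} (\<lambda>s. p s + indicat_real {t..<t + e} s *\<^sub>R (a v* sigma0 s))
       = ennreal (V t + variance_change t e a)"
    and "0 \<le> V t + variance_change t e a"
proof -
  let ?f = "\<lambda>s. variance_rate a s"
  let ?h = "\<lambda>s. p s + indicat_real {t..<t + e} s *\<^sub>R (a v* sigma0 s)"
  have tT: "t \<in> {0..T}" using t by auto
  have "set_integrable lborel {t..<t + e} ?f"
    using e by (intro variance_change_integrable) auto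
  then have i1: "integrable lborel (\<lambda>s. indicat_real {t..<t + e} s *\<^sub>R ?f s)"
    by (simp only: set_integrable_def)
  have eq2: "(\<integral>\<^sup>+ s. ennreal (indicat_real {t..T} s * (norm (p s))\<^sup>2) \<partial>lborel) = ennreal (V t)"
    unfolding p_energy[OF tT, symmetric] by (intro nn_integral_cong) (auto split: split_indicator)
  have i2: "integrable lborel (\<lambda>s. indicat_real {t..T} s * (norm (p s))\<^sup>2)"
    by (rule integrableI_nonneg) (auto simp: eq2)
  have l2: "(LINT s|lborel. indicat_real {t..T} s * (norm (p s))\<^sup>2) = V t"
    by (rule integral_eq_nn_integral[THEN trans]) (auto simp: eq2 V_nonneg[OF tT])
  obtain c2 where c2: "AE s in lborel. s \<in> {0..T} \<longrightarrow> regular c2 s" by (rule AE_regular)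
  have ae: "AE s in lborel. indicat_real {t..T} s * (norm (?h s))\<^sup>2 =
      indicat_real {t..T} s * (norm (p s))\<^sup>2 + indicat_real {t..<t + e} s *\<^sub>R ?f s"
    using c2
  proof eventually_elim
    case (elim s)
    show ?case
    proof (cases "s \<in> {t..<t + e}")
      case True
      then have s: "s \<in> {0..T}" "s \<in> {t..T}" using t e by auto
      have "(a v* sigma0 s) \<bullet> kappa0 s = a \<bullet> (\<sigma> s *v kappa s)"
        using s by (simp add: dot_lmul_matrix on_interval)
      also have "\<dots> = theta0 s \<bullet> a" using elim s regular_kappa[of c2 s] by (simp add: on_interval inner_commute)
      finally have "p s \<bullet> (a v* sigma0 s) = w s * (theta0 s \<bullet> a)"
        by (simp add: p_def inner_commute)
      then have "(norm (p s + a v* sigma0 s))\<^sup>2 = (norm (p s))\<^sup>2 + ?f s"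
        by (simp add: power2_norm_eq_inner inner_add_left inner_add_right inner_commute)
      then show ?thesis using True s by simp
    qed simp
  qed
  have i3: "integrable lborel (\<lambda>s. indicat_real {t..T} s * (norm (?h s))\<^sup>2)"
    by (rule integrable_cong_AE_imp[OF Bochner_Integration.integrable_add[OF i2 i1]]) (use ae in auto)
  have l3: "(LINT s|lborel. indicat_real {t..T} s * (norm (?h s))\<^sup>2) = V t + variance_change t e a"
  proof -
    have "(LINT s|lborel. indicat_real {t..T} s * (norm (?h s))\<^sup>2) =
      (LINT s|lborel. indicat_real {t..T} s * (norm (p s))\<^sup>2 + indicat_real {t..<t + e} s *\<^sub>R ?f s)"
      by (rule integral_cong_AE[OF _ _ ae]) measurable
    also have "\<dots> = V t + variance_change t e a"
      unfolding Bochner_Integration.integral_add[OF i2 i1] l2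
      by (simp add: variance_change_def set_lebesgue_integral_def)
    finally show ?thesis .
  qed
  show "0 \<le> V t + variance_change t e a" unfolding l3[symmetric] by (rule integral_nonneg_AE) auto
  have "energy {t..T} (\<lambda>s. ?h s) =
    (\<integral>\<^sup>+ s. ennreal (indicat_real {t..T} s * (norm (?h s))\<^sup>2) \<partial>lborel)"
    by (intro nn_integral_cong) (auto split: split_indicator)
  also have "\<dots> = ennreal (V t + variance_change t e a)"
    unfolding l3[symmetric] by (rule nn_integral_eq_integral[OF i3]) auto
  finally show "energy {t..T} (\<lambda>s. ?h s) = ennreal (V t + variance_change t e a)" .
qed

text \<open>To first order the gain in drift cancels against \<open>1 / (2 G)\<close> times the gain in variance, because
  \<open>w\<close> is continuous at \<open>t\<close> with value \<open>G (V t)\<close>; what remains of the variance has the right sign.\<close>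

lemma first_order_cancellation:
  assumes t: "t \<in> {0..<T}" and \<eta>: "\<eta> > 0"
  shows "\<forall>\<^sub>F e in at_right 0. drift_change t e a - variance_change t e a / (2 * G_fun F (V t)) \<le> \<eta> * e"
proof -
  obtain K where K: "K \<ge> 0" "\<And>s. norm (theta0 s) \<le> K" by (rule theta0_bounded) (rule that)
  let ?G = "G_fun F (V t)"
  have G: "?G > 0" by (rule G_pos)
  \<comment> \<open>Chosen so that the last bound in the chain below equals \<eta>; the 1 in the
    denominator keeps it positive when K or a is 0.\<close>
  define \<rho> where "\<rho> = \<eta> * ?G / (K * norm a + 1)"
  have den: "K * norm a + 1 > 0" using K by (simp add: add_nonneg_pos)
  have \<rho>: "\<rho> > 0" using \<eta> G den by (simp add: \<rho>_def)
  have wt: "w t = ?G" using t by (simp add: w_def)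
  have "continuous (at t within {0..T}) w"
    using continuous_w t by (auto simp: continuous_on_eq_continuous_within)
  then obtain \<delta> where \<delta>: "\<delta> > 0" "\<And>s. s \<in> {0..T} \<Longrightarrow> dist s t < \<delta> \<Longrightarrow> dist (w s) (w t) < \<rho>"
    using \<rho> unfolding continuous_within_eps_delta by blast
  have ev: "\<forall>\<^sub>F e in at_right 0. e \<in> {0<..<min \<delta> (T - t)}"
    using \<delta>(1) t unfolding eventually_at_right_field by (intro exI[of _ "min \<delta> (T - t)"]) auto
  show ?thesis
    using ev
  proof eventually_elim
    case (elim e)
    then have e: "0 \<le> e" "e < \<delta>" "t + e < T" by auto
    have th: "\<bar>theta0 s \<bullet> a\<bar> \<le> K * norm a" for s
      using Cauchy_Schwarz_ineq2[of "theta0 s" a] mult_right_mono[OF K(2)[of s] norm_ge_zero[of a]] by linarith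
    have si: "set_integrable lborel {t..<t + e} (variance_rate a)"
      by (rule variance_change_integrable[OF e(1)])
    have si': "set_integrable lborel {t..<t + e} (\<lambda>s. theta0 s \<bullet> a)"
      by (rule set_integral_bounded(1)[where C = "K * norm a"]) (use e th in auto)
    have "drift_change t e a - variance_change t e a / (2 * ?G) =
      (LINT s:{t..<t + e}|lborel. theta0 s \<bullet> a - variance_rate a s / (2 * ?G))"
      unfolding drift_change_def variance_change_def
      by (subst set_integral_diff(2)[OF si' set_integrable_divide[OF si]]) auto
    also have "\<dots> \<le> (LINT s:{t..<t + e}|lborel. \<eta>)"
    proof (rule set_integral_mono)
      show "set_integrable lborel {t..<t + e} (\<lambda>s. theta0 s \<bullet> a - variance_rate a s / (2 * ?G))"
        by (intro set_integral_diff(1) si' set_integrable_divide) (use si in auto)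
      show "set_integrable lborel {t..<t + e} (\<lambda>s. \<eta>)"
        by (rule set_integral_bounded(1)[where C = "\<bar>\<eta>\<bar>"]) (use e in auto)
      fix s assume s: "s \<in> {t..<t + e}"
      then have "dist (w s) (w t) < \<rho>" using e t by (intro \<delta>(2)) (auto simp: dist_real_def)
      then have ws: "\<bar>?G - w s\<bar> \<le> \<rho>" by (simp add: wt dist_real_def)
      have "theta0 s \<bullet> a - variance_rate a s / (2 * ?G)
        = (?G - w s) * (theta0 s \<bullet> a) / ?G - (norm (a v* sigma0 s))\<^sup>2 / (2 * ?G)"
        using G by (simp add: field_simps)
      \<comment> \<open>The quadratic cost of the perturbation has a favourable sign and is dropped;
        what is left is small by continuity of w at t.\<close>
      also have "\<dots> \<le> (?G - w s) * (theta0 s \<bullet> a) / ?G" using G by simp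
      also have "\<dots> \<le> \<bar>?G - w s\<bar> * \<bar>theta0 s \<bullet> a\<bar> / ?G"
        using G by (intro divide_right_mono) (auto simp: abs_mult[symmetric])
      also have "\<dots> \<le> \<rho> * (K * norm a + 1) / ?G"
        using G ws th[of s] \<rho> K by (intro divide_right_mono mult_mono) auto
      also have "\<dots> = \<eta>" using G den by (simp add: \<rho>_def)
      finally show "theta0 s \<bullet> a - variance_rate a s / (2 * ?G) \<le> \<eta>" .
    qed
    also have "\<dots> = \<eta> * e"
      using e by (simp add: set_lebesgue_integral_def mult.commute)
    finally show ?case .
  qed
qed

end

lemma vector_matrix_scaleR_left: "(c *\<^sub>R x) v* (A :: real^'n^'m) = c *\<^sub>R (x v* A)"
  by (simp add: vec_eq_iff vector_matrix_mult_def sum_distrib_left mult_ac)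

lemma vector_matrix_add_left: "(x + y) v* (A :: real^'n^'m) = x v* A + y v* A"
  by (simp add: vec_eq_iff vector_matrix_mult_def sum.distrib distrib_left distrib_right)

section \<open>Verification of the equilibrium property\<close>

context cara_market
begin

context
  fixes \<pi> :: "real \<Rightarrow> 'a \<Rightarrow> real^'d"
  assumes \<pi>: "\<And>t \<omega>. t \<in> {0..<T} \<Longrightarrow> \<omega> \<in> space M \<Longrightarrow>
    \<pi> t \<omega> = G_fun F (V t) *\<^sub>R (matrix_inv (transpose (\<sigma> t)) *v kappa t)"
begin

lemma equilibrium_volatility:
  assumes "\<omega> \<in> space M"
  shows "AE s in lborel. s \<in> {0..T} \<longrightarrow> \<pi> s \<omega> v* \<sigma> s = p s \<and> \<pi> s \<omega> \<bullet> \<theta> s = w s * c s"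
proof -
  obtain c2 where c2: "AE s in lborel. s \<in> {0..T} \<longrightarrow> regular c2 s" by (rule AE_regular)
  \<comment> \<open>The strategy is prescribed on [0, T) only, so the end point T is discarded as a
    null set.\<close>
  from c2 AE_lborel_singleton[of T] show ?thesis
  proof eventually_elim
    case (elim s)
    show ?case
    proof
      assume s: "s \<in> {0..T}"
      then have reg: "regular c2 s" and s': "s \<in> {0..<T}" using elim by auto
      have e: "\<pi> s \<omega> v* \<sigma> s = p s"
        using \<pi>[OF s' assms] s by (simp add: vector_matrix_scaleR_left regular_hedge[OF reg] p_def w_def on_interval)
      have "\<pi> s \<omega> \<bullet> \<theta> s = (\<pi> s \<omega> v* \<sigma> s) \<bullet> kappa s"
        by (simp only: dot_lmul_matrix regular_kappa[OF reg])
      then have "\<pi> s \<omega> \<bullet> \<theta> s = w s * c s"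
        using s by (simp add: e p_def on_interval power2_norm_eq_inner)
      with e show "\<pi> s \<omega> v* \<sigma> s = p s \<and> \<pi> s \<omega> \<bullet> \<theta> s = w s * c s" by simp
    qed
  qed
qed

text \<open>The drift rate of the candidate is w |kappa|^2, hence deterministic. It is integrable
  because w is bounded and the total energy of kappa is finite.\<close>

lemma equilibrium_drift:
  assumes \<omega>: "\<omega> \<in> space M"
  shows "set_integrable lborel {0..T} (\<lambda>s. \<pi> s \<omega> \<bullet> \<theta> s)"
    and "(LINT s:{0..T}|lborel. \<pi> s \<omega> \<bullet> \<theta> s) = (LINT s|lborel. w s * c s)"
proof -
  let ?f = "\<lambda>s. indicat_real {0..T} s *\<^sub>R (\<pi> s \<omega> \<bullet> \<theta> s)"
  have c0: "c s = indicat_real {0..T} s * c s" for s using kappa0_outside[of s] by (auto split: split_indicator)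
  have ic: "integrable lborel c"
  proof (rule integrableI_nonneg)
    have "(\<integral>\<^sup>+ s. ennreal (c s) \<partial>lborel) = (\<integral>\<^sup>+ s\<in>{0..T}. ennreal (c s) \<partial>lborel)"
      using kappa0_outside by (intro nn_integral_cong) (auto split: split_indicator)
    also have "\<dots> < \<infinity>" using small' by (rule order_less_le_trans) simp
    finally show "(\<integral>\<^sup>+ s. ennreal (c s) \<partial>lborel) < \<infinity>" .
  qed auto
  obtain B where B: "\<And>s. \<bar>w s\<bar> \<le> B" by (rule w_bounded) (rule that)
  have iwc: "integrable lborel (\<lambda>s. w s * c s)"
    by (rule Bochner_Integration.integrable_bound[OF integrable_mult_right[OF ic, of B]])
      (auto simp: abs_mult intro!: AE_I2 mult_right_mono order_trans[OF B])
  have meas: "?f \<in> borel_measurable borel"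
  proof -
    \<comment> \<open>The value at T is arbitrary. Splitting it off leaves an explicit Borel
      expression, which gives measurability of the path in time.\<close>
    have eq: "?f s = (if s = T then ?f T else
       indicat_real {0..T} s * ((w s *\<^sub>R (matrix_inv (transpose (sigma0 s)) *v kappa0 s)) \<bullet> theta0 s))" for s
      using \<pi>[OF _ \<omega>, of s] by (auto simp: on_interval w_def split: split_indicator)
    have "(\<lambda>s. if s = T then ?f T else
       indicat_real {0..T} s * ((w s *\<^sub>R (matrix_inv (transpose (sigma0 s)) *v kappa0 s)) \<bullet> theta0 s)) \<in> borel_measurable borel"
      by measurable
    then show ?thesis by (subst eq)
  qed
  have ae: "AE s in lborel. ?f s = w s * c s"
    using equilibrium_volatility[OF \<omega>]
  proof eventually_elim
    case (elim s)
    then show ?case using kappa0_outside[of s] by (cases "s \<in> {0..T}") auto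
  qed
  show "set_integrable lborel {0..T} (\<lambda>s. \<pi> s \<omega> \<bullet> \<theta> s)"
    unfolding set_integrable_def by (rule integrable_cong_AE_imp[OF iwc]) (use meas ae in auto)
  show "(LINT s:{0..T}|lborel. \<pi> s \<omega> \<bullet> \<theta> s) = (LINT s|lborel. w s * c s)"
    unfolding set_lebesgue_integral_def by (rule integral_cong_AE) (use meas ae in auto)
qed

lemma perturbed_drift:
  assumes \<omega>: "\<omega> \<in> space M" and t: "t \<in> {0..<T}" and e: "e \<in> {0<..<T - t}"
  shows "(LINT s:{0..T}|lborel. perturbed \<pi> t e \<phi> s \<omega> \<bullet> \<theta> s) = (LINT s|lborel. w s * c s) + drift_change t e (\<phi> \<omega>)"
proof -
  let ?g = "\<lambda>s. indicat_real {t..<t + e} s * (\<phi> \<omega> \<bullet> \<theta> s)"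
  have eq: "indicat_real {0..T} s *\<^sub>R ?g s = indicat_real {t..<t + e} s *\<^sub>R (theta0 s \<bullet> \<phi> \<omega>)" for s
    using t e by (auto simp: on_interval inner_commute split: split_indicator)
  obtain K where K: "K \<ge> 0" "\<And>s. norm (theta0 s) \<le> K" by (rule theta0_bounded) (rule that)
  have "\<bar>theta0 s \<bullet> \<phi> \<omega>\<bar> \<le> K * norm (\<phi> \<omega>)" for s
    using Cauchy_Schwarz_ineq2[of "theta0 s" "\<phi> \<omega>"] mult_right_mono[OF K(2)[of s] norm_ge_zero[of "\<phi> \<omega>"]] by linarith
  then have "set_integrable lborel {t..<t + e} (\<lambda>s. theta0 s \<bullet> \<phi> \<omega>)"
    using e by (intro set_integral_bounded(1)[where C = "K * norm (\<phi> \<omega>)"]) auto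
  then have g: "set_integrable lborel {0..T} ?g" "(LINT s:{0..T}|lborel. ?g s) = drift_change t e (\<phi> \<omega>)"
    unfolding set_integrable_def set_lebesgue_integral_def eq drift_change_def by auto
  have "(LINT s:{0..T}|lborel. perturbed \<pi> t e \<phi> s \<omega> \<bullet> \<theta> s) = (LINT s:{0..T}|lborel. \<pi> s \<omega> \<bullet> \<theta> s + ?g s)"
    by (simp add: perturbed_def inner_add_left)
  also have "\<dots> = (LINT s|lborel. w s * c s) + drift_change t e (\<phi> \<omega>)"
    by (subst set_integral_add(2)[OF equilibrium_drift(1)[OF \<omega>] g(1)]) (simp add: equilibrium_drift(2)[OF \<omega>] g(2))
  finally show ?thesis .
qed

lemma perturbed_volatility:
  assumes \<omega>: "\<omega> \<in> space M" and t: "t \<in> {0..<T}" and e: "e \<in> {0<..<T - t}"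
  shows "AE s in lborel. s \<in> {0..T} \<longrightarrow>
    transpose (\<sigma> s) *v perturbed \<pi> t e \<phi> s \<omega> = p s + indicat_real {t..<t + e} s *\<^sub>R (\<phi> \<omega> v* sigma0 s)"
  using equilibrium_volatility[OF \<omega>]
  by eventually_elim
    (simp add: perturbed_def vector_matrix_add_left vector_matrix_scaleR_left on_interval)

lemma equilibrium:
  assumes adm: "admissible x\<^sub>0 \<P>\<^sub>0 \<pi>"
  shows "type_I_equilibrium x\<^sub>0 \<P>\<^sub>0 (betweenness F) \<pi>"
  unfolding type_I_equilibrium_def
proof (intro conjI adm ballI impI allI)
  fix t \<phi> \<delta> X X\<^sub>\<epsilon> L
  assume t: "t \<in> {0..<T}" and \<phi>: "\<phi> \<in> borel_measurable (filt t)" "bounded (\<phi> ` space M)" and \<delta>: "\<delta> \<in> {0<..T - t}"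
    and X: "wealth x\<^sub>0 \<pi> X" and L: "cond_law t (X T) L"
    and XE: "\<forall>\<epsilon>\<in>{0<..<\<delta>}. wealth x\<^sub>0 (perturbed \<pi> t \<epsilon> \<phi>) (X\<^sub>\<epsilon> \<epsilon>)"
  have tT: "t \<in> {0..T}" "t \<le> T" and TT: "T \<in> {0..T}" using t by auto
  note [measurable] = \<phi>(1)
  let ?d0 = "LINT s|lborel. w s * c s"
  let ?h = "\<lambda>e s \<omega>. p s + indicat_real {t..<t + e} s *\<^sub>R (\<phi> \<omega> v* sigma0 s)"
  let ?DC = "\<lambda>e \<omega>. drift_change t e (\<phi> \<omega>)" and ?VC = "\<lambda>e \<omega>. variance_change t e (\<phi> \<omega>)"
  obtain R where R: "\<And>\<omega>. \<omega> \<in> space M \<Longrightarrow> norm (\<phi> \<omega>) \<le> R" using \<phi>(2) unfolding bounded_iff by blast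
  obtain C where C: "C \<ge> 0" "\<And>t e a. 0 \<le> e \<Longrightarrow> norm a \<le> R \<Longrightarrow> \<bar>variance_change t e a\<bar> \<le> C * e"
    by (rule variance_change_bound[of R]) (rule that)
  obtain Z where Z: "ito_integral (\<lambda>s \<omega>. transpose (\<sigma> s) *v \<pi> s \<omega>) Z"
    "AE \<omega> in M. \<forall>t\<in>{0..T}. X t \<omega> = x\<^sub>0 + (LINT s:{0..t}|lborel. \<pi> s \<omega> \<bullet> \<theta> s) + Z t \<omega>"
    using X unfolding wealth_def by blast
  have itoZ: "ito_integral (\<lambda>s \<omega>. p s) Z"
  proof (rule ito_integral_cong[OF Z(1)])
    fix \<omega> assume "\<omega> \<in> space M"
    from equilibrium_volatility[OF this]
    show "AE s in lborel. s \<in> {0..T} \<longrightarrow> transpose (\<sigma> s) *v \<pi> s \<omega> = p s" by eventually_elim simp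
  qed
  have XT: "AE \<omega> in M. X T \<omega> = x\<^sub>0 + ?d0 + Z T \<omega>"
    using Z(2) AE_space
  proof eventually_elim
    case (elim \<omega>)
    then show ?case using TT equilibrium_drift(2)[of \<omega>] by auto
  qed
  obtain Z0 where Z0[measurable]: "Z0 \<in> borel_measurable (filt t)" and Zt: "AE \<omega> in M. Z t \<omega> = Z0 \<omega>"
    by (rule ito_adapted_version[OF itoZ tT(1)])
  \<comment> \<open>The conditional mean under the candidate: the whole drift is deterministic, and
    the stochastic integral up to t is replaced by an adapted version.\<close>
  define m where "m \<omega> = x\<^sub>0 + ?d0 + Z0 \<omega>" for \<omega>
  have m[measurable]: "m \<in> borel_measurable (filt t)" unfolding m_def by measurable
  \<comment> \<open>The versions required by the equilibrium condition, written down for every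
    epsilon at once. Only L, which is given, has to be identified outside one null set.\<close>
  define LE where "LE e \<omega> = normal_law (m \<omega> + ?DC e \<omega>) (V t + ?VC e \<omega>)" for e \<omega>
  have "cond_law t (X T) (\<lambda>\<omega>. normal_law (m \<omega>) (V t))"
  proof (rule ito_cond_law[OF itoZ tT(1) _ p_energy[OF tT(1)]])
    show "AE \<omega> in M. X T \<omega> = m \<omega> + (Z T \<omega> - Z t \<omega>)"
      using XT Zt by eventually_elim (simp add: m_def)
    show "0 \<le> V t \<and> V t \<le> V t" using V_nonneg[OF tT(1)] by simp
  qed auto
  then have Leq: "AE \<omega> in M. L \<omega> = normal_law (m \<omega>) (V t)" by (rule cond_law_unique[OF tT(1) L])
  have cond: "cond_law t (X\<^sub>\<epsilon> e T) (LE e)" if e: "e \<in> {0<..<\<delta>}" for e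
  proof -
    have e': "e \<in> {0<..<T - t}" using e \<delta> by auto
    obtain ZE where ZE: "ito_integral (\<lambda>s \<omega>. transpose (\<sigma> s) *v perturbed \<pi> t e \<phi> s \<omega>) ZE"
      "AE \<omega> in M. \<forall>r\<in>{0..T}. X\<^sub>\<epsilon> e r \<omega> = x\<^sub>0 + (LINT s:{0..r}|lborel. perturbed \<pi> t e \<phi> s \<omega> \<bullet> \<theta> s) + ZE r \<omega>"
      using bspec[OF XE e] unfolding wealth_def by blast
    have itoE: "ito_integral (?h e) ZE"
      by (rule ito_integral_cong[OF ZE(1) perturbed_volatility[OF _ t e']])
    have hm: "(\<lambda>s. ?h e s \<omega>) \<in> borel_measurable borel" for \<omega> by measurable
    have XET: "AE \<omega> in M. X\<^sub>\<epsilon> e T \<omega> = x\<^sub>0 + ?d0 + ?DC e \<omega> + ZE T \<omega>"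
      using ZE(2) AE_space
    proof eventually_elim
      case (elim \<omega>)
      then show ?case using TT perturbed_drift[OF _ t e', of \<omega> \<phi>] by auto
    qed
    \<comment> \<open>The perturbation starts at t, so both stochastic integrals have the same
      integrand on [0, t), although their approximating sequences are unrelated.\<close>
    have ZEt: "AE \<omega> in M. ZE t \<omega> = Z t \<omega>"
      by (rule ito_integral_unique[OF itoE itoZ hm _ tT(1)]) auto
    show ?thesis
      unfolding LE_def
    \<comment> \<open>The conditional variance is random through \<phi>; boundedness of \<phi>
      supplies the uniform bound that the exponential identity needs.\<close>
    proof (rule ito_cond_law[OF itoE tT(1) hm perturbed_energy(1)[OF t e'], where B = "V t + C * e"])
      show "0 \<le> V t + ?VC e \<omega> \<and> V t + ?VC e \<omega> \<le> V t + C * e" if "\<omega> \<in> space M" for \<omega>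
        using perturbed_energy(2)[OF t e'] C(2)[of e "\<phi> \<omega>" t] R[OF that] e by (auto simp: abs_le_iff)
      show "(\<lambda>\<omega>. V t + ?VC e \<omega>) \<in> borel_measurable (filt t)"
        unfolding variance_change_def set_lebesgue_integral_def by measurable
      show "(\<lambda>\<omega>. m \<omega> + ?DC e \<omega>) \<in> borel_measurable (filt t)"
        unfolding drift_change_def set_lebesgue_integral_def by measurable
      show "AE \<omega> in M. X\<^sub>\<epsilon> e T \<omega> = m \<omega> + ?DC e \<omega> + (ZE T \<omega> - ZE t \<omega>)"
        using XET ZEt Zt by eventually_elim (simp add: m_def)
    qed
  qed
  have lim: "AE \<omega> in M. Limsup (at_right 0) (\<lambda>\<epsilon>. ereal ((betweenness F (LE \<epsilon> \<omega>) - betweenness F (L \<omega>)) / \<epsilon>)) \<le> 0"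
    using Leq AE_space
  proof eventually_elim
    case (elim \<omega>)
    have b: "betweenness F (LE \<epsilon> \<omega>) - betweenness F (L \<omega>) =
        ?DC \<epsilon> \<omega> + H_fun F (V t + ?VC \<epsilon> \<omega>) - H_fun F (V t)" for \<epsilon>
      by (simp add: elim(1) LE_def normal_law_def betweenness_normal)
    show ?case
      unfolding b
    proof (rule Limsup_increment_le_0[where \<delta> = "T - t" and C = C])
      show "V t \<ge> 0" by (rule V_nonneg[OF tT(1)])
      show "T - t > 0" using t by simp
      show "V t + ?VC e \<omega> \<ge> 0" if "e \<in> {0<..<T - t}" for e by (rule perturbed_energy(2)[OF t that])
      show "\<bar>?VC e \<omega>\<bar> \<le> C * e" if "e \<in> {0<..<T - t}" for e
        using that R[OF elim(2)] by (intro C(2)) auto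
      show "\<forall>\<^sub>F \<epsilon> in at_right 0. ?DC \<epsilon> \<omega> - ?VC \<epsilon> \<omega> / (2 * G_fun F (V t)) \<le> \<eta> * \<epsilon>" if "\<eta> > 0" for \<eta>
        by (rule first_order_cancellation[OF t that])
      assume V0: "V t = 0"
      have "\<forall>\<^sub>F e in at_right 0. e \<in> {0<..<T - t}"
        using t unfolding eventually_at_right_field by (intro exI[of _ "T - t"]) auto
      then show "\<forall>\<^sub>F e in at_right 0. ?DC e \<omega> = 0"
      proof eventually_elim
        case (elim e)
        show ?case
          unfolding drift_change_def set_lebesgue_integral_def
        proof (rule integral_eq_zero_AE)
          show "AE s in lborel. indicat_real {t..<t + e} s *\<^sub>R (theta0 s \<bullet> \<phi> \<omega>) = 0"
            using V_eq_0_theta[OF tT(1) V0]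
            by eventually_elim (use elim in \<open>auto split: split_indicator\<close>)
        qed
      qed
    qed
  qed
  show "\<exists>L\<^sub>\<epsilon>. (\<forall>\<epsilon>\<in>{0<..<\<delta>}. cond_law t (X\<^sub>\<epsilon> \<epsilon> T) (L\<^sub>\<epsilon> \<epsilon>)) \<and>
     (AE \<omega> in M. Limsup (at_right 0) (\<lambda>\<epsilon>. ereal ((betweenness F (L\<^sub>\<epsilon> \<epsilon> \<omega>) - betweenness F (L \<omega>)) / \<epsilon>)) \<le> 0)"
    using cond lim by blast
qed

end

end

theorem theorem5p1:
  fixes M :: "'a measure" and T x\<^sub>0 :: real and k :: nat
    and W :: "'d::finite + nat \<Rightarrow> real \<Rightarrow> 'a \<Rightarrow> real"
    and \<theta> :: "real \<Rightarrow> real^'d" and \<sigma> :: "real \<Rightarrow> real^'d^'d"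
    and F :: "real \<Rightarrow> real" and \<P>\<^sub>0 :: "real measure set"
    and \<pi> :: "real \<Rightarrow> 'a \<Rightarrow> real^'d"
  assumes "market M T k W \<theta> \<sigma>"
    and "assumption_F F" and "assumption_P F \<P>\<^sub>0" and "assumption_U F"
    and "calG F \<infinity> > (\<integral>\<^sup>+ s\<in>{0..T}. ennreal ((norm (market.kappa \<theta> \<sigma> s))\<^sup>2) \<partial>lborel)"
    and "\<And>t \<omega>. t \<in> {0..<T} \<Longrightarrow> \<omega> \<in> space M \<Longrightarrow>
      \<pi> t \<omega> = G_fun F (calG_inv F (\<integral>\<^sup>+ s\<in>{t..T}. ennreal ((norm (market.kappa \<theta> \<sigma> s))\<^sup>2) \<partial>lborel))
        *\<^sub>R (matrix_inv (transpose (\<sigma> t)) *v market.kappa \<theta> \<sigma> t)"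
    and "market.admissible M T k W \<theta> \<sigma> x\<^sub>0 \<P>\<^sub>0 \<pi>"
  shows "market.type_I_equilibrium M T k W \<theta> \<sigma> x\<^sub>0 \<P>\<^sub>0 (betweenness F) \<pi>"
proof -
  interpret market M T k W \<theta> \<sigma> by fact
  interpret cara_market M T k W \<theta> \<sigma> F
    by unfold_locales (use assms(2,5) in auto)
  show ?thesis
    by (rule equilibrium[OF _ assms(7)]) (use assms(6) in \<open>simp add: V_def\<close>)
qed

end
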